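(* Let $K$ be a countable field. Then a construction datum over $K$ (as defined in the context) exists, and for every construction datum over $K$, with associated subspace $E\subseteq \overline{A}$ (a two-sided ideal of $\overline{A}$), the finitely generated $K$-algebra $\overline{A}/E$ (without unit) is nil, is not nilpotent, and has Gelfand-Kirillov dimension not exceeding $20$.
   Context: $A=K\langle x,y,z\rangle$ is the free associative unital $K$-algebra in three non-commuting indeterminates. $M(n)$ is the set of monomials (words) of degree $n$ in $x,y,z$ (so $M(0)=\{1\}$), and $H(n)$ is the $K$-span of $M(n)$. $\overline{A}$ is the (non-unital) subalgebra of $A$ of polynomials with zero constant term. For subspaces $P,Q$ of $A$, $PQ$ denotes the span of all products $pq$, $p\in P$, $q\in Q$. For $n\ge 1$ and a subset $X\subseteq A$, $B_n(X)=\sum_{k=0}^\infty M(nk)XA$ (a right ideal of $A$). Put $S=\bigcup_{i\ge 5}\{2^i-i-1,\,2^i-i,\ldots,2^i-1\}\subseteq\mathbb{N}$. A construction datum over $K$ consists of: (a) a set $Z\subseteq\mathbb{N}$ all of whose elements are $\ge 5$, and an enumeration $\overline{A}=\{f_i\}_{i\in Z}$ such that $2^{2^i}>3^{6t_i}$ for each $i\in Z$, where $t_i=\deg f_i$; (b) for each $i\in Z$, a $K$-subspace $F_i\subseteq H(2^{2^i})$ with $\dim_K F_i<2^{2^{i+1}}-2$ such that the two-sided ideal of $A$ generated by $f_i^{10w_i}$ is contained in $B_{w_i}(F_i)$, where $w_i=4\cdot 2^{2^i}$; (c) for each $n\ge 0$, $K$-subspaces $U(2^n),V(2^n)\subseteq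 H(2^n)$ with $V(1)=Kx+Ky$, $U(1)=Kz$, such that for all $n\ge 0$: 1. $\dim_K V(2^n)=2$ if $n\notin S$; 2. $\dim_K V(2^{2^i-i-1+j})=2^{2^j}$ for all $i\ge 5$ and $0\le j\le i$; 3. $V(2^n)$ is spanned by monomials; 4. $F_i\subseteq U(2^{2^i})$ for every $i\in Z$; 5. $V(2^n)+U(2^n)=H(2^n)$ and $V(2^n)\cap U(2^n)=0$; 6. $H(2^n)U(2^n)+U(2^n)H(2^n)\subseteq U(2^{n+1})$; 7. $V(2^{n+1})\subseteq V(2^n)V(2^n)$. Given a construction datum, for $n\ge 1$ let $m$ be the natural number with $2^m\le n<2^{m+1}$, and let $E(n)$ be the set of $r\in H(n)$ such that for all $0\le j\le 2^{m+2}-n$, $$H(j)\,r\,H(2^{m+2}-j-n)\subseteq U(2^{m+1})H(2^{m+1})+H(2^{m+1})U(2^{m+1}).$$ Set $E=E(1)+E(2)+\cdots$. An algebra is nil if each of its elements is nilpotent; a (non-unital) algebra $R$ is nilpotent if $R^k=0$ for some $k$. *)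

theory Defs
  imports
    "HOL-Algebra.QuotRing"
    "Jordan_Normal_Form.VS_Connect"
    "HOL-Library.Poly_Mapping"
    "HOL-Library.Set_Algebras"
    "HOL-Library.Extended_Real"
begin

section \<open>Associative algebras without unit\<close>

text \<open>
  Algebras are records of type \<^type>\<open>module\<close>; the field \<open>one\<close> of the record is never used.
\<close>

locale assoc_algebra = vectorspace K R for K and R (structure) +
  assumes mult_closed: "\<lbrakk>x \<in> carrier R; y \<in> carrier R\<rbrakk> \<Longrightarrow> x \<otimes> y \<in> carrier R"
    and mult_assoc: "\<lbrakk>x \<in> carrier R; y \<in> carrier R; z \<in> carrier R\<rbrakk>
      \<Longrightarrow> (x \<otimes> y) \<otimes> z = x \<otimes> (y \<otimes> z)"
    and mult_distrib_right: "\<lbrakk>x \<in> carrier R; y \<in> carrier R; z \<in> carrier R\<rbrakk>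
      \<Longrightarrow> (x \<oplus> y) \<otimes> z = x \<otimes> z \<oplus> y \<otimes> z"
    and mult_distrib_left: "\<lbrakk>x \<in> carrier R; y \<in> carrier R; z \<in> carrier R\<rbrakk>
      \<Longrightarrow> x \<otimes> (y \<oplus> z) = x \<otimes> y \<oplus> x \<otimes> z"
    and smult_mult_left: "\<lbrakk>c \<in> carrier K; x \<in> carrier R; y \<in> carrier R\<rbrakk>
      \<Longrightarrow> (c \<odot> x) \<otimes> y = c \<odot> (x \<otimes> y)"
    and smult_mult_right: "\<lbrakk>c \<in> carrier K; x \<in> carrier R; y \<in> carrier R\<rbrakk>
      \<Longrightarrow> x \<otimes> (c \<odot> y) = c \<odot> (x \<otimes> y)"
begin

text \<open>In the absence of a unit, \<open>elt_pow x n\<close> and \<open>sub_pow V n\<close> are the intended powers only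
  for \<open>n \<ge> 1\<close>.\<close>

definition elt_pow :: "'c \<Rightarrow> nat \<Rightarrow> 'c"
  where "elt_pow x n = ((\<lambda>y. y \<otimes> x) ^^ (n - 1)) x"

definition sub_prod :: "'c set \<Rightarrow> 'c set \<Rightarrow> 'c set"
  where "sub_prod P Q = span {p \<otimes> q | p q. p \<in> P \<and> q \<in> Q}"

definition sub_pow :: "'c set \<Rightarrow> nat \<Rightarrow> 'c set"
  where "sub_pow V n = ((\<lambda>W. sub_prod W V) ^^ (n - 1)) V"

definition two_sided_ideal :: "'c set \<Rightarrow> bool"
  where "two_sided_ideal I \<longleftrightarrow> VectorSpace.subspace K I R \<and>
    (\<forall>x\<in>carrier R. \<forall>i\<in>I. x \<otimes> i \<in> I \<and> i \<otimes> x \<in> I)"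

definition subalgebra :: "'c set \<Rightarrow> bool"
  where "subalgebra B \<longleftrightarrow> VectorSpace.subspace K B R \<and> (\<forall>x\<in>B. \<forall>y\<in>B. x \<otimes> y \<in> B)"

definition finitely_generated :: bool
  where "finitely_generated \<longleftrightarrow>
    (\<exists>X. finite X \<and> X \<subseteq> carrier R \<and> subalgebra hull X = carrier R)"

definition nil :: bool
  where "nil \<longleftrightarrow> (\<forall>x\<in>carrier R. \<exists>n\<ge>1. elt_pow x n = \<zero>)"

definition nilpotent :: bool
  where "nilpotent \<longleftrightarrow> (\<exists>n\<ge>1. sub_pow (carrier R) n = {\<zero>})"

definition growth :: "'c set \<Rightarrow> nat \<Rightarrow> nat"
  where "growth V n = vectorspace.dim K (vs (span (\<Union>i\<in>{1..n}. sub_pow V i)))"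

text \<open>For \<open>V = 0\<close> the convention \<open>log n 0 = 0\<close> makes the growth exponent \<open>0\<close>.\<close>

definition GKdim :: ereal
  where "GKdim = (SUP V \<in> {V. VectorSpace.subspace K V R \<and> vectorspace.fin_dim K (vs V)}.
    limsup (\<lambda>n. ereal (log (real n) (real (growth V n)))))"

end

text \<open>The quotient ring of the library, extended by the induced scalar multiplication.\<close>

definition quot_algebra :: "('k, 'a, 'm) module_scheme \<Rightarrow> 'a set \<Rightarrow> ('k, 'a set) module"
  where "quot_algebra R I =
    ring.extend (R Quot I) (module.fields (\<lambda>c X. \<Union>x\<in>X. I +>\<^bsub>R\<^esub> (c \<odot>\<^bsub>R\<^esub> x)))"

section \<open>The free associative algebra in three indeterminates\<close>

datatype letter = LX | LY | LZ

datatype monomial = Monomial (letters: "letter list")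

text \<open>The monoid of words, written additively so that \<^type>\<open>poly_mapping\<close> makes the
  finitely supported functions on it into its monoid algebra.\<close>

instantiation monomial :: monoid_add
begin

definition zero_monomial :: monomial
  where "0 = Monomial []"

definition plus_monomial :: "monomial \<Rightarrow> monomial \<Rightarrow> monomial"
  where "u + v = Monomial (letters u @ letters v)"

instance
  by standard (simp_all add: zero_monomial_def plus_monomial_def)

end

type_synonym 'k falg = "monomial \<Rightarrow>\<^sub>0 'k"

definition mon_length :: "monomial \<Rightarrow> nat"
  where "mon_length u = length (letters u)"

definition scl :: "'k::field \<Rightarrow> 'k falg \<Rightarrow> 'k falg"
  where "scl c p = Poly_Mapping.map ((*) c) p"

lemma lookup_scl [simp]: "Poly_Mapping.lookup (scl c p) u = c * Poly_Mapping.lookup p u"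
  by (simp add: scl_def Poly_Mapping.map.rep_eq when_def)

global_interpretation falg: vector_space "scl :: 'k::field \<Rightarrow> 'k falg \<Rightarrow> 'k falg"
  by standard (simp_all add: poly_mapping_eq_iff fun_eq_iff lookup_add algebra_simps)

definition var :: "letter \<Rightarrow> 'k::field falg"
  where "var l = Poly_Mapping.single (Monomial [l]) 1"

definition deg :: "'k::field falg \<Rightarrow> nat"
  where "deg p = Max (insert 0 (mon_length ` Poly_Mapping.keys p))"

definition Mon :: "nat \<Rightarrow> 'k::field falg set"
  where "Mon n = {Poly_Mapping.single u 1 | u. mon_length u = n}"

definition Hom :: "nat \<Rightarrow> 'k::field falg set"
  where "Hom n = falg.span (Mon n)"

definition Abar :: "'k::field falg set"
  where "Abar = {p. Poly_Mapping.lookup p 0 = 0}"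

definition Abar_algebra :: "('k::field, 'k falg) module"
  where "Abar_algebra =
    \<lparr>carrier = Abar, mult = (*), one = undefined, zero = 0, add = (+), smult = scl\<rparr>"

text \<open>The span of all products; the plain product \<^term>\<open>P * Q\<close> of sets is elementwise.\<close>

definition sprod :: "'k::field falg set \<Rightarrow> 'k falg set \<Rightarrow> 'k falg set"  (infixl \<open>\<cdot>\<close> 70)
  where "P \<cdot> Q = falg.span (P * Q)"

definition generated_ideal :: "'k::field falg \<Rightarrow> 'k falg set"
  where "generated_ideal g =
    (\<lambda>I. falg.subspace I \<and> (\<forall>a. \<forall>p\<in>I. a * p \<in> I \<and> p * a \<in> I)) hull {g}"

definition B_ideal :: "nat \<Rightarrow> 'k::field falg set \<Rightarrow> 'k falg set"
  where "B_ideal n X = falg.span (\<Union>k. Mon (n * k) \<cdot> X \<cdot> UNIV)"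

section \<open>Construction data\<close>

definition S_exc :: "nat set"
  where "S_exc = (\<Union>i\<in>{5..}. {2 ^ i - i - 1 .. 2 ^ i - 1})"

definition w_exp :: "nat \<Rightarrow> nat"
  where "w_exp i = 4 * 2 ^ 2 ^ i"

text \<open>\<open>U\<close> and \<open>V\<close> are indexed by degrees; only their values at powers of \<open>2\<close> matter, just as
  \<open>f\<close> and \<open>F\<close> matter only on \<open>Z\<close>.\<close>

definition construction_datum ::
  "nat set \<Rightarrow> (nat \<Rightarrow> 'k::field falg) \<Rightarrow> (nat \<Rightarrow> 'k falg set) \<Rightarrow>
    (nat \<Rightarrow> 'k falg set) \<Rightarrow> (nat \<Rightarrow> 'k falg set) \<Rightarrow> bool"
  where "construction_datum Z f F U V \<longleftrightarrow>
    (\<forall>i\<in>Z. i \<ge> 5) \<and> f ` Z = Abar \<and>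
    (\<forall>i\<in>Z. (2::nat) ^ 2 ^ i > 3 ^ (6 * deg (f i))) \<and>
    (\<forall>i\<in>Z. falg.subspace (F i) \<and> F i \<subseteq> Hom (2 ^ 2 ^ i) \<and>
      falg.dim (F i) < 2 ^ 2 ^ (i + 1) - 2 \<and>
      generated_ideal (f i ^ (10 * w_exp i)) \<subseteq> B_ideal (w_exp i) (F i)) \<and>
    (\<forall>n. falg.subspace (U (2 ^ n)) \<and> U (2 ^ n) \<subseteq> Hom (2 ^ n)) \<and>
    (\<forall>n. falg.subspace (V (2 ^ n)) \<and> V (2 ^ n) \<subseteq> Hom (2 ^ n)) \<and>
    V 1 = falg.span {var LX, var LY} \<and> U 1 = falg.span {var LZ} \<and>
    (\<forall>n. n \<notin> S_exc \<longrightarrow> falg.dim (V (2 ^ n)) = 2) \<and>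
    (\<forall>i\<ge>5. \<forall>j\<le>i. falg.dim (V (2 ^ (2 ^ i - i - 1 + j))) = 2 ^ 2 ^ j) \<and>
    (\<forall>n. \<exists>W \<subseteq> (\<Union>d. Mon d). V (2 ^ n) = falg.span W) \<and>
    (\<forall>i\<in>Z. F i \<subseteq> U (2 ^ 2 ^ i)) \<and>
    (\<forall>n. V (2 ^ n) + U (2 ^ n) = Hom (2 ^ n) \<and> V (2 ^ n) \<inter> U (2 ^ n) = {0}) \<and>
    (\<forall>n. Hom (2 ^ n) \<cdot> U (2 ^ n) + U (2 ^ n) \<cdot> Hom (2 ^ n) \<subseteq> U (2 ^ (n + 1))) \<and>
    (\<forall>n. V (2 ^ (n + 1)) \<subseteq> V (2 ^ n) \<cdot> V (2 ^ n))"

text \<open>The exponent \<open>m\<close> is uniquely determined by \<open>n \<ge> 1\<close>.\<close>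

definition E_deg :: "(nat \<Rightarrow> 'k::field falg set) \<Rightarrow> nat \<Rightarrow> 'k falg set"
  where "E_deg U n = {r \<in> Hom n. \<exists>m. 2 ^ m \<le> n \<and> n < 2 ^ (m + 1) \<and>
    (\<forall>j \<le> 2 ^ (m + 2) - n. Hom j \<cdot> {r} \<cdot> Hom (2 ^ (m + 2) - j - n) \<subseteq>
      U (2 ^ (m + 1)) \<cdot> Hom (2 ^ (m + 1)) + Hom (2 ^ (m + 1)) \<cdot> U (2 ^ (m + 1)))}"

definition E_space :: "(nat \<Rightarrow> 'k::field falg set) \<Rightarrow> 'k falg set"
  where "E_space U = falg.span (\<Union>n\<in>{1..}. E_deg U n)"

end

theory Submission
  imports Defs
begin

text \<open>
  Nilpotency: if the window of length \<open>W = 2 ^ 2 ^ i\<close> is laid over a high power of \<open>f\<close>, then only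
  the two factors of \<open>f\<close> that cross its ends are cut, and what lies between them is a homogeneous
  component of some \<open>f ^ s\<close> with \<open>s \<le> W\<close>. So all windows lie in one space \<open>F\<close> of dimension less than
  \<open>W\<^sup>2 - 2\<close>, which is small enough to be put into \<open>U (2 ^ 2 ^ i)\<close> when the dimension of \<open>V\<close> drops
  from \<open>W\<^sup>2\<close> to \<open>2\<close>. Conversely, a datum puts \<open>F\<close> at dyadic positions into \<open>U\<close>, and \<open>U\<close> spreads
  to all larger dyadic blocks, hence the homogeneous components of \<open>f ^ (10 * w)\<close> lie in \<open>E\<close>.

  Non-nilpotency: the tensor square of the projection to \<open>V\<close> along \<open>U\<close> kills \<open>U H + H U\<close> but fixes
  the square of any word in \<open>V\<close>.

  Growth: a position of an interval in a dyadic block cuts it into at most two dyadic blocks of each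
  size. Modulo \<open>U\<close> each block contributes \<open>dim V\<close>, so the condition in \<open>E n\<close> at one position
  has codimension at most \<open>(\<Prod>i\<le>m. dim V (2 ^ i))\<^sup>2\<close>, where \<open>2 ^ m\<close> exceeds \<open>n\<close> by a bounded
  factor. The prescribed dimensions bound the product by \<open>2 ^ (9 * m + 1)\<close>; with linearly many
  positions and summation over all degrees up to \<open>n\<close> the exponent is \<open>2 * 9 + 1 + 1 = 20\<close>.
\<close>

section \<open>Words\<close>

text \<open>Two demands on \<open>V\<close> are in conflict. With \<open>W = 2 ^ 2 ^ i\<close>,
  absorbing \<open>F i\<close> may cost almost \<open>W\<^sup>2\<close> dimensions in degree
  \<open>W\<close>, so the product of \<open>V\<close> with itself one level earlier must have
  dimension \<open>W\<^sup>2\<close>, while slow growth asks for small \<open>V\<close>. Because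
  \<open>V (2 ^ (n + 1))\<close> lies in that product, its dimension is at most squared from one
  level to the next, and \<open>i\<close> squarings lead from \<open>2\<close> to \<open>W\<close>.
  These are the levels from \<open>2 ^ i - i - 1\<close> to \<open>2 ^ i - 1\<close> collected in
  \<open>S_exc\<close>; right after them the dimension falls back to \<open>2\<close>. One such run
  multiplies the product of all dimensions by less than \<open>2 ^ 2 ^ (i + 1)\<close> and ends at a
  level near \<open>2 ^ i\<close>, so the product remains exponential in the level, that is,
  polynomial in the degree. The condition on \<open>deg f\<close> makes the windows few: with
  \<open>t = deg f\<close>, two words shorter than \<open>t\<close> and an exponent \<open>s\<close>
  leave about \<open>3 ^ (2 * t) * W\<close> choices, far fewer than
  \<open>W\<^sup>2\<close>.\<close>

abbreviation wd :: "monomial \<Rightarrow> 'k::field falg"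
  where "wd u \<equiv> Poly_Mapping.single u 1"

lemma mon_length_add [simp]: "mon_length (u + v) = mon_length u + mon_length v"
  by (simp add: mon_length_def plus_monomial_def)

lemma mon_length_zero [simp]: "mon_length 0 = 0"
  by (simp add: mon_length_def zero_monomial_def)

lemma mon_length_eq_0_iff [simp]: "mon_length u = 0 \<longleftrightarrow> u = 0"
  by (cases u) (simp add: mon_length_def zero_monomial_def)

lemma words_of_length: "{u. mon_length u = n} = Monomial ` {xs. set xs \<subseteq> {LX, LY, LZ} \<and> length xs = n}"
proof -
  have *: "set xs \<subseteq> {LX, LY, LZ}" for xs
    using letter.exhaust by auto
  show ?thesis
    unfolding mon_length_def image_def by (auto simp: *; metis monomial.collapse)
qed

lemma finite_words [simp]: "finite {u. mon_length u = n}"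
  unfolding words_of_length by (intro finite_imageI finite_lists_length_eq) simp

lemma card_words: "card {u. mon_length u = n} = 3 ^ n"
proof -
  have "card {u. mon_length u = n} = card {xs. set xs \<subseteq> {LX, LY, LZ} \<and> length xs = n}"
    unfolding words_of_length by (rule card_image) (simp add: inj_on_def)
  also have "\<dots> = 3 ^ n"
    by (subst card_lists_length_eq) (simp_all add: numeral_3_eq_3)
  finally show ?thesis .
qed

lemma word_split:
  assumes "mon_length u = a + b"
  obtains v w where "u = v + w" "mon_length v = a" "mon_length w = b"
proof
  show "u = Monomial (take a (letters u)) + Monomial (drop a (letters u))"
    by (simp add: plus_monomial_def)
  show "mon_length (Monomial (take a (letters u))) = a" "mon_length (Monomial (drop a (letters u))) = b"
    using assms by (simp_all add: mon_length_def)
qed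

lemma word_add_cancel:
  assumes "u + v = u' + v'" "mon_length u = mon_length u'"
  shows "u = u' \<and> v = v'"
  using assms by (cases u; cases v; cases u'; cases v') (simp add: plus_monomial_def mon_length_def)

lemma wd_mult: "wd u * wd v = wd (u + v)"
  by (simp add: mult_single)

lemma wd_eq_iff [simp]: "(wd u :: 'k::field falg) = wd v \<longleftrightarrow> u = v"
  by (metis lookup_single_eq lookup_single_not_eq one_neq_zero)

lemma wd_neq_0: "(wd u :: 'k::field falg) \<noteq> 0"
  by (metis lookup_single_eq lookup_zero one_neq_zero)

lemma scl_single: "scl c (Poly_Mapping.single u a) = Poly_Mapping.single u (c * a)"
  by (rule poly_mapping_eqI) (simp add: lookup_single when_def)

lemma falg_expand:
  fixes p :: "'k::field falg"
  shows "p = (\<Sum>u\<in>Poly_Mapping.keys p. scl (Poly_Mapping.lookup p u) (wd u))"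
proof (rule poly_mapping_eqI)
  fix v
  have "(\<Sum>u\<in>Poly_Mapping.keys p. Poly_Mapping.lookup p u * Poly_Mapping.lookup (wd u) v) =
      (\<Sum>u\<in>Poly_Mapping.keys p. if u = v then Poly_Mapping.lookup p u else 0)"
    by (rule sum.cong) (auto simp: lookup_single when_def)
  then show "Poly_Mapping.lookup p v = Poly_Mapping.lookup (\<Sum>u\<in>Poly_Mapping.keys p. scl (Poly_Mapping.lookup p u) (wd u)) v"
    by (simp add: lookup_sum in_keys_iff)
qed

lemma scl_mult_left: "scl c p * q = scl c (p * q)"
  unfolding scl_def mult_map_scale_conv_mult by (simp add: mult.assoc)

lemma scl_mult_right: "p * scl c q = scl c (p * q)" for p :: "'k::field falg"
proof -
  have *: "p * Poly_Mapping.single 0 c = Poly_Mapping.single 0 c * p"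
    by (subst (1 2) falg_expand[of p])
       (simp add: sum_distrib_left sum_distrib_right scl_single mult_single mult.commute)
  show ?thesis
    unfolding scl_def mult_map_scale_conv_mult by (simp add: mult.assoc[symmetric] *)
qed

lemma falg_spanning: "p \<in> falg.span (range wd)" for p :: "'k::field falg"
  by (subst falg_expand) (intro falg.span_sum falg.span_scale falg.span_base rangeI)

section \<open>Linear maps and products of subspaces\<close>

interpretation falg_pair: vector_space_pair "scl :: 'k::field \<Rightarrow> 'k falg \<Rightarrow> _" "scl :: 'k \<Rightarrow> 'k falg \<Rightarrow> _"
  by standard

abbreviation lin :: "('k::field falg \<Rightarrow> 'k falg) \<Rightarrow> bool"
  where "lin \<equiv> Vector_Spaces.linear scl scl"

lemma linI:
  assumes "\<And>p q. f (p + q) = f p + f q" "\<And>c p. f (scl c p) = scl c (f p)"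
  shows "lin f"
  using assms by (simp add: Vector_Spaces.linear_iff falg.vector_space_axioms)

lemma lin_span:
  assumes "lin f" "falg.subspace T" "\<And>x. x \<in> S \<Longrightarrow> f x \<in> T" "x \<in> falg.span S"
  shows "f x \<in> T"
  using assms falg.span_minimal[of S "{x. f x \<in> T}"] falg_pair.linear_subspace_linear_preimage[of f T]
  by auto

lemma lin_mult: "lin (\<lambda>x. a * x * b)"
  by (rule linI) (simp_all add: algebra_simps scl_mult_left scl_mult_right)

lemma lin_mult_right: "lin (\<lambda>x. x * b)"
  by (rule linI) (simp_all add: algebra_simps scl_mult_left scl_mult_right)

lemma lin_mult_left: "lin (\<lambda>x. a * x)"
  by (rule linI) (simp_all add: algebra_simps scl_mult_left scl_mult_right)

lemma mult_span:
  assumes "falg.subspace T" "\<And>p q. p \<in> P \<Longrightarrow> q \<in> Q \<Longrightarrow> p * q \<in> T"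
    and "x \<in> falg.span P" "y \<in> falg.span Q"
  shows "x * y \<in> T"
proof -
  have "p * y \<in> T" if "p \<in> P" for p
    by (rule lin_span[OF lin_mult_left assms(1) _ assms(4)]) (use that assms(2) in auto)
  then show ?thesis
    by (rule lin_span[OF lin_mult_right assms(1) _ assms(3)])
qed

lemma subspace_sprod [simp]: "falg.subspace (P \<cdot> Q)"
  by (simp add: sprod_def)

lemma sprodI: "p \<in> P \<Longrightarrow> q \<in> Q \<Longrightarrow> p * q \<in> P \<cdot> Q"
  unfolding sprod_def by (intro falg.span_base set_times_intro)

lemma sprod_least:
  assumes "falg.subspace T" "\<And>p q. p \<in> P \<Longrightarrow> q \<in> Q \<Longrightarrow> p * q \<in> T"
  shows "P \<cdot> Q \<subseteq> T"
  unfolding sprod_def by (rule falg.span_minimal) (auto elim!: set_times_elim intro: assms)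

lemma sprod_subset_iff:
  assumes "falg.subspace T"
  shows "P \<cdot> Q \<subseteq> T \<longleftrightarrow> (\<forall>p\<in>P. \<forall>q\<in>Q. p * q \<in> T)"
  using sprod_least[OF assms, of P Q] sprodI by blast

lemma sprod3_subset_iff:
  assumes "falg.subspace T"
  shows "P \<cdot> Q \<cdot> R \<subseteq> T \<longleftrightarrow> (\<forall>p\<in>P. \<forall>q\<in>Q. \<forall>r\<in>R. p * q * r \<in> T)"
proof
  assume "P \<cdot> Q \<cdot> R \<subseteq> T"
  then show "\<forall>p\<in>P. \<forall>q\<in>Q. \<forall>r\<in>R. p * q * r \<in> T"
    by (meson sprodI subsetD)
next
  assume *: "\<forall>p\<in>P. \<forall>q\<in>Q. \<forall>r\<in>R. p * q * r \<in> T"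
  have "x * r \<in> T" if "x \<in> P \<cdot> Q" "r \<in> R" for x r
  proof (rule lin_span[OF lin_mult_right assms])
    show "x \<in> falg.span (P * Q)" using that(1) by (simp add: sprod_def)
    show "y * r \<in> T" if "y \<in> P * Q" for y
      using that \<open>r \<in> R\<close> * by (auto elim!: set_times_elim)
  qed
  then show "P \<cdot> Q \<cdot> R \<subseteq> T"
    using sprod_least[OF assms] by blast
qed

lemma subspace_plus:
  assumes "falg.subspace P" "falg.subspace Q"
  shows "falg.subspace (P + Q)"
proof -
  have "P + Q = {x + y |x y. x \<in> P \<and> y \<in> Q}"
    by (auto simp: set_plus_def)
  then show ?thesis using falg.subspace_sums[OF assms] by simp
qed

lemma plus_subset_iff:
  assumes "falg.subspace P" "falg.subspace Q" "falg.subspace T"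
  shows "P + Q \<subseteq> T \<longleftrightarrow> P \<subseteq> T \<and> Q \<subseteq> T"
proof
  assume *: "P + Q \<subseteq> T"
  have "p \<in> T" if "p \<in> P" for p
    using subsetD[OF * set_plus_intro[OF that falg.subspace_0[OF assms(2)]]] by simp
  moreover have "q \<in> T" if "q \<in> Q" for q
    using subsetD[OF * set_plus_intro[OF falg.subspace_0[OF assms(1)] that]] by simp
  ultimately show "P \<subseteq> T \<and> Q \<subseteq> T" by blast
next
  assume "P \<subseteq> T \<and> Q \<subseteq> T"
  then show "P + Q \<subseteq> T"
    using falg.subspace_add[OF assms(3)] by (auto elim!: set_plus_elim)
qed

section \<open>Homogeneous elements\<close>

lemma subspace_Hom [simp]: "falg.subspace (Hom n)"
  by (simp add: Hom_def)

lemma wd_in_Hom [simp]: "mon_length u = n \<Longrightarrow> wd u \<in> Hom n"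
  unfolding Hom_def Mon_def by (rule falg.span_base) auto

lemma Hom_iff: "p \<in> Hom n \<longleftrightarrow> (\<forall>u\<in>Poly_Mapping.keys p. mon_length u = n)"
proof
  have "falg.subspace {p. \<forall>u\<in>Poly_Mapping.keys p. mon_length u = n}"
    by (rule falg.subspaceI) (auto simp: in_keys_iff dest!: subsetD[OF keys_add])
  moreover have "Mon n \<subseteq> {p. \<forall>u\<in>Poly_Mapping.keys p. mon_length u = n}"
    by (auto simp: Mon_def)
  ultimately show "\<forall>u\<in>Poly_Mapping.keys p. mon_length u = n" if "p \<in> Hom n"
    using falg.span_minimal that unfolding Hom_def by blast
next
  assume "\<forall>u\<in>Poly_Mapping.keys p. mon_length u = n"
  then show "p \<in> Hom n"
    by (subst falg_expand) (intro falg.subspace_sum falg.subspace_scale subspace_Hom wd_in_Hom, simp)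
qed

lemma Hom_lin:
  assumes "lin f" "falg.subspace T" "\<And>u. mon_length u = n \<Longrightarrow> f (wd u) \<in> T" "p \<in> Hom n"
  shows "f p \<in> T"
  using assms(4) unfolding Hom_def by (rule lin_span[OF assms(1,2), rotated]) (auto simp: Mon_def assms(3))

lemma Hom_mult:
  assumes "p \<in> Hom a" "q \<in> Hom b"
  shows "p * q \<in> Hom (a + b)"
  using assms unfolding Hom_def[of a] Hom_def[of b]
  by (rule mult_span[OF subspace_Hom, rotated]) (auto simp: Mon_def wd_mult)

lemma Hom_split_subset:
  assumes "falg.subspace T" "\<And>p q. p \<in> Hom a \<Longrightarrow> q \<in> Hom b \<Longrightarrow> p * q \<in> T"
  shows "Hom (a + b) \<subseteq> T"
proof
  fix x :: "'a falg" assume "x \<in> Hom (a + b)"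
  then show "x \<in> T"
  proof (rule Hom_lin[OF falg.linear_ident assms(1), rotated])
    fix u assume "mon_length u = a + b"
    then obtain v w where "u = v + w" "mon_length v = a" "mon_length w = b"
      by (rule word_split)
    then show "wd u \<in> T" by (auto simp: wd_mult[symmetric] intro: assms(2))
  qed
qed

lemma Hom_0: "Hom 0 = falg.span {1}"
  by (simp add: Hom_def Mon_def)

lemma finite_Mon [simp]: "finite (Mon n)"
  unfolding Mon_def by simp

definition hcomp :: "nat \<Rightarrow> 'k::field falg \<Rightarrow> 'k falg"
  where "hcomp n p = Abs_poly_mapping (\<lambda>u. Poly_Mapping.lookup p u when mon_length u = n)"

lemma lookup_hcomp [simp]: "Poly_Mapping.lookup (hcomp n p) u = (Poly_Mapping.lookup p u when mon_length u = n)"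
proof -
  have "finite {u. (Poly_Mapping.lookup p u when mon_length u = n) \<noteq> 0}"
    by (rule finite_subset[of _ "Poly_Mapping.keys p"]) (auto simp: in_keys_iff when_def)
  then show ?thesis by (simp add: hcomp_def)
qed

lemma lin_hcomp: "lin (hcomp n)"
  by (rule linI) (rule poly_mapping_eqI, simp add: lookup_add when_def)+

lemma hcomp_in_Hom [simp]: "hcomp n p \<in> Hom n"
  by (auto simp: Hom_iff in_keys_iff when_def split: if_splits)

lemma hcomp_Hom: "p \<in> Hom m \<Longrightarrow> hcomp n p = (if m = n then p else 0)"
  by (rule poly_mapping_eqI) (auto simp: Hom_iff in_keys_iff when_def)

lemma hcomp_sum_eq:
  assumes "finite A" "mon_length ` Poly_Mapping.keys p \<subseteq> A"
  shows "p = (\<Sum>n\<in>A. hcomp n p)"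
proof (rule poly_mapping_eqI)
  fix u
  have "Poly_Mapping.lookup p u = (\<Sum>n\<in>A. if mon_length u = n then Poly_Mapping.lookup p u else 0)"
    using assms by (auto simp: in_keys_iff image_subset_iff)
  then show "Poly_Mapping.lookup p u = Poly_Mapping.lookup (\<Sum>n\<in>A. hcomp n p) u"
    by (simp add: lookup_sum when_def)
qed

lemma hcomp_mult_left:
  assumes "a \<in> Hom j"
  shows "hcomp n (a * p) = (if j \<le> n then a * hcomp (n - j) p else 0)"
proof -
  \<comment> \<open>The index \<open>n - j\<close> is added so that the sum collapses to this single
    term even if \<open>p\<close> has no component there. For \<open>j > n\<close> the truncated
    difference does no damage, since the conditional inside the sum gives zero.\<close>
  let ?A = "insert (n - j) (mon_length ` Poly_Mapping.keys p)"
  have "hcomp n (a * p) = hcomp n (a * (\<Sum>m\<in>?A. hcomp m p))"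
    by (subst hcomp_sum_eq[of ?A p]) auto
  also have "\<dots> = (\<Sum>m\<in>?A. hcomp n (a * hcomp m p))"
    by (simp only: sum_distrib_left falg_pair.linear_sum[OF lin_hcomp])
  also have "\<dots> = (\<Sum>m\<in>?A. if m = n - j then (if j \<le> n then a * hcomp m p else 0) else 0)"
    by (rule sum.cong) (auto simp: hcomp_Hom[OF Hom_mult[OF assms hcomp_in_Hom]])
  also have "\<dots> = (if j \<le> n then a * hcomp (n - j) p else 0)"
    by simp
  finally show ?thesis .
qed

lemma hcomp_mult_right:
  assumes "a \<in> Hom j"
  shows "hcomp n (p * a) = (if j \<le> n then hcomp (n - j) p * a else 0)"
proof -
  let ?A = "insert (n - j) (mon_length ` Poly_Mapping.keys p)"
  have "hcomp n (p * a) = hcomp n ((\<Sum>m\<in>?A. hcomp m p) * a)"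
    by (subst hcomp_sum_eq[of ?A p]) auto
  also have "\<dots> = (\<Sum>m\<in>?A. hcomp n (hcomp m p * a))"
    by (simp only: sum_distrib_right falg_pair.linear_sum[OF lin_hcomp])
  also have "\<dots> = (\<Sum>m\<in>?A. if m = n - j then (if j \<le> n then hcomp m p * a else 0) else 0)"
    by (rule sum.cong) (auto simp: hcomp_Hom[OF Hom_mult[OF hcomp_in_Hom assms]])
  also have "\<dots> = (if j \<le> n then hcomp (n - j) p * a else 0)"
    by simp
  finally show ?thesis .
qed

section \<open>Tensor products of linear maps\<close>

text \<open>The maps act on the first \<open>a\<close> letters and on the remaining letters of each word.\<close>

definition tens :: "nat \<Rightarrow> ('k::field falg \<Rightarrow> 'k falg) \<Rightarrow> ('k falg \<Rightarrow> 'k falg) \<Rightarrow> 'k falg \<Rightarrow> 'k falg"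
  where "tens a g h p = (\<Sum>u\<in>Poly_Mapping.keys p. scl (Poly_Mapping.lookup p u)
    (g (wd (Monomial (take a (letters u)))) * h (wd (Monomial (drop a (letters u))))))"

lemma tens_superset:
  assumes "finite A" "Poly_Mapping.keys p \<subseteq> A"
  shows "tens a g h p = (\<Sum>u\<in>A. scl (Poly_Mapping.lookup p u)
    (g (wd (Monomial (take a (letters u)))) * h (wd (Monomial (drop a (letters u))))))"
  unfolding tens_def by (rule sum.mono_neutral_left) (use assms in \<open>auto simp: in_keys_iff\<close>)

lemma lin_tens: "lin (tens a g h)"
proof (rule linI)
  fix p q :: "'a falg"
  let ?A = "Poly_Mapping.keys p \<union> Poly_Mapping.keys q"
  have "Poly_Mapping.keys (p + q) \<subseteq> ?A" by (rule keys_add)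
  then show "tens a g h (p + q) = tens a g h p + tens a g h q"
    by (simp add: tens_superset[of ?A] lookup_add falg.scale_left_distrib sum.distrib)
next
  fix c and p :: "'a falg"
  have "Poly_Mapping.keys (scl c p) \<subseteq> Poly_Mapping.keys p"
    by (auto simp: in_keys_iff)
  then show "tens a g h (scl c p) = scl c (tens a g h p)"
    by (simp add: tens_superset[of "Poly_Mapping.keys p"] falg.scale_sum_right)
qed

lemma tens_wd:
  assumes "mon_length u = a"
  shows "tens a g h (wd u * wd v) = g (wd u) * h (wd v)"
  using assms by (simp add: wd_mult tens_def plus_monomial_def mon_length_def)

lemma tens_mult:
  assumes "lin g" "lin h" "p \<in> Hom a" "q \<in> Hom b"
  shows "tens a g h (p * q) = g p * h q"
proof -
  have 1: "tens a g h (wd u * q) - g (wd u) * h q \<in> {0}" if "mon_length u = a" for u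
  proof (rule Hom_lin[OF _ _ _ assms(4)])
    show "lin (\<lambda>q. tens a g h (wd u * q) - g (wd u) * h q)"
      using falg_pair.linear_add[OF lin_tens] falg_pair.linear_scale[OF lin_tens]
        falg_pair.linear_add[OF assms(2)] falg_pair.linear_scale[OF assms(2)]
      by (intro linI) (simp_all add: algebra_simps scl_mult_right falg.scale_right_diff_distrib)
  qed (simp_all add: tens_wd that)
  have "tens a g h (p * q) - g p * h q \<in> {0}"
  proof (rule Hom_lin[OF _ _ _ assms(3)])
    show "lin (\<lambda>p. tens a g h (p * q) - g p * h q)"
      using falg_pair.linear_add[OF lin_tens] falg_pair.linear_scale[OF lin_tens]
        falg_pair.linear_add[OF assms(1)] falg_pair.linear_scale[OF assms(1)]
      by (intro linI) (simp_all add: algebra_simps scl_mult_left falg.scale_right_diff_distrib)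
  qed (use 1 in simp_all)
  then show ?thesis by simp
qed

section \<open>Powers of a fixed element\<close>

lemma Abar_keys:
  assumes "f \<in> Abar" "u \<in> Poly_Mapping.keys f"
  shows "1 \<le> mon_length u" "mon_length u \<le> deg f"
proof -
  show "1 \<le> mon_length u"
    using assms by (auto simp: Abar_def in_keys_iff Suc_le_eq intro!: Nat.gr0I)
  show "mon_length u \<le> deg f"
    unfolding deg_def using assms(2) by (intro Max_ge) auto
qed

lemma deg_eq_0_Abar:
  assumes "f \<in> Abar" "deg f = 0"
  shows "f = 0"
  using Abar_keys[OF assms(1)] assms(2) by (metis all_not_in_conv keys_eq_empty le_zero_eq one_neq_zero le_trans)

text \<open>Each factor has no constant term, so it raises the least possible degree by at least
  one.\<close>

lemma hcomp_power_eq_0: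
  assumes "f \<in> Abar" "m < s"
  shows "hcomp m (f ^ s) = 0"
  using assms(2)
proof (induction s arbitrary: m)
  case (Suc s)
  have "hcomp m (f ^ Suc s) = hcomp m (\<Sum>u\<in>Poly_Mapping.keys f. scl (Poly_Mapping.lookup f u) (f ^ s * wd u))"
    unfolding power_Suc2 by (subst (2) falg_expand) (simp add: sum_distrib_left scl_mult_right)
  also have "\<dots> = (\<Sum>u\<in>Poly_Mapping.keys f. scl (Poly_Mapping.lookup f u) (hcomp m (f ^ s * wd u)))"
    by (simp add: falg_pair.linear_sum[OF lin_hcomp] falg_pair.linear_scale[OF lin_hcomp])
  also have "\<dots> = 0"
  proof (rule sum.neutral, rule ballI)
    fix u assume "u \<in> Poly_Mapping.keys f"
    then have "1 \<le> mon_length u" by (rule Abar_keys[OF assms(1)])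
    then have "hcomp m (f ^ s * wd u) = 0"
      using Suc by (simp add: hcomp_mult_right[OF wd_in_Hom[OF refl]])
    then show "scl (Poly_Mapping.lookup f u) (hcomp m (f ^ s * wd u)) = 0" by simp
  qed
  finally show ?case .
qed simp

text \<open>After an initial tail, \<open>L\<close> letters of a window remain;
  \<open>trunc L (f ^ s)\<close> collects what \<open>s\<close> whole factors contribute without
  leaving the window.\<close>

definition trunc :: "nat \<Rightarrow> 'k::field falg \<Rightarrow> 'k falg"
  where "trunc L p = (\<Sum>m\<le>L. hcomp m p)"

lemma lin_trunc: "lin (trunc L)"
  by (rule linI) (simp_all add: trunc_def falg_pair.linear_add[OF lin_hcomp]
    falg_pair.linear_scale[OF lin_hcomp] sum.distrib falg.scale_sum_right)

lemma trunc_Hom: "p \<in> Hom m \<Longrightarrow> trunc L p = (if m \<le> L then p else 0)"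
  by (simp add: trunc_def hcomp_Hom)

lemma trunc_1: "trunc L 1 = 1"
  using trunc_Hom[OF wd_in_Hom[of 0 0], of L] by simp

lemma trunc_power_eq_0: "f \<in> Abar \<Longrightarrow> L < s \<Longrightarrow> trunc L (f ^ s) = 0"
  by (simp add: trunc_def hcomp_power_eq_0)

text \<open>Truncating before or after multiplication differs exactly by the components that lie
  inside the window and are pushed across its end by \<open>u\<close>.\<close>

lemma trunc_mult_wd:
  "trunc L p * wd u - trunc L (p * wd u) =
    (\<Sum>m\<le>L. if L < m + mon_length u then hcomp m p * wd u else 0)"
proof -
  let ?A = "{..L} \<union> mon_length ` Poly_Mapping.keys p"
  have "trunc L (p * wd u) = trunc L ((\<Sum>m\<in>?A. hcomp m p) * wd u)"
    by (subst hcomp_sum_eq[of ?A p]) auto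
  also have "\<dots> = (\<Sum>m\<in>?A. trunc L (hcomp m p * wd u))"
    by (simp only: sum_distrib_right falg_pair.linear_sum[OF lin_trunc])
  also have "\<dots> = (\<Sum>m\<in>?A. if m + mon_length u \<le> L then hcomp m p * wd u else 0)"
    by (simp add: trunc_Hom[OF Hom_mult[OF hcomp_in_Hom wd_in_Hom[OF refl]]])
  also have "\<dots> = (\<Sum>m\<le>L. if m + mon_length u \<le> L then hcomp m p * wd u else 0)"
    by (rule sum.mono_neutral_right) auto
  finally have "trunc L p * wd u - trunc L (p * wd u) =
      (\<Sum>m\<le>L. hcomp m p * wd u - (if m + mon_length u \<le> L then hcomp m p * wd u else 0))"
    by (simp add: trunc_def sum_distrib_right sum_subtractf)
  also have "\<dots> = (\<Sum>m\<le>L. if L < m + mon_length u then hcomp m p * wd u else 0)"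
    by (rule sum.cong) auto
  finally show ?thesis .
qed

lemma sprod_UNIV_right:
  assumes "x \<in> F \<cdot> UNIV"
  shows "x * y \<in> F \<cdot> UNIV"
proof (rule lin_span[OF lin_mult_right subspace_sprod])
  show "x \<in> falg.span (F * UNIV)" using assms by (simp add: sprod_def)
  show "z * y \<in> F \<cdot> UNIV" if z: "z \<in> F * UNIV" for z
  proof -
    obtain p q where "z = p * q" "p \<in> F" using z by (rule set_times_elim)
    then show ?thesis using sprodI[of p F "q * y" UNIV] by (simp add: mult.assoc)
  qed
qed

text \<open>The window of length \<open>W\<close> starts with the tail \<open>v\<close> of a cut factor of \<open>f\<close> and ends with the
  head \<open>u\<close> of another one.\<close>

definition power_pieces :: "'k::field falg \<Rightarrow> nat \<Rightarrow> 'k falg set"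
  where "power_pieces f W = {wd v * hcomp m (f ^ s) * wd u |v m s u.
    mon_length v < deg f \<and> mon_length u < deg f \<and> s \<le> W \<and> mon_length v + m + mon_length u = W}"

lemma power_pieces_card:
  "finite (power_pieces f W) \<and> card (power_pieces f W) \<le> (3 ^ deg f)\<^sup>2 * (W + 1)"
proof -
  let ?t = "deg f"
  let ?D = "{v. mon_length v < ?t}"
  \<comment> \<open>The degree \<open>m\<close> is forced by the other data because the lengths add
    up to \<open>W\<close>, so triples suffice for the count.\<close>
  let ?g = "\<lambda>(v, u, s). wd v * hcomp (W - mon_length v - mon_length u) (f ^ s) * wd u"
  have geom: "(\<Sum>n<t. 3 ^ n) \<le> (3::nat) ^ t" for t
    by (induction t) auto
  have D: "?D = (\<Union>n<?t. {v. mon_length v = n})" by auto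
  have finD: "finite ?D" unfolding D by simp
  have "card ?D \<le> (\<Sum>n<?t. card {v. mon_length v = n})"
    unfolding D by (rule card_UN_le) simp
  also have "\<dots> = (\<Sum>n<?t. 3 ^ n)" by (simp add: card_words)
  also have "\<dots> \<le> 3 ^ ?t"
    using geom by simp
  finally have cD: "card ?D \<le> 3 ^ ?t" .
  have sub: "power_pieces f W \<subseteq> ?g ` (?D \<times> ?D \<times> {..W})"
  proof
    fix x assume "x \<in> power_pieces f W"
    then obtain v m s u where "x = wd v * hcomp m (f ^ s) * wd u" "mon_length v < ?t" "mon_length u < ?t"
      "s \<le> W" "mon_length v + m + mon_length u = W"
      unfolding power_pieces_def by blast
    then show "x \<in> ?g ` (?D \<times> ?D \<times> {..W})"
      by (intro image_eqI[of _ _ "(v, u, s)"]) auto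
  qed
  have fin: "finite (?D \<times> ?D \<times> {..W})" using finD by simp
  have "card (power_pieces f W) \<le> card (?g ` (?D \<times> ?D \<times> {..W}))"
    using sub fin by (intro card_mono finite_imageI)
  also have "\<dots> \<le> card (?D \<times> ?D \<times> {..W})"
    using fin by (rule card_image_le)
  also have "\<dots> = (card ?D)\<^sup>2 * (W + 1)"
    by (simp add: card_cartesian_product power2_eq_square algebra_simps)
  also have "\<dots> \<le> (3 ^ ?t)\<^sup>2 * (W + 1)"
    using cD by (intro mult_right_mono power_mono) auto
  finally show ?thesis using finite_subset[OF sub finite_imageI[OF fin]] by simp
qed

lemma power_pieces_Hom: "power_pieces f W \<subseteq> Hom W"
  unfolding power_pieces_def by (auto intro!: Hom_mult wd_in_Hom)

text \<open>Multiplying by one factor \<open>f\<close>, the part that leaves the window is of the form required of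
  \<open>power_pieces\<close>, and after more than \<open>L\<close> factors nothing stays inside.\<close>

lemma wd_trunc_power_mem:
  assumes "f \<in> Abar" "mon_length v < deg f" "mon_length v + L = W" "L < N + s"
  shows "wd v * trunc L (f ^ s) * f ^ N \<in> power_pieces f W \<cdot> UNIV"
  using assms(4)
proof (induction N arbitrary: s)
  case 0
  then show ?case by (simp add: trunc_power_eq_0[OF assms(1)] falg.subspace_0)
next
  case (Suc N)
  let ?I = "power_pieces f W \<cdot> UNIV"
  have step: "wd v * (trunc L (f ^ s) * wd u - trunc L (f ^ s * wd u)) \<in> ?I"
    if "u \<in> Poly_Mapping.keys f" for u
    unfolding trunc_mult_wd sum_distrib_left
  proof (rule falg.subspace_sum[OF subspace_sprod])
    fix m assume "m \<in> {..L}"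
    show "wd v * (if L < m + mon_length u then hcomp m (f ^ s) * wd u else 0) \<in> ?I"
    proof (cases "L < m + mon_length u \<and> s \<le> W")
      case True
      \<comment> \<open>The factor that crosses the end of the window is cut there: the head
        \<open>h\<close> completes a piece of length \<open>W\<close>, and the rest \<open>c\<close>
        is swallowed by \<open>UNIV\<close>.\<close>
      then have "mon_length u = (L - m) + (m + mon_length u - L)"
        using \<open>m \<in> {..L}\<close> by simp
      then obtain h c where u: "u = h + c" "mon_length h = L - m"
        by (rule word_split)
      have "mon_length h < deg f"
        using Abar_keys(2)[OF assms(1) that] \<open>mon_length h = L - m\<close> True \<open>m \<in> {..L}\<close>
        unfolding atMost_iff by linarith
      then have "wd v * hcomp m (f ^ s) * wd h \<in> power_pieces f W"
        unfolding power_pieces_def using assms(2,3) True u(2) \<open>m \<in> {..L}\<close> by fastforce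
      then have "wd v * hcomp m (f ^ s) * wd h * wd c \<in> ?I"
        by (rule sprodI) simp
      then show ?thesis using True by (simp add: u wd_mult[symmetric] mult.assoc)
    next
      case False
      \<comment> \<open>Here \<open>s > W\<close>, while \<open>m \<le> L \<le> W\<close>, so
        \<open>s\<close> factors cannot have degree \<open>m\<close>. This is why the pieces need
        only exponents up to \<open>W\<close>.\<close>
      then have "hcomp m (f ^ s) = 0" if "L < m + mon_length u"
        using that \<open>m \<in> {..L}\<close> assms(3) by (intro hcomp_power_eq_0[OF assms(1)]) auto
      then show ?thesis by (auto simp: falg.subspace_0)
    qed
  qed
  have "wd v * (trunc L (f ^ s) * f - trunc L (f ^ s * f)) =
      (\<Sum>u\<in>Poly_Mapping.keys f. scl (Poly_Mapping.lookup f u)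
        (wd v * (trunc L (f ^ s) * wd u - trunc L (f ^ s * wd u))))"
    by (subst (2 4) falg_expand[of f])
       (simp add: sum_distrib_left scl_mult_right falg_pair.linear_sum[OF lin_trunc]
         falg_pair.linear_scale[OF lin_trunc] right_diff_distrib sum_subtractf
         falg.scale_right_diff_distrib)
  also have "\<dots> \<in> ?I"
    using step by (intro falg.subspace_sum falg.subspace_scale subspace_sprod)
  finally have "wd v * (trunc L (f ^ s) * f - trunc L (f ^ s * f)) * f ^ N \<in> ?I"
    by (rule sprod_UNIV_right)
  moreover have "wd v * trunc L (f ^ Suc s) * f ^ N \<in> ?I"
    using Suc.IH[of "Suc s"] Suc.prems by simp
  ultimately have "wd v * (trunc L (f ^ s) * f - trunc L (f ^ s * f)) * f ^ N
      + wd v * trunc L (f ^ Suc s) * f ^ N \<in> ?I"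
    by (rule falg.subspace_add[OF subspace_sprod])
  then show ?case
    by (simp only: power_Suc2[of f s]) (simp add: algebra_simps)
qed

lemma wd_power_mem:
  assumes "f \<in> Abar" "mon_length v < deg f" "mon_length v \<le> W" "W < N"
  shows "wd v * f ^ N \<in> power_pieces f W \<cdot> UNIV"
  using wd_trunc_power_mem[OF assms(1,2), of "W - mon_length v" W N 0] assms(3,4)
  by (simp add: trunc_1)

section \<open>The right ideals \<open>B\<close>\<close>

lemma subspace_B_ideal [simp]: "falg.subspace (B_ideal w F)"
  by (simp add: B_ideal_def)

lemma B_idealI:
  assumes "mon_length u = w * k" "x \<in> F \<cdot> UNIV"
  shows "wd u * x \<in> B_ideal w F"
proof -
  have "wd u * y \<in> B_ideal w F" if y: "y \<in> F * UNIV" for y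
  proof -
    obtain p q where "y = p * q" "p \<in> F" using y unfolding set_times_def by blast
    moreover have "wd u \<in> Mon (w * k)" using assms(1) by (auto simp: Mon_def)
    ultimately have "wd u * y \<in> Mon (w * k) \<cdot> F \<cdot> UNIV"
      using sprodI[OF sprodI[of "wd u" "Mon (w * k)" p F], of q UNIV] \<open>p \<in> F\<close> by (simp add: mult.assoc)
    then show ?thesis unfolding B_ideal_def by (intro falg.span_base) auto
  qed
  then show ?thesis
    using assms(2) unfolding sprod_def by (rule lin_span[OF lin_mult_left subspace_B_ideal])
qed

lemma B_ideal_right: "x \<in> B_ideal w F \<Longrightarrow> x * y \<in> B_ideal w F"
  unfolding B_ideal_def
  by (erule lin_span[OF lin_mult_right falg.subspace_span, rotated])
     (auto intro!: falg.span_base sprod_UNIV_right)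

text \<open>Factors of \<open>f\<close> are appended to \<open>a\<close> until the position
  \<open>w * k\<close> is reached. Each takes at least one letter, so at most
  \<open>w * k - mon_length a\<close> factors are spent and more than \<open>W\<close> are left to
  fill the window. A factor that crosses the position leaves behind it a tail shorter than
  \<open>deg f\<close>.\<close>

lemma wd_power_B_ideal:
  assumes "f \<in> Abar" "0 < deg f" "deg f \<le> W"
    and "mon_length a \<le> w * k" "w * k - mon_length a + W < N"
  shows "wd a * f ^ N \<in> B_ideal w (power_pieces f W)"
  using assms(4,5)
proof (induction N arbitrary: a)
  case (Suc N)
  show ?case
  proof (cases "mon_length a = w * k")
    case True
    have "wd 0 * f ^ Suc N \<in> power_pieces f W \<cdot> UNIV"
      using assms(1-3) Suc.prems by (intro wd_power_mem) auto
    from B_idealI[OF True this] show ?thesis by simp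
  next
    case False
    have "wd (a + u) * f ^ N \<in> B_ideal w (power_pieces f W)" if "u \<in> Poly_Mapping.keys f" for u
    proof (cases "mon_length (a + u) \<le> w * k")
      case True
      then show ?thesis using Suc Abar_keys(1)[OF assms(1) that] by (intro Suc.IH) auto
    next
      case lt: False
      then have "mon_length (a + u) = w * k + (mon_length (a + u) - w * k)" by simp
      then obtain p v where pv: "a + u = p + v" "mon_length p = w * k"
        "mon_length v = mon_length (a + u) - w * k"
        by (rule word_split)
      have "mon_length v < deg f"
        using Abar_keys(2)[OF assms(1) that] pv(3) False Suc.prems(1) lt by simp
      then have "wd v * f ^ N \<in> power_pieces f W \<cdot> UNIV"
        using assms(1,3) Suc.prems False by (intro wd_power_mem) auto
      from B_idealI[OF pv(2) this] show ?thesis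
        by (simp add: pv(1) wd_mult[symmetric] mult.assoc)
    qed
    moreover have "wd a * f ^ Suc N =
        (\<Sum>u\<in>Poly_Mapping.keys f. scl (Poly_Mapping.lookup f u) (wd (a + u) * f ^ N))"
      unfolding power_Suc
      by (subst (1) falg_expand[of f])
         (simp add: sum_distrib_left sum_distrib_right scl_mult_right scl_mult_left mult.assoc[symmetric] wd_mult)
    ultimately show ?thesis
      by (auto intro!: falg.subspace_sum falg.subspace_scale)
  qed
qed simp

section \<open>The space \<open>F\<close> belonging to one element\<close>

lemma generated_ideal_subset:
  assumes "falg.subspace B" "\<And>x y. x \<in> B \<Longrightarrow> x * y \<in> B" "\<And>a. wd a * g \<in> B"
  shows "generated_ideal g \<subseteq> B"
proof -
  \<comment> \<open>The elements all of whose two-sided multiples lie in the right ideal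
    \<open>B\<close> form a two-sided ideal inside \<open>B\<close>; for \<open>g\<close> to belong
    to it, left multiples by words are enough.\<close>
  let ?I = "{p. \<forall>a b. a * p * b \<in> B}"
  have "a * g \<in> B" for a
    by (rule lin_span[OF lin_mult_right assms(1) _ falg_spanning]) (use assms(3) in auto)
  then have g: "g \<in> ?I" using assms(2) by simp
  have "falg.subspace ?I"
    by (rule falg.subspaceI)
       (auto simp: algebra_simps scl_mult_left scl_mult_right falg.subspace_0[OF assms(1)]
         intro: falg.subspace_add[OF assms(1)] falg.subspace_scale[OF assms(1)])
  moreover have "a * p \<in> ?I \<and> p * a \<in> ?I" if "p \<in> ?I" for a p
    using that by (auto simp: mult.assoc) (metis mult.assoc)
  ultimately have "generated_ideal g \<subseteq> ?I"
    unfolding generated_ideal_def using g by (intro hull_minimal) auto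
  moreover have "?I \<subseteq> B" by (auto dest!: spec[of _ 1])
  ultimately show ?thesis by blast
qed

lemma B_ideal_span: "B_ideal w F \<subseteq> B_ideal w (falg.span F)"
  unfolding B_ideal_def sprod_def
  by (intro falg.span_mono UN_mono order_refl set_times_mono2) (auto intro: falg.span_superset[THEN subsetD])

text \<open>For \<open>q = 3 ^ t \<ge> 3\<close> the sixth power in the hypothesis gives
  \<open>81 * q\<^sup>2 \<le> q ^ 6 < W\<close>, so the left side is at most
  \<open>W * (W + 1) / 81\<close>.\<close>

lemma power_pieces_bound:
  fixes t W :: nat
  assumes "0 < t" "3 ^ (6 * t) < W"
  shows "(3 ^ t)\<^sup>2 * (W + 1) < W\<^sup>2 - 2"
proof -
  define q :: nat where "q = 3 ^ t"
  have q6: "q ^ 6 < W" using assms(2) by (simp add: q_def power_mult[symmetric] mult.commute)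
  have "3 \<le> q" unfolding q_def using assms(1) power_increasing[of 1 t "3::nat"] by simp
  then have "3 ^ 4 \<le> q ^ 4" by (intro power_mono) auto
  then have "81 * q\<^sup>2 \<le> q ^ 4 * q\<^sup>2" by (intro mult_right_mono) auto
  then have 81: "81 * q\<^sup>2 < W" using q6 by (simp add: power_add[symmetric])
  have "9 \<le> q\<^sup>2" using power_mono[OF \<open>3 \<le> q\<close>, of 2] by simp
  then have W: "729 < W" using 81 by simp
  have "81 * (q\<^sup>2 * (W + 1)) \<le> W * (W + 1)" using 81 by (simp add: mult.assoc[symmetric] del: mult_Suc_right)
  \<comment> \<open>The number \<open>162\<close> is \<open>81\<close> times the \<open>2\<close>
    that is subtracted in the claim.\<close>
  moreover have "W * (W + 1) + 162 < 81 * W\<^sup>2"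
  proof -
    have "W * 729 \<le> W * W" using W by (intro mult_left_mono) auto
    moreover have "W\<^sup>2 = W * W" by (simp add: power2_eq_square)
    ultimately show ?thesis using W unfolding distrib_left mult_1_right by linarith
  qed
  ultimately show ?thesis unfolding q_def[symmetric] by linarith
qed

text \<open>For \<open>deg f = 0\<close> the element is zero and no tail is shorter than
  \<open>deg f\<close>, so this case is settled by \<open>F = {0}\<close>. Otherwise the span of the
  pieces serves as \<open>F\<close>.\<close>

proposition power_piece_space_exists:
  fixes f :: "'k::field falg"
  assumes f: "f \<in> Abar" and W: "3 ^ (6 * deg f) < (2::nat) ^ 2 ^ i"
  shows "\<exists>F. falg.subspace F \<and> F \<subseteq> Hom (2 ^ 2 ^ i) \<and> falg.dim F < 2 ^ 2 ^ (i + 1) - 2 \<and>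
      generated_ideal (f ^ (10 * w_exp i)) \<subseteq> B_ideal (w_exp i) F"
proof (cases "deg f = 0")
  case True
  have "generated_ideal (f ^ (10 * w_exp i)) \<subseteq> B_ideal (w_exp i) {0}"
  proof -
    have "0 < 10 * w_exp i" by (simp add: w_exp_def)
    then have "f ^ (10 * w_exp i) = 0"
      unfolding deg_eq_0_Abar[OF f True] by (rule zero_power)
    then show ?thesis
      by (intro generated_ideal_subset)
         (simp_all add: falg.subspace_0[OF subspace_B_ideal] B_ideal_right)
  qed
  moreover have "falg.dim ({0} :: 'k falg set) = 0"
    using falg.dim_span_eq_card_independent[OF falg.independent_empty] by simp
  moreover have "(2::nat) ^ 2 \<le> 2 ^ 2 ^ (i + 1)"
    by (rule power_increasing) simp_all
  ultimately show ?thesis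
    by (intro exI[of _ "{0}"]) (auto simp: falg.subspace_0)
next
  case False
  define W where "W = (2::nat) ^ 2 ^ i"
  let ?P = "power_pieces f W"
  have W6: "3 ^ (6 * deg f) < W" using W by (simp add: W_def)
  have "deg f < 3 ^ deg f" by (rule power_gt_expt) simp
  also have "\<dots> \<le> (3::nat) ^ (6 * deg f)" by (intro power_increasing) auto
  finally have dW: "deg f \<le> W" using W6 by simp
  have "W > 0" by (simp add: W_def)
  have w: "w_exp i = 4 * W" by (simp add: w_exp_def W_def)
  have "wd a * f ^ (10 * w_exp i) \<in> B_ideal (w_exp i) ?P" for a
  proof -
    \<comment> \<open>The next multiple of \<open>w_exp i = 4 * W\<close> behind \<open>a\<close> is
      at most \<open>4 * W\<close> letters away, and the window needs \<open>W\<close> more; the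
      \<open>40 * W\<close> factors at hand exceed this sum.\<close>
    define k where "k = mon_length a div (w_exp i) + 1"
    have "mon_length a \<le> w_exp i * k \<and> w_exp i * k \<le> mon_length a + w_exp i"
    proof -
      have "mon_length a = w_exp i * (mon_length a div w_exp i) + mon_length a mod w_exp i" by simp
      moreover have "mon_length a mod w_exp i < w_exp i" using \<open>W > 0\<close> w by simp
      ultimately show ?thesis unfolding k_def distrib_left mult_1_right by linarith
    qed
    then show ?thesis
      using f False dW \<open>W > 0\<close> by (intro wd_power_B_ideal[where k = k]) (auto simp: w)
  qed
  then have "wd a * f ^ (10 * w_exp i) \<in> B_ideal (w_exp i) (falg.span ?P)" for a
    using B_ideal_span by blast
  then have "generated_ideal (f ^ (10 * w_exp i)) \<subseteq> B_ideal (w_exp i) (falg.span ?P)"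
    by (intro generated_ideal_subset) (simp_all add: B_ideal_right)
  moreover have "falg.dim (falg.span ?P) < 2 ^ 2 ^ (i + 1) - 2"
  proof -
    have "falg.dim (falg.span ?P) \<le> card ?P"
      using power_pieces_card[of f W] by (intro falg.dim_le_card) auto
    also have "\<dots> \<le> (3 ^ deg f)\<^sup>2 * (W + 1)" using power_pieces_card by blast
    also have "\<dots> < W\<^sup>2 - 2" using False W6 by (intro power_pieces_bound) auto
    also have "W\<^sup>2 = 2 ^ 2 ^ (i + 1)" by (simp add: W_def power_mult[symmetric] mult.commute)
    finally show ?thesis .
  qed
  moreover have "falg.span ?P \<subseteq> Hom W"
    by (intro falg.span_minimal power_pieces_Hom subspace_Hom)
  ultimately show ?thesis
    unfolding W_def[symmetric] by (intro exI[of _ "falg.span ?P"] conjI falg.subspace_span)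
qed

section \<open>Codimension\<close>

lemma subspace_spanning_mod:
  assumes "falg.subspace P" "falg.subspace Q" "finite Y" "P \<subseteq> falg.span Y + Q"
  obtains Y' where "Y' \<subseteq> P" "finite Y'" "card Y' \<le> card Y" "P \<subseteq> falg.span Y' + (P \<inter> Q)"
proof -
  have "\<exists>Y'\<subseteq>P. finite Y' \<and> card Y' \<le> card Y \<and> P \<subseteq> falg.span Y' + (P \<inter> Q)"
    using assms(3,2,4)
  proof (induction Y arbitrary: Q rule: finite_induct)
    case empty
    then have "P \<subseteq> P \<inter> Q" by (auto simp: set_plus_def)
    then show ?case by (intro exI[of _ "{}"]) (auto simp: set_plus_def)
  next
    case (insert y Y)
    let ?Q = "falg.span {y} + Q"
    have Q: "falg.subspace ?Q" using insert.prems(1) by (simp add: subspace_plus)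
    have "falg.span (insert y Y) = falg.span Y + falg.span {y}"
      using falg.span_Un[of Y "{y}"] by (auto simp: set_plus_def)
    then have "P \<subseteq> falg.span Y + ?Q" using insert.prems(2) by (simp add: add.assoc)
    from insert.IH[OF Q this] obtain Y' where Y': "Y' \<subseteq> P" "finite Y'" "card Y' \<le> card Y"
      "P \<subseteq> falg.span Y' + (P \<inter> ?Q)" by blast
    show ?case
    proof (cases "P \<inter> ?Q \<subseteq> Q")
      case True
      then have *: "P \<inter> ?Q \<subseteq> P \<inter> Q" by blast
      have "P \<subseteq> falg.span Y' + (P \<inter> Q)"
        by (rule order_trans[OF Y'(4) set_plus_mono2[OF order_refl *]])
      then show ?thesis using Y' insert by (intro exI[of _ Y']) auto
    next
      case False
      then obtain p0 where p0: "p0 \<in> P" "p0 \<in> ?Q" "p0 \<notin> Q" by blast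
      then obtain c q0 where c: "p0 = scl c y + q0" "q0 \<in> Q"
        by (auto simp: set_plus_def falg.span_singleton)
      have "c \<noteq> 0" using c p0(3) by auto
      have "P \<subseteq> falg.span (insert p0 Y') + (P \<inter> Q)"
      proof
        fix p assume "p \<in> P"
        then have "p \<in> falg.span Y' + (P \<inter> ?Q)" using Y'(4) by (rule subsetD[rotated])
        then obtain a b where ab: "p = a + b" "a \<in> falg.span Y'" "b \<in> P" "b \<in> ?Q"
          by (elim set_plus_elim) blast
        then obtain c' q where c': "b = scl c' y + q" "q \<in> Q"
          by (auto simp: set_plus_def falg.span_singleton)
        \<comment> \<open>This multiple of \<open>p0\<close> cancels the \<open>y\<close>-part of
          \<open>b\<close>, so the remainder falls into \<open>Q\<close>.\<close>
        let ?d = "scl (c' / c) p0"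
        have "b - ?d = q - scl (c' / c) q0"
          using \<open>c \<noteq> 0\<close> by (simp add: c c' falg.scale_right_distrib)
        then have "b - ?d \<in> P \<inter> Q"
          using c'(2) c(2) ab(3) p0(1) insert.prems(1) assms(1)
          by (metis IntI falg.subspace_diff falg.subspace_scale)
        moreover have "a \<in> falg.span (insert p0 Y')"
          using ab(2) falg.span_mono[of Y' "insert p0 Y'"] by blast
        then have "a + ?d \<in> falg.span (insert p0 Y')"
          by (rule falg.span_add) (intro falg.span_scale falg.span_base, simp)
        ultimately have "(a + ?d) + (b - ?d) \<in> falg.span (insert p0 Y') + (P \<inter> Q)"
          by (rule set_plus_intro[rotated])
        then show "p \<in> falg.span (insert p0 Y') + (P \<inter> Q)" by (simp add: ab(1))
      qed
      moreover have "card (insert p0 Y') \<le> card (insert y Y)"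
        using Y' insert.hyps by (simp add: card_insert_if)
      ultimately show ?thesis using Y' p0(1) by (intro exI[of _ "insert p0 Y'"]) auto
    qed
  qed
  then show thesis using that by blast
qed

text \<open>The space \<open>T\<close> has codimension at most \<open>c\<close> in \<open>Hom n\<close>; the set \<open>X\<close> need not lie in \<open>Hom n\<close>.\<close>

definition cod :: "nat \<Rightarrow> 'k::field falg set \<Rightarrow> nat \<Rightarrow> bool"
  where "cod n T c \<longleftrightarrow> (\<exists>X. finite X \<and> card X \<le> c \<and> Hom n \<subseteq> falg.span X + T)"

lemma cod_mono:
  assumes "cod n T c" "T \<subseteq> T'" "c \<le> c'"
  shows "cod n T' c'"
  using assms set_plus_mono2[OF order_refl assms(2)] unfolding cod_def by (meson order_trans)

lemma cod_Hom: "cod n (Hom n) 0"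
  unfolding cod_def by (intro exI[of _ "{}"]) (auto simp: set_plus_def)

text \<open>Codimensions add: representatives modulo \<open>Q\<close> are moved into
  \<open>P\<close>, so they can be joined to those modulo \<open>P\<close>.\<close>

lemma cod_inter:
  assumes "cod n P c" "cod n Q d" "falg.subspace P" "falg.subspace Q" "P \<subseteq> Hom n"
  shows "cod n (P \<inter> Q) (c + d)"
proof -
  obtain X Y where X: "finite X" "card X \<le> c" "Hom n \<subseteq> falg.span X + P"
    and Y: "finite Y" "card Y \<le> d" "Hom n \<subseteq> falg.span Y + Q"
    using assms(1,2) unfolding cod_def by blast
  have "P \<subseteq> falg.span Y + Q" using assms(5) Y(3) by (rule order_trans)
  then obtain Y' where Y': "finite Y'" "card Y' \<le> card Y" "P \<subseteq> falg.span Y' + (P \<inter> Q)"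
    by (rule subspace_spanning_mod[OF assms(3,4) Y(1)])
  have "Hom n \<subseteq> falg.span X + (falg.span Y' + (P \<inter> Q))"
    using X(3) set_plus_mono2[OF order_refl Y'(3)] by (rule order_trans)
  also have "\<dots> = falg.span (X \<union> Y') + (P \<inter> Q)"
  proof -
    have "falg.span (X \<union> Y') = falg.span X + falg.span Y'"
      using falg.span_Un[of X Y'] by (auto simp: set_plus_def)
    then show ?thesis by (simp add: add.assoc)
  qed
  finally have "Hom n \<subseteq> falg.span (X \<union> Y') + (P \<inter> Q)" .
  moreover have "card (X \<union> Y') \<le> c + d"
    using card_Un_le[of X Y'] X(2) Y(2) Y'(2) by linarith
  ultimately show ?thesis unfolding cod_def using X(1) Y'(1) by (intro exI[of _ "X \<union> Y'"]) auto
qed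

lemma cod_INT:
  assumes "finite I" "\<And>i. i \<in> I \<Longrightarrow> cod n (T i) c" "\<And>i. i \<in> I \<Longrightarrow> falg.subspace (T i)"
  shows "cod n (Hom n \<inter> (\<Inter>i\<in>I. T i)) (card I * c)"
  using assms
proof (induction I rule: finite_induct)
  case empty
  then show ?case by (simp add: cod_Hom)
next
  case (insert i I)
  have "cod n ((Hom n \<inter> (\<Inter>i\<in>I. T i)) \<inter> T i) (card I * c + c)"
  proof (rule cod_inter)
    show "cod n (Hom n \<inter> (\<Inter>i\<in>I. T i)) (card I * c)" using insert by simp
    show "cod n (T i) c" "falg.subspace (T i)" using insert.prems by auto
    show "falg.subspace (Hom n \<inter> (\<Inter>i\<in>I. T i))"
      using insert.prems by (intro falg.subspace_inter subspace_Hom falg.subspace_Int) auto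
  qed auto
  moreover have "(Hom n \<inter> (\<Inter>i\<in>I. T i)) \<inter> T i = Hom n \<inter> (\<Inter>i\<in>insert i I. T i)" by auto
  ultimately show ?case using insert.hyps by (simp add: add.commute)
qed

text \<open>Codimensions multiply for juxtaposed intervals: in \<open>(x + t) * (y + s)\<close> all
  terms except \<open>x * y\<close> lie in \<open>T\<close>.\<close>

lemma cod_mult:
  assumes "cod a T1 c" "cod b T2 d" "T1 \<subseteq> Hom a" "falg.subspace T"
    and "\<And>t q. t \<in> T1 \<Longrightarrow> q \<in> Hom b \<Longrightarrow> t * q \<in> T"
    and "\<And>p t. p \<in> Hom a \<Longrightarrow> t \<in> T2 \<Longrightarrow> p * t \<in> T"
  shows "cod (a + b) T (c * d)"
proof -
  obtain X Y where X: "finite X" "card X \<le> c" "Hom a \<subseteq> falg.span X + T1"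
    and Y: "finite Y" "card Y \<le> d" "Hom b \<subseteq> falg.span Y + T2"
    using assms(1,2) unfolding cod_def by blast
  have "Hom (a + b) \<subseteq> falg.span (X * Y) + T"
  proof (rule Hom_split_subset)
    show "falg.subspace (falg.span (X * Y) + T)" using assms(4) by (simp add: subspace_plus)
    fix p q :: "'a falg" assume p: "p \<in> Hom a" and q: "q \<in> Hom b"
    obtain x t where x: "p = x + t" "x \<in> falg.span X" "t \<in> T1"
      using X(3) p by (auto elim!: set_plus_elim)
    obtain y s where y: "q = y + s" "y \<in> falg.span Y" "s \<in> T2"
      using Y(3) q by (auto elim!: set_plus_elim)
    \<comment> \<open>The set \<open>X\<close> need not be homogeneous, but this particular
      \<open>x\<close> is, which is what the hypothesis on left factors of \<open>T2\<close> asks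
      for.\<close>
    have "x = p - t" using x(1) by simp
    then have "x \<in> Hom a" using p x(3) assms(3) by (auto intro: falg.subspace_diff)
    have "x * y \<in> falg.span (X * Y)"
      by (rule mult_span[OF falg.subspace_span _ x(2) y(2)]) (intro falg.span_base set_times_intro)
    moreover have "x * s + t * q \<in> T"
      using assms(5,6) \<open>x \<in> Hom a\<close> y(3) x(3) q by (intro falg.subspace_add[OF assms(4)])
    ultimately have "x * y + (x * s + t * q) \<in> falg.span (X * Y) + T" by (rule set_plus_intro)
    moreover have "x * y + (x * s + t * q) = p * q" by (simp add: x(1) y(1) algebra_simps)
    ultimately show "p * q \<in> falg.span (X * Y) + T" by simp
  qed
  moreover have XY: "X * Y = (\<lambda>(x, y). x * y) ` (X \<times> Y)" by (auto simp: set_times_def)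
  have "card (X * Y) \<le> card (X \<times> Y)" unfolding XY using X(1) Y(1) by (intro card_image_le) auto
  then have "card (X * Y) \<le> c * d"
    using mult_le_mono[OF X(2) Y(2)] by (simp add: card_cartesian_product)
  ultimately show ?thesis unfolding cod_def using X(1) Y(1) XY by (intro exI[of _ "X * Y"]) auto
qed

section \<open>Annihilator conditions at a position\<close>

text \<open>The condition in the definition of \<open>E\<close> at one position: \<open>r\<close>
  occupies the letters from \<open>j\<close> to \<open>j + n\<close> of a block of length
  \<open>j + n + l\<close>. Testing on words keeps the splitting of neighbours simple;
  \<open>Ann_iff_sprod\<close> returns to the products of subspaces.\<close>

definition Ann :: "'k::field falg set \<Rightarrow> nat \<Rightarrow> nat \<Rightarrow> nat \<Rightarrow> 'k falg set"
  where "Ann T j n l = {r \<in> Hom n. \<forall>u v. mon_length u = j \<longrightarrow> mon_length v = l \<longrightarrow> wd u * r * wd v \<in> T}"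

lemma AnnD: "r \<in> Ann T j n l \<Longrightarrow> mon_length u = j \<Longrightarrow> mon_length v = l \<Longrightarrow> wd u * r * wd v \<in> T"
  by (simp add: Ann_def)

lemma AnnI:
  assumes "r \<in> Hom n" "\<And>u v. mon_length u = j \<Longrightarrow> mon_length v = l \<Longrightarrow> wd u * r * wd v \<in> T"
  shows "r \<in> Ann T j n l"
  using assms by (simp add: Ann_def)

lemma Ann_Hom: "r \<in> Ann T j n l \<Longrightarrow> r \<in> Hom n"
  by (simp add: Ann_def)

lemma Ann_mono: "T \<subseteq> T' \<Longrightarrow> Ann T j n l \<subseteq> Ann T' j n l"
  by (auto simp: Ann_def)

lemma subspace_Ann:
  assumes "falg.subspace T"
  shows "falg.subspace (Ann T j n l)"
  by (rule falg.subspaceI)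
     (auto simp: Ann_def algebra_simps scl_mult_left scl_mult_right
       intro: falg.subspace_add[OF assms] falg.subspace_scale[OF assms] falg.subspace_0[OF assms]
        falg.subspace_add[OF subspace_Hom] falg.subspace_scale[OF subspace_Hom] falg.subspace_0[OF subspace_Hom])

lemma Ann_iff_sprod:
  assumes "falg.subspace T"
  shows "r \<in> Ann T j n l \<longleftrightarrow> r \<in> Hom n \<and> Hom j \<cdot> {r} \<cdot> Hom l \<subseteq> T"
proof
  assume r: "r \<in> Ann T j n l"
  have "p * r * q \<in> T" if "p \<in> Hom j" "q \<in> Hom l" for p q
  proof -
    have "wd u * r * q \<in> T" if "mon_length u = j" for u
      by (rule Hom_lin[OF lin_mult_left assms _ \<open>q \<in> Hom l\<close>]) (use AnnD[OF r] that in auto)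
    then show ?thesis
      by (intro Hom_lin[where f = "\<lambda>p. p * r * q" and p = p, OF _ assms _ \<open>p \<in> Hom j\<close>])
         (auto intro!: linI simp: algebra_simps scl_mult_left)
  qed
  then show "r \<in> Hom n \<and> Hom j \<cdot> {r} \<cdot> Hom l \<subseteq> T"
    using Ann_Hom[OF r] by (auto simp: sprod3_subset_iff[OF assms])
next
  assume "r \<in> Hom n \<and> Hom j \<cdot> {r} \<cdot> Hom l \<subseteq> T"
  then show "r \<in> Ann T j n l"
    by (auto simp: sprod3_subset_iff[OF assms] intro!: AnnI)
qed

lemma self_Ann: "r \<in> T \<Longrightarrow> r \<in> Hom n \<Longrightarrow> r \<in> Ann T 0 n 0"
  by (auto intro!: AnnI)

section \<open>Projections along a complement\<close>

lemma projection_exists: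
  fixes U V :: "'k::field falg set"
  assumes V: "falg.subspace V" and U: "falg.subspace U"
    and VU: "V + U = Hom n" and disj: "V \<inter> U = {0}"
  obtains \<pi> where "lin \<pi>" "\<And>v. v \<in> V \<Longrightarrow> \<pi> v = v" "\<And>u. u \<in> U \<Longrightarrow> \<pi> u = 0"
proof -
  \<comment> \<open>Taking the homogeneous component before projecting makes the map total and
    linear on the whole algebra, the form that \<open>tens\<close> expects.\<close>
  define \<pi> where "\<pi> p = (SOME v. v \<in> V \<and> hcomp n p - v \<in> U)" for p
  have ex: "\<exists>v. v \<in> V \<and> hcomp n p - v \<in> U" for p
  proof -
    have "hcomp n p \<in> V + U" by (simp add: VU)
    then show ?thesis by (auto elim!: set_plus_elim)
  qed
  have \<pi>: "\<pi> p \<in> V \<and> hcomp n p - \<pi> p \<in> U" for p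
    unfolding \<pi>_def by (rule someI_ex[OF ex])
  have unique: "v = w" if "v \<in> V" "w \<in> V" "h - v \<in> U" "h - w \<in> U" for v w h
  proof -
    have "v - w \<in> V" using that V by (intro falg.subspace_diff)
    moreover have "v - w = (h - w) - (h - v)" by simp
    then have "v - w \<in> U" using that falg.subspace_diff[OF U] by metis
    ultimately have "v - w \<in> {0}" using disj by blast
    then show ?thesis by simp
  qed
  have hom: "hcomp n p = p" if "p \<in> V \<or> p \<in> U" for p
    using that hcomp_Hom[of p n n] VU subsetD[of "V + U" "Hom n" p]
      set_plus_intro[of p V 0 U] set_plus_intro[of 0 V p U] falg.subspace_0[OF V] falg.subspace_0[OF U] by auto
  have "lin \<pi>"
  proof (rule linI)
    fix p q
    have "hcomp n (p + q) - (\<pi> p + \<pi> q) = (hcomp n p - \<pi> p) + (hcomp n q - \<pi> q)"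
      by (simp add: falg_pair.linear_add[OF lin_hcomp])
    then have "hcomp n (p + q) - (\<pi> p + \<pi> q) \<in> U"
      using \<pi> falg.subspace_add[OF U] by metis
    then show "\<pi> (p + q) = \<pi> p + \<pi> q"
      using \<pi> falg.subspace_add[OF V] by (intro unique[of _ _ "hcomp n (p + q)"]) auto
  next
    fix c p
    have "hcomp n (scl c p) - scl c (\<pi> p) = scl c (hcomp n p - \<pi> p)"
      by (simp add: falg_pair.linear_scale[OF lin_hcomp] falg.scale_right_diff_distrib)
    then have "hcomp n (scl c p) - scl c (\<pi> p) \<in> U"
      using \<pi> falg.subspace_scale[OF U] by metis
    then show "\<pi> (scl c p) = scl c (\<pi> p)"
      using \<pi> falg.subspace_scale[OF V] by (intro unique[of _ _ "hcomp n (scl c p)"]) auto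
  qed
  moreover have "\<pi> v = v" if "v \<in> V" for v
    using \<pi>[of v] that by (intro unique[of _ _ "hcomp n v"]) (auto simp: hom falg.subspace_0[OF U])
  moreover have "\<pi> u = 0" if "u \<in> U" for u
    using \<pi>[of u] that by (intro unique[of _ _ "hcomp n u"]) (auto simp: hom falg.subspace_0[OF V])
  ultimately show thesis by (rule that)
qed

text \<open>Besides non-nilpotency it serves the construction of \<open>U\<close>: words in
  \<open>W * W\<close> are fixed while the old relations vanish, which bounds how many of these
  words a new space can destroy.\<close>

lemma square_projection_exists:
  fixes U V :: "'k::field falg set"
  assumes V: "falg.subspace V" and U: "falg.subspace U"
    and VU: "V + U = Hom n" and disj: "V \<inter> U = {0}"
  obtains \<rho> where "lin \<rho>" "\<And>v w. v \<in> V \<Longrightarrow> w \<in> V \<Longrightarrow> \<rho> (v * w) = v * w"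
    "\<And>x. x \<in> U \<cdot> Hom n + Hom n \<cdot> U \<Longrightarrow> \<rho> x = 0"
proof -
  obtain \<pi> where \<pi>: "lin \<pi>" "\<And>v. v \<in> V \<Longrightarrow> \<pi> v = v" "\<And>u. u \<in> U \<Longrightarrow> \<pi> u = 0"
    by (rule projection_exists[OF assms]) blast
  have hom: "V \<subseteq> Hom n" "U \<subseteq> Hom n"
    using plus_subset_iff[OF V U subspace_Hom, of n] VU by auto
  let ?r = "tens n \<pi> \<pi>"
  have K: "falg.subspace {x. ?r x \<in> {0}}"
    by (rule falg_pair.linear_subspace_linear_preimage[OF lin_tens]) simp
  have "?r (x * y) = 0 \<and> ?r (y * x) = 0" if "x \<in> U" "y \<in> Hom n" for x y
    using tens_mult[OF \<pi>(1) \<pi>(1), of x n y n] tens_mult[OF \<pi>(1) \<pi>(1), of y n x n] hom that \<pi>(3) by auto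
  then have "U \<cdot> Hom n + Hom n \<cdot> U \<subseteq> {x. ?r x \<in> {0}}"
    unfolding plus_subset_iff[OF subspace_sprod subspace_sprod K] sprod_subset_iff[OF K] by auto
  moreover have "?r (v * w) = v * w" if "v \<in> V" "w \<in> V" for v w
    using tens_mult[OF \<pi>(1) \<pi>(1), of v n w n] hom that \<pi>(2) by auto
  ultimately show thesis by (intro that[of ?r] lin_tens) auto
qed

lemma subspace_Hom_basis:
  fixes P :: "'k::field falg set"
  assumes "falg.subspace P" "P \<subseteq> Hom n"
  obtains B where "B \<subseteq> P" "falg.independent B" "P = falg.span B" "finite B" "card B = falg.dim P"
proof -
  obtain B where B: "B \<subseteq> P" "falg.independent B" "P \<subseteq> falg.span B" "card B = falg.dim P"
    by (rule falg.basis_exists)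
  have "B \<subseteq> falg.span (Mon n)" using B(1) assms(2) by (auto simp: Hom_def)
  then have "finite B" using falg.independent_span_bound[OF finite_Mon B(2)] by blast
  moreover have "P = falg.span B"
    using B(1,3) falg.span_minimal[OF B(1) assms(1)] by blast
  ultimately show thesis using B that by simp
qed

text \<open>Indices are exponents of two rather than degrees. Since \<open>V k\<close> is nonzero,
  every \<open>dV k\<close> is at least \<open>1\<close>, so products of these numbers do not shrink
  when factors are added.\<close>

locale splitting =
  fixes U V :: "nat \<Rightarrow> 'k::field falg set"
  assumes subspace_U: "falg.subspace (U k)" and U_Hom: "U k \<subseteq> Hom (2 ^ k)"
    and subspace_V: "falg.subspace (V k)" and V_Hom: "V k \<subseteq> Hom (2 ^ k)"
    and V_plus_U: "V k + U k = Hom (2 ^ k)" and V_inter_U: "V k \<inter> U k = {0}"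
    and V_nonzero: "V k \<noteq> {0}"
    and U_step: "Hom (2 ^ k) \<cdot> U k + U k \<cdot> Hom (2 ^ k) \<subseteq> U (Suc k)"
begin

text \<open>Modulo this space, degree \<open>2 ^ Suc k\<close> becomes the tensor square of
  \<open>V k\<close>. It is the target in the definition of \<open>E\<close>, and its inclusion in
  \<open>U (Suc k)\<close> links one level to the next.\<close>

definition UU :: "nat \<Rightarrow> 'k falg set"
  where "UU k = U k \<cdot> Hom (2 ^ k) + Hom (2 ^ k) \<cdot> U k"

lemma subspace_UU: "falg.subspace (UU k)"
  by (simp add: UU_def subspace_plus)

lemma UU_subset_U: "UU k \<subseteq> U (Suc k)"
  using U_step[of k] by (simp add: UU_def add.commute)

lemma UU_subset_iff:
  assumes "falg.subspace T"
  shows "UU k \<subseteq> T \<longleftrightarrow> (\<forall>x\<in>U k. \<forall>y\<in>Hom (2 ^ k). x * y \<in> T \<and> y * x \<in> T)"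
  unfolding UU_def
  by (simp add: plus_subset_iff[OF _ _ assms] sprod_subset_iff[OF assms]) blast

lemma UU_I:
  assumes "x \<in> U k" "y \<in> Hom (2 ^ k)"
  shows "x * y \<in> UU k" "y * x \<in> UU k"
  using UU_subset_iff[OF subspace_UU, of k k] assms by blast+

lemma Ann_UU_left:
  assumes "r \<in> Ann (U k) j n l"
  shows "r \<in> Ann (UU k) j n (l + 2 ^ k)"
proof (rule AnnI)
  show "r \<in> Hom n" using assms by (rule Ann_Hom)
  fix u v assume u: "mon_length u = j" and "mon_length v = l + 2 ^ k"
  then obtain v1 v2 where v: "v = v1 + v2" "mon_length v1 = l" "mon_length v2 = 2 ^ k"
    by (elim word_split)
  have "(wd u * r * wd v1) * wd v2 \<in> UU k"
    using AnnD[OF assms u v(2)] v(3) by (intro UU_I) auto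
  then show "wd u * r * wd v \<in> UU k" by (simp add: v(1) wd_mult[symmetric] mult.assoc)
qed

lemma Ann_UU_right:
  assumes "r \<in> Ann (U k) j n l"
  shows "r \<in> Ann (UU k) (2 ^ k + j) n l"
proof (rule AnnI)
  show "r \<in> Hom n" using assms by (rule Ann_Hom)
  fix u v assume v: "mon_length v = l" and "mon_length u = 2 ^ k + j"
  then obtain u1 u2 where u: "u = u1 + u2" "mon_length u1 = 2 ^ k" "mon_length u2 = j"
    by (elim word_split)
  have "wd u1 * (wd u2 * r * wd v) \<in> UU k"
    using AnnD[OF assms u(3) v] u(2) by (intro UU_I) auto
  then show "wd u * r * wd v \<in> UU k" by (simp add: u(1) wd_mult[symmetric] mult.assoc)
qed

text \<open>The midpoint of the block separates \<open>r\<close> from \<open>q\<close>: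
  \<open>r\<close> completes the left half to an element of \<open>U k\<close>, and \<open>q\<close>
  together with the word behind it fills the right half.\<close>

lemma Ann_UU_cross_left:
  assumes "r \<in> Ann (U k) j a 0" "q \<in> Hom b" "b + l = 2 ^ k"
  shows "r * q \<in> Ann (UU k) j (a + b) l"
proof (rule AnnI)
  show "r * q \<in> Hom (a + b)" using Ann_Hom[OF assms(1)] assms(2) by (rule Hom_mult)
  fix u v assume u: "mon_length u = j" and v: "mon_length v = l"
  have "q * wd v \<in> Hom (b + l)" using assms(2) v by (intro Hom_mult) auto
  then have "(wd u * r) * (q * wd v) \<in> UU k"
    using AnnD[OF assms(1) u, of 0] assms(3) by (intro UU_I) auto
  then show "wd u * (r * q) * wd v \<in> UU k" by (simp add: mult.assoc)
qed

lemma Ann_UU_cross_right: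
  assumes "p \<in> Hom a" "r \<in> Ann (U k) 0 b l" "j + a = 2 ^ k"
  shows "p * r \<in> Ann (UU k) j (a + b) l"
proof (rule AnnI)
  show "p * r \<in> Hom (a + b)" using assms(1) Ann_Hom[OF assms(2)] by (rule Hom_mult)
  fix u v assume u: "mon_length u = j" and v: "mon_length v = l"
  have "wd u * p \<in> Hom (j + a)" using assms(1) u by (intro Hom_mult) auto
  then have "(wd u * p) * (r * wd v) \<in> UU k"
    using AnnD[OF assms(2) _ v, of 0] assms(3) by (intro UU_I) auto
  then show "wd u * (p * r) * wd v \<in> UU k" by (simp add: mult.assoc)
qed

lemma Ann_U_of_UU: "r \<in> Ann (UU k) j n l \<Longrightarrow> r \<in> Ann (U (Suc k)) j n l"
  using Ann_mono[OF UU_subset_U] by blast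

section \<open>Bounds for the codimensions\<close>

definition dV :: "nat \<Rightarrow> nat"
  where "dV k = falg.dim (V k)"

lemma finite_basis_V:
  obtains B where "V k = falg.span B" "finite B" "card B = dV k"
  using subspace_Hom_basis[OF subspace_V V_Hom] by (metis dV_def)

lemma cod_U: "cod (2 ^ k) (U k) (dV k)"
proof -
  obtain B where "V k = falg.span B" "finite B" "card B = dV k"
    by (rule finite_basis_V)
  then show ?thesis using V_plus_U[of k] unfolding cod_def by (intro exI[of _ B]) auto
qed

lemma dV_pos: "1 \<le> dV k"
proof -
  obtain B where "V k = falg.span B" "finite B" "card B = dV k"
    by (rule finite_basis_V)
  then show ?thesis using V_nonzero[of k] by (cases "card B") auto
qed

lemma cod_Ann_0: "falg.subspace T \<Longrightarrow> cod 0 (Ann T j 0 l) 1"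
  unfolding cod_def
  by (intro exI[of _ "{1}"])
     (auto simp: Hom_0 set_plus_def intro!: bexI falg.subspace_0[OF subspace_Ann])

lemma U_Ann: "r \<in> U k \<Longrightarrow> r \<in> Ann (U k) 0 (2 ^ k) 0"
  using U_Hom self_Ann by blast

text \<open>The recursion reads the binary digits of \<open>n\<close>. Either the prefix stays in
  the left half, or it consists of the full left half, costing \<open>dV k\<close>, and a prefix of
  the right half. Thus each level below \<open>k\<close> is charged at most once.\<close>

lemma cod_prefix_less:
  assumes "n + l = 2 ^ k" "n < 2 ^ k"
  shows "cod n (Ann (U k) 0 n l) (\<Prod>i<k. dV i)"
  using assms
proof (induction k arbitrary: n l)
  case 0
  then show ?case using cod_Ann_0[OF subspace_U] by simp
next
  case (Suc k)
  show ?case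
  proof (cases "n < 2 ^ k")
    case True
    then have "cod n (Ann (U k) 0 n (l - 2 ^ k)) (\<Prod>i<k. dV i)"
      using Suc.prems by (intro Suc.IH) auto
    moreover have "Ann (U k) 0 n (l - 2 ^ k) \<subseteq> Ann (U (Suc k)) 0 n l"
      using Ann_U_of_UU[OF Ann_UU_left, of _ k 0 n "l - 2 ^ k"] Suc.prems True by auto
    ultimately show ?thesis
      by (rule cod_mono) (use dV_pos[of k] in simp)
  next
    case False
    then obtain n' where n': "n = 2 ^ k + n'" using le_Suc_ex not_less by blast
    have "cod (2 ^ k + n') (Ann (U (Suc k)) 0 n l) (dV k * (\<Prod>i<k. dV i))"
    proof (rule cod_mult[OF cod_U Suc.IH U_Hom subspace_Ann[OF subspace_U]])
      show "n' + l = 2 ^ k" "n' < 2 ^ k" using Suc.prems n' by auto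
      then show "t * q \<in> Ann (U (Suc k)) 0 n l" if "t \<in> U k" "q \<in> Hom n'" for t q
        using that unfolding n' by (intro Ann_U_of_UU Ann_UU_cross_left U_Ann)
      show "p * t \<in> Ann (U (Suc k)) 0 n l" if "p \<in> Hom (2 ^ k)" "t \<in> Ann (U k) 0 n' l" for p t
        using that unfolding n' by (intro Ann_U_of_UU Ann_UU_cross_right) auto
    qed
    then show ?thesis by (simp add: n' mult.commute)
  qed
qed

text \<open>The mirror image of the argument for prefixes, with the full right half split
  off.\<close>

lemma cod_suffix_less:
  assumes "j + n = 2 ^ k" "n < 2 ^ k"
  shows "cod n (Ann (U k) j n 0) (\<Prod>i<k. dV i)"
  using assms
proof (induction k arbitrary: n j)
  case 0
  then show ?case using cod_Ann_0[OF subspace_U] by simp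
next
  case (Suc k)
  show ?case
  proof (cases "n < 2 ^ k")
    case True
    then have "cod n (Ann (U k) (j - 2 ^ k) n 0) (\<Prod>i<k. dV i)"
      using Suc.prems by (intro Suc.IH) auto
    moreover have "Ann (U k) (j - 2 ^ k) n 0 \<subseteq> Ann (U (Suc k)) j n 0"
      using Ann_U_of_UU[OF Ann_UU_right, of _ k "j - 2 ^ k" n 0] Suc.prems True by auto
    ultimately show ?thesis
      by (rule cod_mono) (use dV_pos[of k] in simp)
  next
    case False
    then obtain n' where n': "n = n' + 2 ^ k" using le_Suc_ex not_less by (metis add.commute)
    have "cod (n' + 2 ^ k) (Ann (U (Suc k)) j n 0) ((\<Prod>i<k. dV i) * dV k)"
    proof (rule cod_mult[OF Suc.IH cod_U _ subspace_Ann[OF subspace_U]])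
      show jn: "j + n' = 2 ^ k" "n' < 2 ^ k" using Suc.prems n' by auto
      show "Ann (U k) j n' 0 \<subseteq> Hom n'" using Ann_Hom by blast
      show "t * q \<in> Ann (U (Suc k)) j n 0" if "t \<in> Ann (U k) j n' 0" "q \<in> Hom (2 ^ k)" for t q
        using that unfolding n' by (intro Ann_U_of_UU Ann_UU_cross_left) auto
      show "p * t \<in> Ann (U (Suc k)) j n 0" if "p \<in> Hom n'" "t \<in> U k" for p t
        using that jn unfolding n' by (intro Ann_U_of_UU Ann_UU_cross_right U_Ann)
    qed
    then show ?thesis by (simp add: n' mult.commute)
  qed
qed

definition Q :: "nat \<Rightarrow> nat"
  where "Q k = (\<Prod>i\<le>k. dV i)"

lemma Q_Suc: "Q (Suc k) = Q k * dV (Suc k)"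
  by (simp add: Q_def)

lemma Q_mono_Suc: "Q k \<le> Q (Suc k)"
  using dV_pos[of "Suc k"] by (simp add: Q_Suc)

lemma prod_dV_pos: "1 \<le> (\<Prod>i\<in>A. dV i)"
  by (rule prod_ge_1) (rule dV_pos)

lemma prod_less_Q: "(\<Prod>i<k. dV i) \<le> Q k"
proof -
  have "Q k = (\<Prod>i<k. dV i) * dV k"
    unfolding Q_def lessThan_Suc_atMost[symmetric] by simp
  then show ?thesis using dV_pos[of k] by simp
qed

lemma dV_le_Q: "dV k \<le> Q k"
proof -
  have "Q k = (\<Prod>i<k. dV i) * dV k"
    unfolding Q_def lessThan_Suc_atMost[symmetric] by simp
  then show ?thesis using prod_dV_pos[of "{..<k}"] by simp
qed

lemma cod_U_Ann: "cod (2 ^ k) (Ann (U k) 0 (2 ^ k) 0) (dV k)"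
  by (rule cod_mono[OF cod_U]) (auto intro: U_Ann)

lemma cod_prefix:
  assumes "n + l = 2 ^ k"
  shows "cod n (Ann (U k) 0 n l) (Q k)"
proof (cases "n < 2 ^ k")
  case True
  show ?thesis by (rule cod_mono[OF cod_prefix_less[OF assms True] order_refl prod_less_Q])
next
  case False
  then have "n = 2 ^ k" "l = 0" using assms by auto
  then show ?thesis using cod_mono[OF cod_U_Ann order_refl dV_le_Q] by simp
qed

lemma cod_suffix:
  assumes "j + n = 2 ^ k"
  shows "cod n (Ann (U k) j n 0) (Q k)"
proof (cases "n < 2 ^ k")
  case True
  show ?thesis by (rule cod_mono[OF cod_suffix_less[OF assms True] order_refl prod_less_Q])
next
  case False
  then have "n = 2 ^ k" "j = 0" using assms by auto
  then show ?thesis using cod_mono[OF cod_U_Ann order_refl dV_le_Q] by simp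
qed

text \<open>An interval inside one half costs nothing new. If it crosses the midpoint, it is a
  suffix of the left half followed by a prefix of the right half, which produces the square; no
  further splitting into two arbitrary intervals occurs. The bound for smaller blocks is an
  assumption so that the same step serves the induction for \<open>U\<close> and the final passage
  to \<open>UU\<close>.\<close>

lemma cod_interval_step:
  assumes IH: "\<And>j n l. j + n + l = 2 ^ k \<Longrightarrow> cod n (Ann (U k) j n l) ((Q k)\<^sup>2)"
    and jnl: "j + n + l = 2 ^ Suc k"
  shows "cod n (Ann (UU k) j n l) ((Q k)\<^sup>2)"
proof -
  consider "j + n \<le> 2 ^ k" | "2 ^ k \<le> j" | "j < 2 ^ k" "2 ^ k < j + n" by linarith
  then show ?thesis
  proof cases
    case 1
    then obtain l' where l': "l = l' + 2 ^ k" "j + n + l' = 2 ^ k"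
      using jnl by (intro that[of "l - 2 ^ k"]) auto
    show ?thesis
      by (rule cod_mono[OF IH[OF l'(2)] _ order_refl]) (use Ann_UU_left l'(1) in auto)
  next
    case 2
    then obtain j' where j': "j = 2 ^ k + j'" "j' + n + l = 2 ^ k"
      using jnl by (intro that[of "j - 2 ^ k"]) auto
    show ?thesis
      by (rule cod_mono[OF IH[OF j'(2)] _ order_refl]) (use Ann_UU_right j'(1) in auto)
  next
    case 3
    then obtain a b where ab: "n = a + b" "j + a = 2 ^ k" "b + l = 2 ^ k"
      using jnl by (intro that[of "2 ^ k - j" "j + n - 2 ^ k"]) auto
    have "cod (a + b) (Ann (UU k) j n l) (Q k * Q k)"
    proof (rule cod_mult[OF cod_suffix[OF ab(2)] cod_prefix[OF ab(3)] _ subspace_Ann[OF subspace_UU]])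
      show "Ann (U k) j a 0 \<subseteq> Hom a" using Ann_Hom by blast
      show "t * q \<in> Ann (UU k) j n l" if "t \<in> Ann (U k) j a 0" "q \<in> Hom b" for t q
        using that ab by (auto intro: Ann_UU_cross_left)
      show "p * t \<in> Ann (UU k) j n l" if "p \<in> Hom a" "t \<in> Ann (U k) 0 b l" for p t
        using that ab by (auto intro: Ann_UU_cross_right)
    qed
    then show ?thesis by (simp add: ab(1) power2_eq_square)
  qed
qed

lemma cod_interval_U:
  assumes "j + n + l = 2 ^ k"
  shows "cod n (Ann (U k) j n l) ((Q k)\<^sup>2)"
  using assms
proof (induction k arbitrary: j n l)
  case 0
  have Q1: "1 \<le> Q k" for k using prod_dV_pos by (simp add: Q_def)
  consider "n = 0" | "n = 1" "j = 0" "l = 0" using 0 by fastforce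
  then show ?case
  proof cases
    case 1
    show ?thesis unfolding 1
      by (rule cod_mono[OF cod_Ann_0[OF subspace_U] order_refl]) (rule one_le_power[OF Q1])
  next
    case 2
    have "Q 0 \<le> (Q 0)\<^sup>2" using Q1[of 0] by (simp add: power2_eq_square)
    with cod_prefix[of 1 0 0] show ?thesis unfolding 2 by (auto intro: cod_mono[OF _ order_refl])
  qed
next
  case (Suc k)
  have "cod n (Ann (UU k) j n l) ((Q k)\<^sup>2)"
    by (rule cod_interval_step[OF Suc])
  then show ?case
    by (rule cod_mono[OF _ Ann_mono[OF UU_subset_U]]) (simp add: power_mono Q_mono_Suc)
qed

lemma cod_interval_UU:
  assumes "j + n + l = 2 ^ Suc k"
  shows "cod n (Ann (UU k) j n l) ((Q k)\<^sup>2)"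
  by (rule cod_interval_step[OF cod_interval_U assms])

section \<open>The ideal \<open>E\<close>\<close>

text \<open>The degree component of \<open>E\<close> with the level \<open>k\<close> of the window
  made independent of the degree \<open>n\<close>, because multiplication changes \<open>n\<close>
  while the level at first stays the same.\<close>

definition Eann :: "nat \<Rightarrow> nat \<Rightarrow> 'k falg set"
  where "Eann k n = {r \<in> Hom n. \<forall>j l. j + n + l = 2 ^ Suc k \<longrightarrow> r \<in> Ann (UU k) j n l}"

lemma EannD: "r \<in> Eann k n \<Longrightarrow> j + n + l = 2 ^ Suc k \<Longrightarrow> r \<in> Ann (UU k) j n l"
  by (simp add: Eann_def)

lemma Eann_INT:
  assumes "n \<le> 2 ^ Suc k"
  shows "Eann k n = Hom n \<inter> (\<Inter>j\<in>{..2 ^ Suc k - n}. Ann (UU k) j n (2 ^ Suc k - n - j))"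
proof -
  have "l = 2 ^ Suc k - n - j" if "j + n + l = 2 ^ Suc k" for j l
    using that by simp
  moreover have "j + n + (2 ^ Suc k - n - j) = 2 ^ Suc k" if "j \<le> 2 ^ Suc k - n" for j
    using that assms by simp
  ultimately show ?thesis
    unfolding Eann_def by fastforce
qed

lemma subspace_Eann: "falg.subspace (Eann k n)"
  by (rule falg.subspaceI)
     (auto simp: Eann_def intro: falg.subspace_0[OF subspace_Ann[OF subspace_UU]]
        falg.subspace_add[OF subspace_Ann[OF subspace_UU]] falg.subspace_scale[OF subspace_Ann[OF subspace_UU]]
        falg.subspace_0[OF subspace_Hom] falg.subspace_add[OF subspace_Hom] falg.subspace_scale[OF subspace_Hom])

lemma cod_Eann:
  assumes "n \<le> 2 ^ Suc k"
  shows "cod n (Eann k n) ((2 ^ Suc k + 1) * (Q k)\<^sup>2)"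
proof -
  have "cod n (Eann k n) (card {..2 ^ Suc k - n} * (Q k)\<^sup>2)"
    unfolding Eann_INT[OF assms]
    using assms by (intro cod_INT subspace_Ann subspace_UU cod_interval_UU) auto
  then show ?thesis by (rule cod_mono) auto
qed

text \<open>An interval of length at most \<open>2 ^ k\<close> in a block of length
  \<open>2 ^ (k + 2)\<close> lies in the left half, in the right half, or in the middle half, formed
  by the second and third quarters. Each of these has length \<open>2 ^ Suc k\<close>, so the
  hypothesis applies there. This covers the change of level when a degree reaches a power of
  two.\<close>

lemma Eann_Suc:
  assumes "r \<in> Eann k n" "n \<le> 2 ^ k"
  shows "r \<in> Eann (Suc k) n"
proof -
  have "r \<in> Ann (UU (Suc k)) j n l" if jnl: "j + n + l = 2 ^ Suc (Suc k)" for j l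
  proof -
    consider "j + n \<le> 2 ^ Suc k" | "2 ^ Suc k \<le> j" | "2 ^ k \<le> j" "2 ^ k \<le> l"
      using jnl assms(2) by fastforce
    then show ?thesis
    proof cases
      case 1
      then have "r \<in> Ann (UU k) j n (l - 2 ^ Suc k)"
        using jnl by (intro EannD[OF assms(1)]) auto
      from Ann_UU_left[OF Ann_U_of_UU[OF this]] show ?thesis using 1 jnl by auto
    next
      case 2
      then have "r \<in> Ann (UU k) (j - 2 ^ Suc k) n l"
        using jnl by (intro EannD[OF assms(1)]) auto
      from Ann_UU_right[OF Ann_U_of_UU[OF this]] show ?thesis using 2 by auto
    next
      case 3
      show ?thesis
      proof (rule AnnI)
        show "r \<in> Hom n" using assms(1) by (simp add: Eann_def)
        fix u v assume "mon_length u = j" "mon_length v = l"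
        then have "mon_length u = 2 ^ k + (j - 2 ^ k)" "mon_length v = (l - 2 ^ k) + 2 ^ k"
          using 3 by auto
        then obtain u1 u2 v1 v2 where uv: "u = u1 + u2" "mon_length u1 = 2 ^ k" "mon_length u2 = j - 2 ^ k"
          "v = v1 + v2" "mon_length v1 = l - 2 ^ k" "mon_length v2 = 2 ^ k"
          by (elim word_split)
        have "r \<in> Ann (UU k) (j - 2 ^ k) n (l - 2 ^ k)"
          using 3 jnl by (intro EannD[OF assms(1)]) auto
        then have inner: "wd u2 * r * wd v1 \<in> UU k" using uv by (auto intro: AnnD)
        \<comment> \<open>The outer quarters are \<open>u1\<close> and \<open>v2\<close>. An element
          of \<open>U k\<close> in the second quarter joins \<open>u1\<close> to put the left half
          into \<open>U (Suc k)\<close>; one in the third quarter joins \<open>v2\<close> to do the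
          same for the right half.\<close>
        let ?T = "{x. wd u1 * x * wd v2 \<in> UU (Suc k)}"
        have "UU k \<subseteq> ?T"
        proof (subst UU_subset_iff)
          show "falg.subspace ?T"
            by (rule falg_pair.linear_subspace_linear_preimage[OF lin_mult subspace_UU])
          show "\<forall>x\<in>U k. \<forall>y\<in>Hom (2 ^ k). x * y \<in> ?T \<and> y * x \<in> ?T"
          proof (intro ballI conjI)
            fix x y :: "'k falg" assume x: "x \<in> U k" and y: "y \<in> Hom (2 ^ k)"
            have y': "y * wd v2 \<in> Hom (2 ^ Suc k)" "wd u1 * y \<in> Hom (2 ^ Suc k)"
              using Hom_mult[OF y wd_in_Hom[OF uv(6)]] Hom_mult[OF wd_in_Hom[OF uv(2)] y]
              by (simp_all add: mult_2)
            have x': "wd u1 * x \<in> U (Suc k)" "x * wd v2 \<in> U (Suc k)"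
              using UU_I[OF x wd_in_Hom[OF uv(2)]] UU_I[OF x wd_in_Hom[OF uv(6)]] UU_subset_U by blast+
            show "x * y \<in> ?T" using UU_I(1)[OF x'(1) y'(1)] by (simp add: mult.assoc)
            show "y * x \<in> ?T" using UU_I(2)[OF x'(2) y'(2)] by (simp add: mult.assoc)
          qed
        qed
        with inner have "wd u1 * (wd u2 * r * wd v1) * wd v2 \<in> UU (Suc k)" by blast
        then show "wd u * r * wd v \<in> UU (Suc k)" by (simp add: uv wd_mult[symmetric] mult.assoc)
      qed
    qed
  qed
  then show ?thesis using assms(1) by (simp add: Eann_def)
qed

text \<open>The new letter is counted as part of the surrounding word, so every position of the
  longer interval yields a position of \<open>r\<close> in the same window.\<close>

lemma Eann_letter:
  assumes "r \<in> Eann k n" "mon_length x = 1"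
  shows "r * wd x \<in> Eann k (Suc n)" "wd x * r \<in> Eann k (Suc n)"
proof -
  have r: "r \<in> Hom n" using assms(1) by (simp add: Eann_def)
  have hom: "r * wd x \<in> Hom (Suc n)" "wd x * r \<in> Hom (Suc n)"
    using Hom_mult[OF r wd_in_Hom[OF assms(2)]] Hom_mult[OF wd_in_Hom[OF assms(2)] r] by simp_all
  have "r * wd x \<in> Ann (UU k) j (Suc n) l" if "j + Suc n + l = 2 ^ Suc k" for j l
  proof (rule AnnI[OF hom(1)])
    fix u v assume "mon_length u = j" "mon_length v = l"
    then show "wd u * (r * wd x) * wd v \<in> UU k"
      using AnnD[OF EannD[OF assms(1)], of j "Suc l" u "x + v"] that assms(2)
      by (simp add: wd_mult[symmetric] mult.assoc)
  qed
  then show "r * wd x \<in> Eann k (Suc n)" using hom by (simp add: Eann_def)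
  have "wd x * r \<in> Ann (UU k) j (Suc n) l" if "j + Suc n + l = 2 ^ Suc k" for j l
  proof (rule AnnI[OF hom(2)])
    fix u v assume "mon_length u = j" "mon_length v = l"
    then show "wd u * (wd x * r) * wd v \<in> UU k"
      using AnnD[OF EannD[OF assms(1)], of "Suc j" l "u + x" v] that assms(2)
      by (simp add: wd_mult[symmetric] mult.assoc)
  qed
  then show "wd x * r \<in> Eann k (Suc n)" using hom by (simp add: Eann_def)
qed

end

section \<open>Homogeneous components of \<open>E\<close> and closure under multiplication\<close>

lemma dyadic_unique:
  fixes n :: nat
  assumes "2 ^ m \<le> n" "n < 2 ^ Suc m" "2 ^ m' \<le> n" "n < 2 ^ Suc m'"
  shows "m = m'"
proof -
  have "(2::nat) ^ m < 2 ^ Suc m'" "(2::nat) ^ m' < 2 ^ Suc m" using assms by linarith+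
  then have "m < Suc m'" "m' < Suc m" by (auto intro: power_less_imp_less_exp[of "2::nat"] simp del: power_Suc)
  then show ?thesis by simp
qed

lemma dyadic_exists:
  fixes n :: nat
  assumes "1 \<le> n"
  obtains m where "2 ^ m \<le> n" "n < 2 ^ Suc m"
  using ex_power_ivl1[of 2 n] assms by auto

lemma subspace_Abar: "falg.subspace Abar"
  by (rule falg.subspaceI) (auto simp: Abar_def lookup_add)

lemma Hom_Abar:
  assumes "1 \<le> n"
  shows "Hom n \<subseteq> Abar"
proof
  fix p :: "'k::field falg" assume "p \<in> Hom n"
  then have "0 \<notin> Poly_Mapping.keys p" using assms by (auto simp: Hom_iff)
  then show "p \<in> Abar" by (simp add: Abar_def in_keys_iff)
qed

locale degree_splitting =
  fixes U V :: "nat \<Rightarrow> 'k::field falg set"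
  assumes splitting: "splitting (\<lambda>k. U (2 ^ k)) (\<lambda>k. V (2 ^ k))"
begin

sublocale splitting "\<lambda>k. U (2 ^ k)" "\<lambda>k. V (2 ^ k)"
  by (rule splitting)

text \<open>The level is \<open>Suc m\<close> because the windows have degree
  \<open>2 ^ (m + 2)\<close> and halves of degree \<open>2 ^ (m + 1)\<close>.\<close>

lemma E_deg_eq:
  assumes m: "2 ^ m \<le> n" "n < 2 ^ Suc m"
  shows "E_deg U n = Eann (Suc m) n"
proof -
  define P where "P m r \<longleftrightarrow> (\<forall>j\<le>2 ^ (m + 2) - n. Hom j \<cdot> {r} \<cdot> Hom (2 ^ (m + 2) - j - n) \<subseteq>
      U (2 ^ (m + 1)) \<cdot> Hom (2 ^ (m + 1)) + Hom (2 ^ (m + 1)) \<cdot> U (2 ^ (m + 1)))" for m r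
  have ex: "(\<exists>m'. 2 ^ m' \<le> n \<and> n < 2 ^ (m' + 1) \<and> R m') \<longleftrightarrow> R m" for R
    using dyadic_unique[OF m] m by (metis Suc_eq_plus1)
  have "P m r \<longleftrightarrow> (\<forall>j l. j + n + l = 2 ^ Suc (Suc m) \<longrightarrow> r \<in> Ann (UU (Suc m)) j n l)"
    if "r \<in> Hom n" for r
  proof -
    have UU_eq: "UU (Suc m) = U (2 ^ (m + 1)) \<cdot> Hom (2 ^ (m + 1)) + Hom (2 ^ (m + 1)) \<cdot> U (2 ^ (m + 1))"
      by (simp add: UU_def)
    have n: "n \<le> 2 ^ (m + 2)" using m(2) by simp
    have l: "l = 2 ^ (m + 2) - j - n \<and> j \<le> 2 ^ (m + 2) - n" if "j + n + l = 2 ^ Suc (Suc m)" for j l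
    proof -
      have "(2::nat) ^ Suc (Suc m) = 2 ^ (m + 2)" by simp
      then show ?thesis using that by linarith
    qed
    have l': "j + n + (2 ^ (m + 2) - j - n) = 2 ^ Suc (Suc m)" if "j \<le> 2 ^ (m + 2) - n" for j
      using that n by simp
    have "P m r \<longleftrightarrow> (\<forall>j\<le>2 ^ (m + 2) - n. r \<in> Ann (UU (Suc m)) j n (2 ^ (m + 2) - j - n))"
      unfolding P_def UU_eq[symmetric] Ann_iff_sprod[OF subspace_UU] by (simp only: \<open>r \<in> Hom n\<close> simp_thms)
    also have "\<dots> \<longleftrightarrow> (\<forall>j l. j + n + l = 2 ^ Suc (Suc m) \<longrightarrow> r \<in> Ann (UU (Suc m)) j n l)"
    proof (intro iffI allI impI)
      fix j l assume "\<forall>j\<le>2 ^ (m + 2) - n. r \<in> Ann (UU (Suc m)) j n (2 ^ (m + 2) - j - n)"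
        and "j + n + l = 2 ^ Suc (Suc m)"
      then show "r \<in> Ann (UU (Suc m)) j n l" using l[of j l] by blast
    qed (use l' in blast)
    finally show ?thesis .
  qed
  then show ?thesis
    unfolding E_deg_def P_def[symmetric] ex Eann_def by blast
qed

lemma E_deg_Hom: "E_deg U n \<subseteq> Hom n"
  by (auto simp: E_deg_def)

lemma subspace_E_deg:
  assumes "1 \<le> n"
  shows "falg.subspace (E_deg U n)"
  using dyadic_exists[OF assms] E_deg_eq subspace_Eann by metis

lemma E_deg_letter:
  assumes "1 \<le> n" "r \<in> E_deg U n" "mon_length x = 1"
  shows "r * wd x \<in> E_deg U (Suc n) \<and> wd x * r \<in> E_deg U (Suc n)"
proof -
  obtain m where m: "2 ^ m \<le> n" "n < 2 ^ Suc m" using assms(1) by (rule dyadic_exists)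
  have *: "r * wd x \<in> Eann (Suc m) (Suc n)" "wd x * r \<in> Eann (Suc m) (Suc n)"
    using Eann_letter[OF _ assms(3)] assms(2) E_deg_eq[OF m] by auto
  show ?thesis
  proof (cases "Suc n < 2 ^ Suc m")
    case True
    then show ?thesis using * E_deg_eq[of m "Suc n"] m by simp
  next
    case False
    \<comment> \<open>The level of the degree component jumps exactly here; the bound
      \<open>Suc n \<le> 2 ^ Suc m\<close> required by \<open>Eann_Suc\<close> holds with
      equality.\<close>
    then have n: "Suc n = 2 ^ Suc m" using m(2) by simp
    then have "E_deg U (Suc n) = Eann (Suc (Suc m)) (Suc n)"
      by (intro E_deg_eq) auto
    then show ?thesis using *[THEN Eann_Suc] n by simp
  qed
qed

lemma E_deg_word:
  assumes "1 \<le> n" "r \<in> E_deg U n"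
  shows "r * wd u \<in> E_deg U (n + mon_length u) \<and> wd u * r \<in> E_deg U (n + mon_length u)"
proof (induction "mon_length u" arbitrary: u)
  case 0
  then show ?case using assms by simp
next
  case (Suc k)
  obtain v x where u: "u = v + x" "mon_length v = k" "mon_length x = 1"
    using Suc.hyps(2) by (metis Suc_eq_plus1 word_split)
  obtain x' v' where u': "u = x' + v'" "mon_length x' = 1" "mon_length v' = k"
    using Suc.hyps(2) by (metis Suc_eq_plus1_left word_split)
  have "r * wd v * wd x \<in> E_deg U (Suc (n + k))"
    using E_deg_letter[OF _ _ u(3), of "n + k" "r * wd v"] Suc.hyps(1)[of v] u(2) assms(1) by auto
  moreover have "wd x' * (wd v' * r) \<in> E_deg U (Suc (n + k))"
    using E_deg_letter[OF _ _ u'(2), of "n + k" "wd v' * r"] Suc.hyps(1)[of v'] u'(3) assms(1) by auto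
  moreover have "r * wd u = r * wd v * wd x" "wd u * r = wd x' * (wd v' * r)"
    unfolding u(1)  by (simp add: wd_mult[symmetric] mult.assoc)
      (simp add: u'(1) wd_mult[symmetric] mult.assoc flip: u(1))
  moreover have "n + mon_length u = Suc (n + k)" using Suc.hyps(2) by simp
  ultimately show ?case by simp
qed

lemma subspace_E: "falg.subspace (E_space U)"
  by (simp add: E_space_def)

lemma E_deg_E_space: "1 \<le> n \<Longrightarrow> E_deg U n \<subseteq> E_space U"
  unfolding E_space_def by (rule order_trans[OF _ falg.span_superset]) auto

lemma E_space_mult:
  assumes "x \<in> E_space U"
  shows "x * a \<in> E_space U" "a * x \<in> E_space U"
proof -
  have *: "r * wd u \<in> E_space U \<and> wd u * r \<in> E_space U" if r: "r \<in> (\<Union>n\<in>{1..}. E_deg U n)" for r u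
  proof -
    obtain n where n: "1 \<le> n" "r \<in> E_deg U n" using r by auto
    then show ?thesis
      using E_deg_word[OF n, of u] E_deg_E_space[of "n + mon_length u"] by auto
  qed
  have "r * a \<in> E_space U" if "r \<in> (\<Union>n\<in>{1..}. E_deg U n)" for r
    by (rule lin_span[OF lin_mult_left subspace_E _ falg_spanning]) (use * that in auto)
  then show "x * a \<in> E_space U"
    using assms unfolding E_space_def[of U]
    by (rule lin_span[OF lin_mult_right falg.subspace_span])
  have "a * r \<in> E_space U" if "r \<in> (\<Union>n\<in>{1..}. E_deg U n)" for r
    by (rule lin_span[OF lin_mult_right subspace_E _ falg_spanning]) (use * that in auto)
  then show "a * x \<in> E_space U"
    using assms unfolding E_space_def[of U]
    by (rule lin_span[OF lin_mult_left falg.subspace_span])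
qed

lemma E_space_Abar: "E_space U \<subseteq> Abar"
  unfolding E_space_def using E_deg_Hom Hom_Abar
  by (intro falg.span_minimal subspace_Abar) auto

text \<open>\<open>E\<close> is graded, so an element of it can be tested by the conditions of each
  single degree.\<close>

lemma hcomp_E_space:
  assumes "x \<in> E_space U" "1 \<le> n"
  shows "hcomp n x \<in> E_deg U n"
  using assms(1) unfolding E_space_def
proof (rule lin_span[OF lin_hcomp subspace_E_deg[OF assms(2)], rotated])
  fix y assume "y \<in> (\<Union>n\<in>{1..}. E_deg U n)"
  then obtain m where y: "y \<in> E_deg U m" "y \<in> Hom m" using E_deg_Hom by auto
  show "hcomp n y \<in> E_deg U n"
    unfolding hcomp_Hom[OF y(2)] using y(1) falg.subspace_0[OF subspace_E_deg[OF assms(2)]] by auto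
qed

lemma cod_E_deg:
  assumes "2 ^ m \<le> n" "n < 2 ^ Suc m"
  shows "cod n (E_deg U n) ((2 ^ Suc (Suc m) + 1) * (Q (Suc m))\<^sup>2)"
  unfolding E_deg_eq[OF assms] using assms by (intro cod_Eann) auto

section \<open>Nil elements\<close>

text \<open>An interval of length \<open>2 ^ p\<close> that starts at a multiple of
  \<open>2 ^ p\<close> never straddles the midpoint of a larger dyadic block, so it sits in one half
  and the claim for that half applies. That claim is an assumption because the step is used for
  \<open>U\<close> inside an induction and once more for \<open>UU\<close>.\<close>

lemma U_aligned_Ann_step:
  assumes "p \<le> k" "2 ^ p * t + 2 ^ p + l = 2 ^ Suc k" "x \<in> U (2 ^ p)"
    and IH: "\<And>t l. 2 ^ p * t + 2 ^ p + l = 2 ^ k \<Longrightarrow> x \<in> Ann (U (2 ^ k)) (2 ^ p * t) (2 ^ p) l"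
  shows "x \<in> Ann (UU k) (2 ^ p * t) (2 ^ p) l"
proof -
  have k: "(2::nat) ^ k = 2 ^ p * 2 ^ (k - p)" using assms(1) by (simp add: power_add[symmetric])
  show ?thesis
  proof (cases "t < 2 ^ (k - p)")
    case True
    then have "2 ^ p * (t + 1) \<le> 2 ^ p * 2 ^ (k - p)" by (intro mult_left_mono) auto
    then have "2 ^ p * t + 2 ^ p \<le> 2 ^ k" unfolding k by (simp add: algebra_simps)
    then show ?thesis
      using Ann_UU_left[OF IH[of t "l - 2 ^ k"]] assms(2) by simp
  next
    case False
    then obtain t' where t': "t = 2 ^ (k - p) + t'" using le_Suc_ex not_less by blast
    then have "2 ^ p * t = 2 ^ k + 2 ^ p * t'" unfolding k by (simp add: algebra_simps)
    then show ?thesis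
      using Ann_UU_right[OF IH[of t' l]] assms(2) by simp
  qed
qed

lemma U_aligned_Ann_U:
  assumes "p \<le> k" "2 ^ p * t + 2 ^ p + l = 2 ^ k" "x \<in> U (2 ^ p)"
  shows "x \<in> Ann (U (2 ^ k)) (2 ^ p * t) (2 ^ p) l"
  using assms(1,2)
proof (induction k arbitrary: t l rule: dec_induct)
  case base
  then show ?case using U_Ann[OF assms(3)] by simp
next
  case (step k)
  show ?case
    by (rule Ann_U_of_UU[OF U_aligned_Ann_step[OF step(1) step.prems assms(3) step.IH]])
qed

lemma U_aligned_Ann_UU:
  assumes "p \<le> k" "2 ^ p * t + 2 ^ p + l = 2 ^ Suc k" "x \<in> U (2 ^ p)"
  shows "x \<in> Ann (UU k) (2 ^ p * t) (2 ^ p) l"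
  by (rule U_aligned_Ann_step[OF assms U_aligned_Ann_U[OF assms(1) _ assms(3)]])

text \<open>In \<open>q * x * a\<close> the part \<open>q * x\<close> is homogeneous, so a component
  is \<open>q * x\<close> times one component of \<open>a\<close>. The length of \<open>q\<close> is
  a multiple of \<open>2 ^ p\<close>, which aligns \<open>x\<close> with the dyadic blocks; if
  \<open>q * x\<close> is longer than the window, the component vanishes.\<close>

lemma hcomp_B_ideal:
  assumes "F \<subseteq> U (2 ^ p)" "p \<le> k" "y \<in> B_ideal (c * 2 ^ p) F"
  shows "hcomp (2 ^ Suc k) y \<in> UU k"
  using assms(3) unfolding B_ideal_def
proof (rule lin_span[OF lin_hcomp subspace_UU, rotated])
  fix y assume "y \<in> (\<Union>i. Mon (c * 2 ^ p * i) \<cdot> F \<cdot> UNIV)"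
  then obtain i where y: "y \<in> Mon (c * 2 ^ p * i) \<cdot> F \<cdot> UNIV" by blast
  let ?T = "{y. hcomp (2 ^ Suc k) y \<in> UU k}"
  have T: "falg.subspace ?T"
    by (rule falg_pair.linear_subspace_linear_preimage[OF lin_hcomp subspace_UU])
  have "q * x * a \<in> ?T" if "q \<in> Mon (c * 2 ^ p * i)" "x \<in> F" for q x a
  proof -
    obtain u where u: "q = wd u" "mon_length u = 2 ^ p * (c * i)"
    proof -
      have "c * 2 ^ p * i = 2 ^ p * (c * i)" by simp
      then show ?thesis using \<open>q \<in> Mon (c * 2 ^ p * i)\<close> that unfolding Mon_def by auto
    qed
    have x: "x \<in> U (2 ^ p)" "x \<in> Hom (2 ^ p)" using that(2) assms(1) U_Hom by auto
    have qx: "q * x \<in> Hom (2 ^ p * (c * i) + 2 ^ p)" using x u by (intro Hom_mult) auto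
    show ?thesis
    proof (cases "2 ^ p * (c * i) + 2 ^ p \<le> 2 ^ Suc k")
      case False
      then show ?thesis
        by (simp add: hcomp_mult_left[OF qx] falg.subspace_0[OF subspace_UU] del: power_Suc)
    next
      case True
      let ?l = "2 ^ Suc k - (2 ^ p * (c * i) + 2 ^ p)"
      have "x \<in> Ann (UU k) (2 ^ p * (c * i)) (2 ^ p) ?l"
        using True by (intro U_aligned_Ann_UU assms(2) x(1)) simp
      then have "q * x * wd v \<in> UU k" if "mon_length v = ?l" for v
        using that u by (auto intro: AnnD)
      then have "q * x * hcomp ?l a \<in> UU k"
        by (rule Hom_lin[OF lin_mult_left subspace_UU _ hcomp_in_Hom])
      then show ?thesis using True by (simp add: hcomp_mult_left[OF qx] del: power_Suc)
    qed
  qed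
  then have "Mon (c * 2 ^ p * i) \<cdot> F \<cdot> UNIV \<subseteq> ?T"
    unfolding sprod3_subset_iff[OF T] by blast
  then show "hcomp (2 ^ Suc k) y \<in> UU k" using y by blast
qed

lemma generated_ideal_mult: "a * g * b \<in> generated_ideal g"
proof -
  have *: "falg.subspace (generated_ideal g) \<and>
      (\<forall>a. \<forall>p\<in>generated_ideal g. a * p \<in> generated_ideal g \<and> p * a \<in> generated_ideal g)"
    unfolding generated_ideal_def
    by (rule hull_in) (auto intro: falg.subspace_Inter)
  have "g \<in> generated_ideal g"
    unfolding generated_ideal_def using hull_subset by fastforce
  then show ?thesis using * by blast
qed

text \<open>Multiples of \<open>g\<close> by words stay in the generated ideal, so one membership in
  \<open>B_ideal\<close> settles all positions. The hypothesis \<open>low\<close> excludes degrees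
  below \<open>2 ^ p\<close>, whose windows may be too short to contain an aligned block of length
  \<open>2 ^ p\<close>.\<close>

lemma E_spaceI_B_ideal:
  assumes "F \<subseteq> U (2 ^ p)" "generated_ideal g \<subseteq> B_ideal (c * 2 ^ p) F"
    and low: "\<And>n. n < 2 ^ p \<Longrightarrow> hcomp n g = 0"
  shows "g \<in> E_space U"
proof -
  have "hcomp n g \<in> E_space U" for n
  proof (cases "hcomp n g = 0")
    case True
    then show ?thesis by (simp add: falg.subspace_0[OF subspace_E])
  next
    case False
    then have n: "2 ^ p \<le> n" using low not_less by blast
    have "1 \<le> (2::nat) ^ p" by simp
    then have n1: "1 \<le> n" using n by (rule order_trans)
    then obtain m where m: "2 ^ m \<le> n" "n < 2 ^ Suc m" by (rule dyadic_exists)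
    have "(2::nat) ^ p < 2 ^ Suc m" using n m(2) by (rule le_less_trans)
    then have "p < Suc m" by (rule power_less_imp_less_exp[rotated]) simp
    then have p: "p \<le> Suc m" by simp
    have "hcomp n g \<in> Ann (UU (Suc m)) j n l" if jnl: "j + n + l = 2 ^ Suc (Suc m)" for j l
    proof (rule AnnI[OF hcomp_in_Hom])
      fix u v assume u: "mon_length u = j" and v: "mon_length v = l"
      have "wd u * g * wd v \<in> B_ideal (c * 2 ^ p) F"
        using assms(2) generated_ideal_mult by blast
      then have "hcomp (2 ^ Suc (Suc m)) (wd u * g * wd v) \<in> UU (Suc m)"
        by (rule hcomp_B_ideal[OF assms(1) p])
      \<comment> \<open>The outer words have degrees \<open>j\<close> and \<open>l\<close>, so only
        the component of \<open>g\<close> of degree \<open>n\<close> reaches degree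
        \<open>j + n + l\<close>.\<close>
      moreover have "hcomp (2 ^ Suc (Suc m)) (wd u * g * wd v) = wd u * hcomp n g * wd v"
        unfolding jnl[symmetric]
        by (simp add: hcomp_mult_right[OF wd_in_Hom[OF v]] hcomp_mult_left[OF wd_in_Hom[OF u]])
      ultimately show "wd u * hcomp n g * wd v \<in> UU (Suc m)" by simp
    qed
    then have "hcomp n g \<in> E_deg U n" unfolding E_deg_eq[OF m] by (simp add: Eann_def)
    then show ?thesis using E_deg_E_space[OF n1] by blast
  qed
  then show ?thesis
    using hcomp_sum_eq[of "mon_length ` Poly_Mapping.keys g" g] falg.subspace_sum[OF subspace_E]
    by (metis finite_imageI finite_keys order_refl)
qed

end

section \<open>Non-nilpotency\<close>

context splitting
begin

lemma word_square_not_UU: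
  assumes "wd w \<in> V k"
  shows "wd (w + w) \<notin> UU k"
proof
  assume *: "wd (w + w) \<in> UU k"
  obtain \<rho> where "lin \<rho>" "\<And>v w. v \<in> V k \<Longrightarrow> w \<in> V k \<Longrightarrow> \<rho> (v * w) = v * w"
    "\<And>x. x \<in> UU k \<Longrightarrow> \<rho> x = 0"
    unfolding UU_def
    by (rule square_projection_exists[OF subspace_V subspace_U V_plus_U V_inter_U]) blast
  then have "wd w * wd w = (0 :: 'k falg)" using assms * by (metis wd_mult)
  then show False by (simp add: wd_mult wd_neq_0)
qed

end

context degree_splitting
begin

text \<open>The condition at position \<open>0\<close> is decisive: if the prefix \<open>u\<close>
  of \<open>w + w\<close> were in \<open>E\<close>, then completing it to the window
  \<open>w + w\<close> would put this square into \<open>UU\<close>.\<close>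

lemma word_not_in_E:
  assumes "\<And>k. \<exists>w. wd w \<in> V (2 ^ k)"
  obtains u where "mon_length u = 2 ^ m" "wd u \<notin> E_space U"
proof -
  obtain w where w: "wd w \<in> V (2 ^ Suc m)" using assms by blast
  then have "mon_length w = 2 ^ Suc m" using V_Hom[of "Suc m"] by (auto simp: Hom_iff)
  then have "mon_length (w + w) = 2 ^ m + (2 ^ Suc (Suc m) - 2 ^ m)" by simp
  then obtain u v where uv: "w + w = u + v" "mon_length u = 2 ^ m" "mon_length v = 2 ^ Suc (Suc m) - 2 ^ m"
    by (rule word_split)
  have "wd u \<notin> E_space U"
  proof
    assume "wd u \<in> E_space U"
    from hcomp_E_space[OF this, of "2 ^ m"] have "wd u \<in> E_deg U (2 ^ m)"
      by (simp add: hcomp_Hom[OF wd_in_Hom[OF uv(2)]])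
    then have "wd u \<in> Eann (Suc m) (2 ^ m)" by (simp add: E_deg_eq[of m])
    then have "wd u \<in> Ann (UU (Suc m)) 0 (2 ^ m) (2 ^ Suc (Suc m) - 2 ^ m)" by (rule EannD) simp
    from AnnD[OF this, of 0 v] have "wd (w + w) \<in> UU (Suc m)"
      using uv by (simp add: wd_mult)
    then show False using word_square_not_UU[OF w] by blast
  qed
  then show thesis using uv(2) that by blast
qed

end

section \<open>Images of the augmentation ideal\<close>

lemma Abar_mult:
  assumes "p \<in> Abar"
  shows "p * q \<in> Abar"
proof -
  have "0 \<notin> Poly_Mapping.keys (p * q)"
  proof
    assume "0 \<in> Poly_Mapping.keys (p * q)"
    then obtain u v where "0 = u + v" "u \<in> Poly_Mapping.keys p" "v \<in> Poly_Mapping.keys q"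
      using keys_mult[of p q] by blast
    moreover from this(1) have "mon_length u = 0" by (metis mon_length_add mon_length_zero add_is_0)
    ultimately show False using assms by (simp add: Abar_def in_keys_iff)
  qed
  then show ?thesis by (simp add: Abar_def in_keys_iff)
qed

lemmas Abar_closed =
  falg.subspace_0[OF subspace_Abar] falg.subspace_add[OF subspace_Abar] falg.subspace_diff[OF subspace_Abar]
  falg.subspace_neg[OF subspace_Abar] falg.subspace_scale[OF subspace_Abar] Abar_mult

lemma wd_Abar [simp]: "wd u \<in> Abar \<longleftrightarrow> u \<noteq> 0"
  by (simp add: Abar_def lookup_single when_def)

lemma Abar_power: "1 \<le> n \<Longrightarrow> p \<in> Abar \<Longrightarrow> p ^ n \<in> Abar"
  by (induction n rule: nat_induct_at_least) (simp_all add: Abar_closed)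

definition Abar_upto :: "nat \<Rightarrow> 'k::field falg set"
  where "Abar_upto D = {p \<in> Abar. \<forall>u\<in>Poly_Mapping.keys p. mon_length u \<le> D}"

lemma Abar_upto_Abar: "Abar_upto D \<subseteq> Abar"
  by (auto simp: Abar_upto_def)

lemma Abar_upto_mono: "D \<le> D' \<Longrightarrow> Abar_upto D \<subseteq> Abar_upto D'"
  by (auto simp: Abar_upto_def)

lemma Abar_upto_deg: "p \<in> Abar \<Longrightarrow> p \<in> Abar_upto (deg p)"
  using Abar_keys(2) by (auto simp: Abar_upto_def)

lemma subspace_Abar_upto: "falg.subspace (Abar_upto D)"
proof (rule falg.subspaceI)
  show "0 \<in> Abar_upto D" by (simp add: Abar_upto_def Abar_def)
  show "p + q \<in> Abar_upto D" if "p \<in> Abar_upto D" "q \<in> Abar_upto D" for p q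
    using that by (auto simp: Abar_upto_def Abar_closed dest!: subsetD[OF keys_add])
  show "scl c p \<in> Abar_upto D" if "p \<in> Abar_upto D" for c p
    using that by (auto simp: Abar_upto_def Abar_closed in_keys_iff)
qed

lemma Abar_upto_mult:
  assumes "p \<in> Abar_upto a" "q \<in> Abar_upto b"
  shows "p * q \<in> Abar_upto (a + b)"
proof -
  have "mon_length u \<le> a + b" if "u \<in> Poly_Mapping.keys (p * q)" for u
    using that keys_mult[of p q] assms by (fastforce simp: Abar_upto_def intro: add_mono)
  then show ?thesis using assms by (auto simp: Abar_upto_def Abar_closed)
qed

text \<open>A quotient of the augmentation ideal seen through its projection \<open>h\<close> with
  kernel \<open>E\<close>. The identity map with kernel zero gives the algebra itself, the coset map
  gives the quotient, and all computations take place on polynomials.\<close>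

locale falg_image =
  fixes h :: "'k::field falg \<Rightarrow> 'c" and R :: "('k, 'c) module" (structure) and E :: "'k falg set"
  assumes carrier_eq: "carrier R = h ` Abar"
    and zero_eq: "\<zero> = h 0"
    and add_eq: "\<lbrakk>p \<in> Abar; q \<in> Abar\<rbrakk> \<Longrightarrow> h p \<oplus> h q = h (p + q)"
    and mult_eq: "\<lbrakk>p \<in> Abar; q \<in> Abar\<rbrakk> \<Longrightarrow> h p \<otimes> h q = h (p * q)"
    and smult_eq: "p \<in> Abar \<Longrightarrow> c \<odot> h p = h (scl c p)"
    and kernel: "\<lbrakk>p \<in> Abar; q \<in> Abar\<rbrakk> \<Longrightarrow> h p = h q \<longleftrightarrow> p - q \<in> E"
begin

lemma image_module: "Module.module class_ring R"
proof (rule module_criteria)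
  show "cring (class_ring :: 'k ring)" by (rule class_cring.is_cring)
  show "\<forall>v\<in>carrier R. \<exists>w\<in>carrier R. v \<oplus> w = \<zero>"
  proof
    fix v assume "v \<in> carrier R"
    then obtain p where "p \<in> Abar" "v = h p" by (auto simp: carrier_eq)
    then show "\<exists>w\<in>carrier R. v \<oplus> w = \<zero>"
      by (intro bexI[of _ "h (- p)"]) (auto simp: carrier_eq zero_eq add_eq Abar_closed)
  qed
qed (auto simp: carrier_eq zero_eq add_eq smult_eq Abar_closed add_ac falg.scale_left_distrib
       falg.scale_right_distrib)

lemma is_assoc_algebra: "assoc_algebra class_ring R"
proof -
  interpret Module.module class_ring R by (rule image_module)
  show ?thesis
    by unfold_locales
       (auto simp: carrier_eq add_eq smult_eq mult_eq Abar_closed algebra_simps scl_mult_left scl_mult_right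
         class_ring_simps)
qed

sublocale assoc_algebra class_ring R
  by (rule is_assoc_algebra)

lemma submodule_image:
  assumes "falg.subspace P" "P \<subseteq> Abar"
  shows "submodule class_ring (h ` P) R"
  using assms falg.subspace_0[OF assms(1)] falg.subspace_add[OF assms(1)] falg.subspace_scale[OF assms(1)]
  by (intro submodule.intro image_module)
     (auto simp: carrier_eq zero_eq add_eq smult_eq subset_iff)

lemma subspace_preimage:
  assumes "submodule class_ring N R"
  shows "falg.subspace {p \<in> Abar. h p \<in> N}"
proof (rule falg.subspaceI)
  show "0 \<in> {p \<in> Abar. h p \<in> N}"
    using submodule.zero_closed[OF assms] by (simp add: zero_eq Abar_closed)
  show "p + q \<in> {p \<in> Abar. h p \<in> N}" if "p \<in> {p \<in> Abar. h p \<in> N}" "q \<in> {p \<in> Abar. h p \<in> N}" for p q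
    using that submodule.m_closed[OF assms, of "h p" "h q"] by (simp add: add_eq Abar_closed)
  show "scl c p \<in> {p \<in> Abar. h p \<in> N}" if "p \<in> {p \<in> Abar. h p \<in> N}" for c p
    using that submodule.smult_closed[OF assms, of c "h p"] by (simp add: smult_eq Abar_closed)
qed

lemma span_image:
  assumes "Y \<subseteq> Abar" "p \<in> falg.span Y"
  shows "p \<in> Abar \<and> h p \<in> span (h ` Y)"
proof -
  have Y: "h ` Y \<subseteq> carrier R" using assms(1) by (auto simp: carrier_eq)
  have "falg.span Y \<subseteq> {p \<in> Abar. h p \<in> span (h ` Y)}"
    using assms(1) in_own_span[OF Y]
    by (intro falg.span_minimal subspace_preimage span_is_submodule Y) auto
  then show ?thesis using assms(2) by auto
qed

lemma two_sided_idealI: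
  assumes "falg.subspace P" "P \<subseteq> Abar" "\<And>a p. p \<in> P \<Longrightarrow> a * p \<in> P \<and> p * a \<in> P"
  shows "two_sided_ideal (h ` P)"
  unfolding two_sided_ideal_def
  using submodule_image[OF assms(1,2)] vectorspace_axioms assms(2,3)
  by (auto simp: VectorSpace.subspace_def carrier_eq mult_eq subset_iff)

lemma elt_pow_image:
  assumes "p \<in> Abar" "1 \<le> n"
  shows "elt_pow (h p) n = h (p ^ n)"
  using assms(2)
proof (induction n rule: dec_induct)
  case base
  then show ?case by (simp add: elt_pow_def)
next
  case (step n)
  then obtain m where n: "n = Suc m" by (cases n) auto
  have "elt_pow (h p) (Suc n) = elt_pow (h p) n \<otimes> h p"
    by (simp add: elt_pow_def n)
  also have "\<dots> = h (p ^ n * p)"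
    using step assms(1) by (simp add: mult_eq Abar_power)
  finally show ?case by (simp add: power_Suc2 del: power_Suc)
qed

lemma nilI:
  assumes "\<And>p. p \<in> Abar \<Longrightarrow> \<exists>n\<ge>1. p ^ n \<in> E"
  shows "nil"
  unfolding nil_def
proof
  fix x assume "x \<in> carrier R"
  then obtain p where p: "p \<in> Abar" "x = h p" by (auto simp: carrier_eq)
  then obtain n where n: "n \<ge> 1" "p ^ n \<in> E" using assms by blast
  have "elt_pow x n = h 0"
    using p n kernel[of "p ^ n" 0] by (simp add: elt_pow_image Abar_power) (simp add: Abar_def)
  then show "\<exists>n\<ge>1. elt_pow x n = \<zero>" using n(1) by (auto simp: zero_eq)
qed

lemma sub_pow_Suc: "1 \<le> n \<Longrightarrow> sub_pow P (Suc n) = sub_prod (sub_pow P n) P"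
  by (cases n) (simp_all add: sub_pow_def)

lemma sub_pow_1: "sub_pow P 1 = P"
  by (simp add: sub_pow_def)

lemma sub_prod_image_upto:
  assumes "P \<subseteq> h ` Abar_upto a" "Q \<subseteq> h ` Abar_upto b"
  shows "sub_prod P Q \<subseteq> h ` Abar_upto (a + b)"
  unfolding sub_prod_def
proof (rule span_is_subset)
  show "submodule class_ring (h ` Abar_upto (a + b)) R"
    by (rule submodule_image[OF subspace_Abar_upto Abar_upto_Abar])
  show "{p \<otimes> q |p q. p \<in> P \<and> q \<in> Q} \<subseteq> h ` Abar_upto (a + b)"
  proof
    fix x assume "x \<in> {p \<otimes> q |p q. p \<in> P \<and> q \<in> Q}"
    then obtain x1 x2 where "x = x1 \<otimes> x2" "x1 \<in> P" "x2 \<in> Q" by blast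
    moreover have "x1 \<in> h ` Abar_upto a" "x2 \<in> h ` Abar_upto b" using calculation assms by auto
    ultimately obtain p q where "x = h p \<otimes> h q" "p \<in> Abar_upto a" "q \<in> Abar_upto b" by blast
    then show "x \<in> h ` Abar_upto (a + b)"
      using Abar_upto_mult[of p a q b] Abar_upto_Abar[of a] Abar_upto_Abar[of b]
      by (auto simp: mult_eq subset_iff)
  qed
qed

lemma sub_pow_image_upto:
  assumes "P \<subseteq> h ` Abar_upto D" "1 \<le> n"
  shows "sub_pow P n \<subseteq> h ` Abar_upto (n * D)"
  using assms(2)
proof (induction n rule: dec_induct)
  case base
  then show ?case using assms(1) by (simp add: sub_pow_1[simplified])
next
  case (step n)
  then show ?case
    using sub_prod_image_upto[OF step.IH assms(1)] by (simp add: sub_pow_Suc add.commute)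
qed

lemma sub_pow_carrier: "1 \<le> n \<Longrightarrow> sub_pow (carrier R) n \<subseteq> carrier R"
proof (induction n rule: nat_induct_at_least)
  case (Suc n)
  then have "{p \<otimes> q |p q. p \<in> sub_pow (carrier R) n \<and> q \<in> carrier R} \<subseteq> carrier R"
    using mult_closed by blast
  then show ?case using Suc by (simp add: sub_pow_Suc sub_prod_def span_is_subset2)
qed (simp add: sub_pow_1[simplified])

text \<open>A word with at least \<open>n\<close> letters is a product of \<open>n\<close> nonempty
  words: the last factor takes all letters that the earlier ones leave.\<close>

lemma word_in_sub_pow:
  assumes "1 \<le> n" "n \<le> mon_length u"
  shows "h (wd u) \<in> sub_pow (carrier R) n"
  using assms
proof (induction n arbitrary: u rule: dec_induct)
  case base
  then show ?case by (auto simp: sub_pow_1[simplified] carrier_eq intro!: imageI)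
next
  case (step n)
  have "mon_length u = n + (mon_length u - n)" using step.prems by simp
  then obtain v w where u: "u = v + w" "mon_length v = n" "mon_length w = mon_length u - n"
    by (rule word_split)
  have nz: "v \<noteq> 0" "w \<noteq> 0" using u step by auto
  have "h (wd v) \<in> sub_pow (carrier R) n" using u by (intro step.IH) simp
  moreover have "h (wd w) \<in> carrier R" using nz by (auto simp: carrier_eq)
  ultimately have "h (wd v) \<otimes> h (wd w) \<in> {p \<otimes> q |p q. p \<in> sub_pow (carrier R) n \<and> q \<in> carrier R}"
    by blast
  moreover have "{p \<otimes> q |p q. p \<in> sub_pow (carrier R) n \<and> q \<in> carrier R} \<subseteq> carrier R"
    using mult_closed sub_pow_carrier[OF step.hyps(1)] by blast
  ultimately have "h (wd v) \<otimes> h (wd w) \<in> sub_prod (sub_pow (carrier R) n) (carrier R)"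
    unfolding sub_prod_def using in_own_span by blast
  then show ?case using nz step.hyps by (simp add: sub_pow_Suc mult_eq u(1) wd_mult)
qed

lemma not_nilpotentI:
  assumes "\<And>n. \<exists>u. n \<le> mon_length u \<and> wd u \<notin> E"
  shows "\<not> nilpotent"
proof
  assume nilpotent
  then obtain n where n: "1 \<le> n" "sub_pow (carrier R) n = {\<zero>}" by (auto simp: nilpotent_def)
  obtain u where u: "n \<le> mon_length u" "wd u \<notin> E" using assms by blast
  then have "u \<noteq> 0" using n(1) by auto
  have "h (wd u) = h 0" using word_in_sub_pow[OF n(1) u(1)] n(2) by (simp add: zero_eq)
  then show False
    using kernel[of "wd u" 0] u(2) \<open>u \<noteq> 0\<close> by (simp add: Abar_def lookup_single when_def)
qed

lemma finitely_generated: "finitely_generated"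
proof -
  let ?X = "h ` {wd (Monomial [LX]), wd (Monomial [LY]), wd (Monomial [LZ])}"
  have letter: "wd (Monomial [x]) \<in> {wd (Monomial [LX]), wd (Monomial [LY]), wd (Monomial [LZ])}" for x
    by (cases x) simp_all
  have nz: "Monomial (x # xs) \<noteq> 0" for x xs by (simp add: zero_monomial_def)
  have X: "?X \<subseteq> carrier R"
    by (auto simp: carrier_eq nz)
  have sub: "carrier R \<subseteq> S" if S: "subalgebra S" "?X \<subseteq> S" for S
  proof -
    have S': "submodule class_ring S R" using S(1) by (simp add: subalgebra_def VectorSpace.subspace_def)
    have word: "h (wd (Monomial (x # xs))) \<in> S" for x xs
    proof (induction xs arbitrary: x)
      case Nil
      then show ?case using letter[of x] S(2) by blast
    next
      case (Cons y ys)
      have "h (wd (Monomial [x])) \<otimes> h (wd (Monomial (y # ys))) \<in> S"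
        using Cons letter[of x] S unfolding subalgebra_def by blast
      then show ?case by (simp add: mult_eq nz wd_mult plus_monomial_def)
    qed
    have "p \<in> {p \<in> Abar. h p \<in> S}" if p: "p \<in> Abar" for p
    proof (subst falg_expand, intro falg.subspace_sum falg.subspace_scale subspace_preimage S')
      fix u assume "u \<in> Poly_Mapping.keys p"
      then have "u \<noteq> 0" using p by (auto simp: Abar_def in_keys_iff)
      then obtain x xs where "u = Monomial (x # xs)"
        by (cases u) (metis list.exhaust zero_monomial_def)
      then show "wd u \<in> {p \<in> Abar. h p \<in> S}" using word nz by simp
    qed
    then show ?thesis by (auto simp: carrier_eq)
  qed
  have "subalgebra (carrier R)"
    using mult_closed vectorspace_axioms image_module
    by (auto simp: subalgebra_def VectorSpace.subspace_def intro!: submodule.intro)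
  then have "subalgebra hull ?X = carrier R"
    using sub X by (intro hull_unique) auto
  then show ?thesis unfolding finitely_generated_def using X by (intro exI[of _ ?X]) auto
qed

section \<open>Growth\<close>

text \<open>Dimension is computed in the image but spanning sets are known for polynomials modulo
  \<open>E\<close>. The preimage of the span \<open>T\<close> of all products connects the
  two.\<close>

lemma growth_le:
  assumes P: "P \<subseteq> h ` Abar_upto D"
    and Y: "finite Y" "Abar_upto (n * D) \<subseteq> falg.span Y + E" and E: "falg.subspace E"
  shows "growth P n \<le> card Y"
proof -
  define T where "T = span (\<Union>i\<in>{1..n}. sub_pow P i)"
  have sub: "(\<Union>i\<in>{1..n}. sub_pow P i) \<subseteq> h ` Abar_upto (n * D)"
  proof (rule UN_least)
    fix i assume i: "i \<in> {1..n}"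
    then have "Abar_upto (i * D) \<subseteq> (Abar_upto (n * D) :: 'k falg set)"
      by (intro Abar_upto_mono mult_right_mono) auto
    then show "sub_pow P i \<subseteq> h ` Abar_upto (n * D)"
      using sub_pow_image_upto[OF P, of i] i by (meson atLeastAtMost_iff image_mono order_trans)
  qed
  then have carr: "(\<Union>i\<in>{1..n}. sub_pow P i) \<subseteq> carrier R"
    unfolding carrier_eq using image_mono[OF Abar_upto_Abar] by (rule order_trans)
  have T: "T \<subseteq> h ` Abar_upto (n * D)"
    unfolding T_def by (rule span_is_subset[OF sub submodule_image[OF subspace_Abar_upto Abar_upto_Abar]])
  have submodT: "submodule class_ring T R" unfolding T_def by (rule span_is_submodule[OF carr])
  let ?P = "{p \<in> Abar. h p \<in> T}"
  have "?P \<subseteq> falg.span Y + E"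
  proof
    fix p assume p: "p \<in> ?P"
    then obtain q where q: "q \<in> Abar_upto (n * D)" "h p = h q" using T by auto
    then have "p - q \<in> E" using kernel[of p q] p Abar_upto_Abar by auto
    moreover obtain a b where "q = a + b" "a \<in> falg.span Y" "b \<in> E"
      using Y(2) q(1) by (auto elim!: set_plus_elim)
    ultimately have "p = a + (b + (p - q))" "b + (p - q) \<in> E"
      using falg.subspace_add[OF E, of b "p - q"] by simp_all
    then show "p \<in> falg.span Y + E" using \<open>a \<in> falg.span Y\<close> by (metis set_plus_intro)
  qed
  \<comment> \<open>The vectors of \<open>Y\<close> need not be mapped into \<open>T\<close>; they
    are replaced by at most as many vectors of the preimage, whose images then generate
    \<open>T\<close>.\<close>
  then obtain Y' where Y': "Y' \<subseteq> ?P" "finite Y'" "card Y' \<le> card Y" "?P \<subseteq> falg.span Y' + (?P \<inter> E)"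
    by (rule subspace_spanning_mod[OF subspace_preimage[OF submodT] E Y(1)])
  have Y'T: "h ` Y' \<subseteq> T" using Y'(1) by auto
  have "T \<subseteq> span (h ` Y')"
  proof
    fix x assume "x \<in> T"
    then have "x \<in> h ` Abar_upto (n * D)" using T by blast
    then obtain p where p: "p \<in> ?P" "x = h p" using \<open>x \<in> T\<close> Abar_upto_Abar[of "n * D"] by blast
    have "p \<in> falg.span Y' + (?P \<inter> E)" using Y'(4) p(1) by (rule subsetD)
    then obtain a b where ab: "p = a + b" "a \<in> falg.span Y'" "b \<in> E" by (elim set_plus_elim) blast
    have a: "a \<in> Abar \<and> h a \<in> span (h ` Y')" using Y'(1) ab(2) by (intro span_image) auto
    moreover have "h p = h a" using kernel[of p a] p(1) a ab(1,3) by simp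
    ultimately show "x \<in> span (h ` Y')" using p(2) by simp
  qed
  moreover have "span (h ` Y') \<subseteq> T" by (rule span_is_subset[OF Y'T submodT])
  ultimately have "span (h ` Y') = T" by blast
  then have gen: "LinearCombinations.module.span class_ring (vs T) (h ` Y') = T"
    using span_li_not_depend(1)[OF Y'T submodT] by simp
  interpret T: vectorspace class_ring "vs T"
    by (rule subspace_is_vs) (use submodT vectorspace_axioms in \<open>simp add: VectorSpace.subspace_def\<close>)
  have "T.dim \<le> card (h ` Y')"
    using Y'T Y'(2) gen by (intro T.gen_ge_dim) auto
  also have "\<dots> \<le> card Y" using card_image_le[OF Y'(2), of h] Y'(3) by simp
  finally show ?thesis by (simp add: growth_def T_def)
qed

lemma fin_dim_image_upto:
  assumes "VectorSpace.subspace class_ring P R" "vectorspace.fin_dim class_ring (vs P)"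
  obtains D where "1 \<le> D" "P \<subseteq> h ` Abar_upto D"
proof -
  interpret P: vectorspace class_ring "vs P" using assms(1) by (rule subspace_is_vs)
  have P: "submodule class_ring P R" using assms(1) by simp
  obtain G where G: "finite G" "G \<subseteq> P" "LinearCombinations.module.span class_ring (vs P) G = P"
    using assms(2) by (auto simp: P.fin_dim_def)
  have PG: "P = span G" using span_li_not_depend(1)[OF G(2) P] G(3) by simp
  have "\<forall>g\<in>G. \<exists>p. p \<in> Abar \<and> h p = g"
    using G(2) submodule.subset[OF P] by (fastforce simp: carrier_eq)
  then obtain r where r: "\<And>g. g \<in> G \<Longrightarrow> r g \<in> Abar \<and> h (r g) = g" by metis
  \<comment> \<open>The sum dominates every single degree, and the successor makes \<open>D\<close>
    positive even when \<open>G\<close> is empty.\<close>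
  define D where "D = Suc (\<Sum>g\<in>G. deg (r g))"
  have "G \<subseteq> h ` Abar_upto D"
  proof
    fix g assume g: "g \<in> G"
    then have "deg (r g) \<le> D" using G(1) using member_le_sum[of g G "\<lambda>g. deg (r g)"] by (simp add: D_def le_SucI)
    then have "r g \<in> Abar_upto D" using Abar_upto_deg[of "r g"] Abar_upto_mono r g by blast
    then show "g \<in> h ` Abar_upto D" using r[OF g] by force
  qed
  then have "P \<subseteq> h ` Abar_upto D"
    unfolding PG by (rule span_is_subset[OF _ submodule_image[OF subspace_Abar_upto Abar_upto_Abar]])
  then show thesis using that[of D] by (simp add: D_def)
qed

text \<open>Scaling the degree by the fixed \<open>D\<close> of a generating space changes only the
  constant, and a constant \<open>c\<close> contributes \<open>ln c / ln n\<close>, which tends to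
  zero.\<close>

lemma GKdim_le:
  assumes E: "falg.subspace E" and C: "1 \<le> C"
    and bound: "\<And>D. 1 \<le> D \<Longrightarrow> \<exists>Y. finite Y \<and> card Y \<le> C * D ^ e \<and> Abar_upto D \<subseteq> falg.span Y + E"
  shows "GKdim \<le> ereal (real e)"
  unfolding GKdim_def
proof (rule SUP_least)
  fix P assume "P \<in> {V. VectorSpace.subspace class_ring V R \<and> vectorspace.fin_dim class_ring (vs V)}"
  then obtain D where D: "1 \<le> D" "P \<subseteq> h ` Abar_upto D"
    using fin_dim_image_upto by blast
  define c where "c = C * D ^ e"
  have c: "1 \<le> c" using C D(1) by (simp add: c_def)
  have "growth P n \<le> c * n ^ e" if "1 \<le> n" for n
  proof -
    have "1 \<le> n * D" using that D(1) by simp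
    then obtain Y where Y: "finite Y" "card Y \<le> C * (n * D) ^ e" "Abar_upto (n * D) \<subseteq> falg.span Y + E"
      using bound by blast
    have "growth P n \<le> C * (n * D) ^ e" using growth_le[OF D(2) Y(1,3) E] Y(2) by (rule order_trans)
    then show ?thesis by (simp add: c_def power_mult_distrib algebra_simps)
  qed
  have le: "log (real n) (real (growth P n)) \<le> ln (real c) / ln (real n) + real e" if n: "2 \<le> n" for n
  proof (cases "growth P n = 0")
    case True
    \<comment> \<open>Since \<open>ln 0 = 0\<close>, the left side is \<open>0\<close> here, and the
      right side is nonnegative because \<open>c \<ge> 1\<close>.\<close>
    then show ?thesis using c n by (simp add: log_def)
  next
    case False
    have "growth P n \<le> c * n ^ e" using n by (intro \<open>\<And>n. 1 \<le> n \<Longrightarrow> growth P n \<le> c * n ^ e\<close>) simp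
    then have "real (growth P n) \<le> real c * real n ^ e"
      by (metis of_nat_le_iff of_nat_mult of_nat_power)
    then have "log (real n) (real (growth P n)) \<le> log (real n) (real c * real n ^ e)"
      using n False c by (subst log_le_cancel_iff) auto
    also have "\<dots> = ln (real c) / ln (real n) + real e"
      using n c by (simp add: log_mult log_nat_power) (simp add: log_def)
    finally show ?thesis .
  qed
  have "((\<lambda>n. ln (real c) / ln (real n) + real e) \<longlongrightarrow> 0 + real e) sequentially"
    by (intro tendsto_add tendsto_const tendsto_divide_0[OF tendsto_const]
        filterlim_at_top_imp_at_infinity filterlim_compose[OF ln_at_top filterlim_real_sequentially])
  then have "limsup (\<lambda>n. ereal (ln (real c) / ln (real n) + real e)) = ereal (real e)"
    by (intro lim_imp_Limsup) simp_all
  moreover have "limsup (\<lambda>n. ereal (log (real n) (real (growth P n)))) \<le>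
      limsup (\<lambda>n. ereal (ln (real c) / ln (real n) + real e))"
    using le by (intro Limsup_mono eventually_sequentiallyI[of 2]) simp
  ultimately show "limsup (\<lambda>n. ereal (log (real n) (real (growth P n)))) \<le> ereal (real e)"
    by simp
qed

end

section \<open>The quotient algebra\<close>

lemma falg_image_id: "falg_image (\<lambda>p. p) Abar_algebra ({0} :: 'k::field falg set)"
  by unfold_locales (simp_all add: Abar_algebra_def)

lemma falg_image_quot:
  fixes E :: "'k::field falg set"
  assumes E: "falg.subspace E" "E \<subseteq> Abar" "\<And>a p. p \<in> E \<Longrightarrow> a * p \<in> E \<and> p * a \<in> E"
  shows "falg_image (\<lambda>p. (\<lambda>e. e + p) ` E) (quot_algebra Abar_algebra E) E"
proof -
  let ?h = "\<lambda>p. (\<lambda>e. e + p) ` E"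
  let ?R = "quot_algebra Abar_algebra E"
  note sub = falg.subspace_0[OF E(1)] falg.subspace_add[OF E(1)] falg.subspace_diff[OF E(1)]
    falg.subspace_neg[OF E(1)] falg.subspace_scale[OF E(1)]
  have coset: "E +>\<^bsub>Abar_algebra\<^esub> p = ?h p" for p
    by (auto simp: a_r_coset_def r_coset_def Abar_algebra_def)
  have mem: "q \<in> ?h p \<longleftrightarrow> q - p \<in> E" for p q
    by (auto simp: image_iff intro!: bexI[of _ "q - p"])
  have eq: "?h p = ?h q \<longleftrightarrow> p - q \<in> E" for p q
  proof
    assume "?h p = ?h q"
    moreover have "p \<in> ?h p" using sub(1) by (simp add: mem)
    ultimately have "p \<in> ?h q" by simp
    then show "p - q \<in> E" by (simp only: mem)
  next
    assume pq: "p - q \<in> E"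
    show "?h p = ?h q"
    proof (intro Set.set_eqI)
      fix r
      have "r - q = (r - p) + (p - q)" "r - p = (r - q) - (p - q)" by simp_all
      then have "r - p \<in> E \<longleftrightarrow> r - q \<in> E" using sub(2,3) pq by metis
      then show "r \<in> ?h p \<longleftrightarrow> r \<in> ?h q" by (simp only: mem)
    qed
  qed
  show ?thesis
  proof
    show "carrier ?R = ?h ` Abar"
      by (auto simp: quot_algebra_def FactRing_def ring.defs A_RCOSETS_def' coset)
        (auto simp: Abar_algebra_def)
    show "\<zero>\<^bsub>?R\<^esub> = ?h 0"
      by (simp add: quot_algebra_def FactRing_def ring.defs)
    fix p q :: "'k falg" and c :: 'k assume p: "p \<in> Abar" and q: "q \<in> Abar"
    show "?h p = ?h q \<longleftrightarrow> p - q \<in> E" by (rule eq)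
    have "?h p + ?h q = ?h (p + q)"
    proof (intro Set.set_eqI)
      fix r
      have "r \<in> ?h p + ?h q" if "r - (p + q) \<in> E"
      proof -
        have "(r - (p + q)) + p \<in> ?h p" "q \<in> ?h q" using that sub(1) by (simp_all only: mem add_diff_cancel_right' diff_self)
        then have "(r - (p + q)) + p + q \<in> ?h p + ?h q" by (rule set_plus_intro)
        then show ?thesis by (simp add: algebra_simps)
      qed
      moreover have "r - (p + q) \<in> E" if r: "r \<in> ?h p + ?h q"
      proof -
        obtain a b where ab: "r = a + b" "a - p \<in> E" "b - q \<in> E"
          using r by (elim set_plus_elim) (simp only: mem)
        have "r - (p + q) = (a - p) + (b - q)" by (simp add: ab(1) algebra_simps)
        then show ?thesis using sub(2) ab(2,3) by metis
      qed
      ultimately show "r \<in> ?h p + ?h q \<longleftrightarrow> r \<in> ?h (p + q)" by (simp only: mem) blast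
    qed
    moreover have "?h p \<oplus>\<^bsub>?R\<^esub> ?h q = (\<Union>a\<in>?h p. \<Union>b\<in>?h q. {a + b})"
      by (simp only: quot_algebra_def FactRing_def ring.defs set_add_def)
        (simp add: Abar_algebra_def set_mult_def)
    moreover have "(\<Union>a\<in>A. \<Union>b\<in>B. {a + b}) = A + B" for A B :: "'k falg set"
      unfolding set_plus_def by blast
    ultimately show "?h p \<oplus>\<^bsub>?R\<^esub> ?h q = ?h (p + q)" by (simp only:)
    have "(\<Union>a\<in>?h p. \<Union>b\<in>?h q. ?h (a * b)) = ?h (p * q)"
    proof -
      \<comment> \<open>The library product of cosets is the union of the cosets of all products of
        representatives; by the ideal property these cosets coincide.\<close>
      have "?h (a * b) = ?h (p * q)" if "a \<in> ?h p" "b \<in> ?h q" for a b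
      proof -
        have "a * b - p * q = (a - p) * b + p * (b - q)" by (simp add: algebra_simps)
        also have "\<dots> \<in> E" using that E(3) sub(2) by (simp only: mem)
        finally show ?thesis by (simp only: eq)
      qed
      moreover have "?h p \<noteq> {}" "?h q \<noteq> {}" using sub(1) by auto
      ultimately show ?thesis by auto
    qed
    then show "?h p \<otimes>\<^bsub>?R\<^esub> ?h q = ?h (p * q)"
      by (simp add: quot_algebra_def FactRing_def ring.defs rcoset_mult_def coset)
        (simp add: Abar_algebra_def)
    have "(\<Union>a\<in>?h p. ?h (scl c a)) = ?h (scl c p)"
    proof -
      have "?h (scl c a) = ?h (scl c p)" if "a \<in> ?h p" for a
      proof -
        have "scl c a - scl c p = scl c (a - p)" by (simp add: falg.scale_right_diff_distrib)
        also have "\<dots> \<in> E" using that sub(5) by (simp only: mem)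
        finally show ?thesis by (simp only: eq)
      qed
      moreover have "?h p \<noteq> {}" using sub(1) by auto
      ultimately show ?thesis by auto
    qed
    then show "c \<odot>\<^bsub>?R\<^esub> ?h p = ?h (scl c p)"
      by (simp add: quot_algebra_def ring.defs module.defs coset) (simp add: Abar_algebra_def)
  qed
qed

section \<open>The dimension sequence\<close>

text \<open>It ensures that truncated subtraction in \<open>2 ^ i - i - 1\<close> is genuine
  subtraction and leaves a margin between consecutive runs.\<close>

lemma Suc_less_two_power:
  assumes "5 \<le> q"
  shows "q + 3 < (2::nat) ^ q"
  using assms by (induction q rule: dec_induct) auto

lemma exc_bounds:
  assumes "5 \<le> i" "j \<le> i"
  shows "2 ^ i - i - 1 + j \<le> 2 ^ i - 1" "2 ^ i \<le> 2 ^ i - i - 1 + j + Suc i"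
  using Suc_less_two_power[OF assms(1)] assms(2) by auto

text \<open>The runs in \<open>S_exc\<close> are separated by gaps: run \<open>i\<close> ends at
  \<open>2 ^ i - 1\<close>, and the level \<open>2 ^ i\<close>, where \<open>F i\<close> is
  absorbed, lies before the next run.\<close>

lemma exc_less:
  assumes "5 \<le> i" "i < i'"
  shows "(2::nat) ^ i + 1 < 2 ^ i' - i' - 1"
proof -
  obtain q where q: "i' = Suc q" "i \<le> q" using assms(2) by (cases i') auto
  have "(2::nat) ^ i \<le> 2 ^ q" using q(2) by (intro power_increasing) auto
  moreover have "(2::nat) ^ i' = 2 * 2 ^ q" by (simp add: q)
  moreover have "q + 3 < (2::nat) ^ q" using q assms(1) by (intro Suc_less_two_power) simp
  ultimately show ?thesis using q(1) by linarith
qed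

lemma exc_unique:
  assumes "5 \<le> i" "j \<le> i" "5 \<le> i'" "j' \<le> i'" "2 ^ i - i - 1 + j = (2 ^ i' - i' - 1 + j' :: nat)"
  shows "i = i' \<and> j = j'"
proof -
  have "\<not> i < i'" using exc_less[of i i'] exc_bounds[of i j] assms by auto
  moreover have "\<not> i' < i" using exc_less[of i' i] exc_bounds[of i' j'] assms by auto
  ultimately show ?thesis using assms by auto
qed

lemma S_exc_iff: "n \<in> S_exc \<longleftrightarrow> (\<exists>i\<ge>5. \<exists>j\<le>i. n = 2 ^ i - i - 1 + j)"
proof
  assume "n \<in> S_exc"
  then obtain i where i: "5 \<le> i" "2 ^ i - i - 1 \<le> n" "n \<le> 2 ^ i - 1"
    unfolding S_exc_def by auto
  then have "n - (2 ^ i - i - 1) \<le> i" "n = 2 ^ i - i - 1 + (n - (2 ^ i - i - 1))"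
    using Suc_less_two_power[OF i(1)] by auto
  then show "\<exists>i\<ge>5. \<exists>j\<le>i. n = 2 ^ i - i - 1 + j" using i(1) by blast
next
  assume "\<exists>i\<ge>5. \<exists>j\<le>i. n = 2 ^ i - i - 1 + j"
  then obtain i j where ij: "5 \<le> i" "j \<le> i" "n = 2 ^ i - i - 1 + j" by blast
  then have "n \<in> {2 ^ i - i - 1..2 ^ i - 1}" using exc_bounds(1)[OF ij(1,2)] by simp
  then show "n \<in> S_exc" unfolding S_exc_def using ij(1) by blast
qed

lemma two_power_not_S_exc:
  assumes "5 \<le> i"
  shows "2 ^ i \<notin> S_exc"
proof
  assume "2 ^ i \<in> S_exc"
  then obtain i' j where i': "5 \<le> i'" "j \<le> i'" "2 ^ i = (2 ^ i' - i' - 1 + j :: nat)"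
    unfolding S_exc_iff by blast
  then have "(2::nat) ^ i \<le> 2 ^ i' - 1" using exc_bounds by metis
  moreover have "0 < (2::nat) ^ i'" by simp
  ultimately have "(2::nat) ^ i < 2 ^ i'" by linarith
  then have "i < i'" by simp
  then show False using exc_less[OF assms] i'(3) by fastforce
qed

definition dim_seq :: "nat \<Rightarrow> nat"
  where "dim_seq n = (if n \<in> S_exc then 2 ^ 2 ^ (THE j. \<exists>i\<ge>5. j \<le> i \<and> n = 2 ^ i - i - 1 + j) else 2)"

lemma dim_seq_exc:
  assumes "5 \<le> i" "j \<le> i"
  shows "dim_seq (2 ^ i - i - 1 + j) = 2 ^ 2 ^ j"
proof -
  have "(THE j'. \<exists>i'\<ge>5. j' \<le> i' \<and> 2 ^ i - i - 1 + j = 2 ^ i' - i' - 1 + j') = j"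
    using assms exc_unique[OF assms] by (intro the_equality) blast+
  moreover have "2 ^ i - i - 1 + j \<in> S_exc" using assms S_exc_iff by blast
  ultimately show ?thesis unfolding dim_seq_def by simp
qed

lemma dim_seq_non_exc: "n \<notin> S_exc \<Longrightarrow> dim_seq n = 2"
  by (simp add: dim_seq_def)

lemma dim_seq_ge_2: "2 \<le> dim_seq n"
proof (cases "n \<in> S_exc")
  case True
  have "(2::nat) ^ 1 \<le> 2 ^ 2 ^ j" for j :: nat by (rule power_increasing) auto
  then show ?thesis unfolding dim_seq_def using True by simp
qed (simp add: dim_seq_def)

text \<open>Inside a run the dimension is exactly squared; at the entry to a run and outside of the
  runs the new value is \<open>2\<close>, below any square that occurs.\<close>

lemma dim_seq_Suc: "dim_seq (Suc n) \<le> dim_seq n * dim_seq n"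
proof -
  have 4: "2 \<le> dim_seq n * dim_seq n" using mult_le_mono[OF dim_seq_ge_2 dim_seq_ge_2, of n n] by simp
  show ?thesis
  proof (cases "Suc n \<in> S_exc")
    case True
    then obtain i j where ij: "5 \<le> i" "j \<le> i" "Suc n = 2 ^ i - i - 1 + j"
      unfolding S_exc_iff by blast
    show ?thesis
    proof (cases j)
      case 0
      then show ?thesis using 4 dim_seq_exc[OF ij(1,2)] ij(3) by simp
    next
      case (Suc j')
      then have n: "n = 2 ^ i - i - 1 + j'" using ij(3) by simp
      have "dim_seq n = 2 ^ 2 ^ j'" unfolding n using ij Suc by (intro dim_seq_exc) auto
      moreover have "dim_seq (Suc n) = 2 ^ 2 ^ Suc j'"
        using dim_seq_exc[OF ij(1,2)] ij(3) Suc by simp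
      ultimately show ?thesis by (simp add: power_add[symmetric] mult_2)
    qed
  next
    case False
    then show ?thesis using 4 by (simp add: dim_seq_non_exc)
  qed
qed

text \<open>The level before \<open>2 ^ i\<close> is the last one of its run, the case
  \<open>j = i\<close>. Its squared dimension matches the bound \<open>2 ^ 2 ^ (i + 1) - 2\<close>
  for \<open>F i\<close>, with \<open>2\<close> left over for \<open>V\<close>.\<close>

lemma dim_seq_before_two_power:
  assumes "5 \<le> i" "Suc n = 2 ^ i"
  shows "dim_seq n * dim_seq n = 2 ^ 2 ^ (i + 1)" "dim_seq (Suc n) = 2"
proof -
  have n: "n = 2 ^ i - i - 1 + i" using assms Suc_less_two_power[OF assms(1)] by simp
  have "dim_seq n = 2 ^ 2 ^ i" unfolding n using assms(1) by (intro dim_seq_exc) auto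
  then show "dim_seq n * dim_seq n = 2 ^ 2 ^ (i + 1)" by (simp add: power_add[symmetric] mult_2)
  show "dim_seq (Suc n) = 2"
    unfolding assms(2) by (intro dim_seq_non_exc two_power_not_S_exc assms(1))
qed

text \<open>In terms of exponents, each level outside \<open>S_exc\<close> contributes
  \<open>1\<close>, at most \<open>k + 1\<close> in total. Run \<open>i\<close> contributes less
  than \<open>2 ^ (i + 1)\<close>, so the runs up to the last relevant index \<open>A\<close>
  contribute less than \<open>4 * 2 ^ A \<le> 8 * k\<close>. The claim concerns any such sequence,
  since it is applied to an arbitrary datum.\<close>

lemma prod_dims_le:
  fixes d :: "nat \<Rightarrow> nat"
  assumes non_exc: "\<And>n. n \<notin> S_exc \<Longrightarrow> d n = 2"
    and exc: "\<And>i j. 5 \<le> i \<Longrightarrow> j \<le> i \<Longrightarrow> d (2 ^ i - i - 1 + j) = 2 ^ 2 ^ j"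
  shows "(\<Prod>n\<le>k. d n) \<le> 2 ^ (9 * k + 1)"
proof -
  have "\<exists>e. d n = 2 ^ e" for n
  proof (cases "n \<in> S_exc")
    case True
    then show ?thesis unfolding S_exc_iff using exc by blast
  next
    case False
    then show ?thesis using non_exc[of n] by (intro exI[of _ 1]) simp
  qed
  then obtain e where e: "\<And>n. d n = 2 ^ e n" by metis
  have e1: "e n = 1" if "n \<notin> S_exc" for n
    using non_exc[OF that] e[of n] power_inject_exp[of "2::nat" "e n" 1] by simp
  have e2: "e (2 ^ i - i - 1 + j) = 2 ^ j" if "5 \<le> i" "j \<le> i" for i j
    using exc[OF that] e[of "2 ^ i - i - 1 + j"] power_inject_exp[of "2::nat" _ "2 ^ j"] by simp
  have exc_sum: "(\<Sum>n\<in>{..k} \<inter> S_exc. e n) \<le> 8 * k"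
  proof (cases "{..k} \<inter> S_exc = {}")
    case False
    define I where "I = {i. 5 \<le> i \<and> 2 ^ i - i - 1 \<le> k}"
    \<comment> \<open>The run starts at \<open>2 ^ i - i - 1 \<le> k\<close>, and
      \<open>i + 1\<close> is at most half of \<open>2 ^ i\<close>.\<close>
    have I2: "(2::nat) ^ i \<le> 2 * k" if i: "i \<in> I" for i
    proof -
      obtain q where q: "i = Suc q" using i by (cases i) (auto simp: I_def)
      have "q + 2 \<le> 2 ^ q"
      proof (cases "5 \<le> q")
        case True
        then show ?thesis using Suc_less_two_power[of q] by simp
      next
        case False
        then have "q = 4" using i q by (simp add: I_def)
        then show ?thesis by simp
      qed
      moreover have "2 ^ i \<le> k + i + 1" using i unfolding I_def mem_Collect_eq by linarith
      moreover have "(2::nat) ^ i = 2 * 2 ^ q" unfolding q by simp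
      ultimately show ?thesis using q by linarith
    qed
    have "I \<subseteq> {..2 * k}"
    proof
      fix i assume "i \<in> I"
      then have "(2::nat) ^ i \<le> 2 * k" by (rule I2)
      moreover have "i < 2 ^ i" by (rule less_exp)
      ultimately show "i \<in> {..2 * k}" unfolding atMost_iff by linarith
    qed
    then have finI: "finite I" by (rule finite_subset) simp
    have neI: "I \<noteq> {}"
    proof -
      obtain n where "n \<in> S_exc" "n \<le> k" using False by auto
      then obtain i j where "5 \<le> i" "n = 2 ^ i - i - 1 + j" unfolding S_exc_iff by blast
      then have "i \<in> I" using \<open>n \<le> k\<close> by (simp add: I_def)
      then show ?thesis by blast
    qed
    define A where "A = Max I"
    have A: "A \<in> I" "\<And>i. i \<in> I \<Longrightarrow> i \<le> A"
      unfolding A_def using finI neI by (auto intro: Max_in)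
    have geom: "(\<Sum>j\<le>i. 2 ^ j) < (2::nat) ^ Suc i" for i
      by (induction i) auto
    \<comment> \<open>Every exceptional level is charged to its pair \<open>(i, j)\<close>; the
      pairs with \<open>i < 5\<close> and those beyond \<open>k\<close> only enlarge the
      bound.\<close>
    have "(\<Sum>n\<in>{..k} \<inter> S_exc. e n) \<le> (\<Sum>x\<in>Sigma {..A} (\<lambda>i. {..i}). 2 ^ snd x)"
    proof (rule sum_le_included[where i = "\<lambda>(i, j). 2 ^ i - i - 1 + j"])
      show "\<forall>n\<in>{..k} \<inter> S_exc. \<exists>x\<in>Sigma {..A} (\<lambda>i. {..i}).
          (\<lambda>(i, j). 2 ^ i - i - 1 + j) x = n \<and> e n \<le> 2 ^ snd x"
      proof
        fix n assume n: "n \<in> {..k} \<inter> S_exc"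
        then have "n \<in> S_exc" by simp
        then obtain i j where ij: "5 \<le> i" "j \<le> i" "n = 2 ^ i - i - 1 + j" unfolding S_exc_iff by blast
        then have "i \<in> I" using n by (simp add: I_def)
        then have "i \<le> A" by (rule A(2))
        moreover have "e n = 2 ^ j" unfolding ij(3) by (rule e2[OF ij(1,2)])
        ultimately show "\<exists>x\<in>Sigma {..A} (\<lambda>i. {..i}). (\<lambda>(i, j). 2 ^ i - i - 1 + j) x = n \<and> e n \<le> 2 ^ snd x"
          using ij(2,3) by (intro bexI[of _ "(i, j)"]) auto
      qed
    qed auto
    also have "\<dots> = (\<Sum>i\<le>A. \<Sum>j\<le>i. 2 ^ j)"
      by (subst sum.Sigma) (auto simp: split_def)
    also have "\<dots> \<le> (\<Sum>i\<le>A. 2 ^ Suc i)"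
      using geom by (intro sum_mono less_imp_le)
    also have "\<dots> = 2 * (\<Sum>i\<le>A. 2 ^ i)" by (simp add: sum_distrib_left)
    also have "\<dots> \<le> 2 * 2 ^ Suc A" using geom[of A] by simp
    also have "\<dots> \<le> 8 * k" using I2[OF A(1)] by simp
    finally show ?thesis .
  qed simp
  have "(\<Sum>n\<le>k. e n) = (\<Sum>n\<in>{..k} - S_exc. e n) + (\<Sum>n\<in>{..k} \<inter> S_exc. e n)"
    by (subst add.commute, rule sum.Int_Diff) simp
  also have "(\<Sum>n\<in>{..k} - S_exc. e n) = card ({..k} - S_exc)" using e1 by simp
  also have "\<dots> \<le> card {..k}" by (intro card_mono) auto
  finally have "(\<Sum>n\<le>k. e n) \<le> 9 * k + 1" using exc_sum by simp
  then have "(2::nat) ^ (\<Sum>n\<le>k. e n) \<le> 2 ^ (9 * k + 1)" by (intro power_increasing) auto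
  then show ?thesis by (simp add: e power_sum)
qed

section \<open>Existence of construction data\<close>

lemma independent_words: "falg.independent (range wd :: 'k::field falg set)"
  unfolding falg.dependent_def
proof
  assume "\<exists>a\<in>range wd. a \<in> falg.span (range wd - {a :: 'k falg})"
  then obtain u where u: "wd u \<in> falg.span (range wd - {wd u :: 'k falg})" by auto
  have "falg.span (range wd - {wd u :: 'k falg}) \<subseteq> {p. Poly_Mapping.lookup p u = 0}"
  proof (rule falg.span_minimal)
    show "falg.subspace {p :: 'k falg. Poly_Mapping.lookup p u = 0}"
      by (rule falg.subspaceI) (auto simp: lookup_add)
  qed (auto simp: lookup_single when_def)
  then show False using u by auto
qed

lemma independent_Mon: "W \<subseteq> Mon n \<Longrightarrow> falg.independent W"
  by (rule falg.independent_mono[OF independent_words]) (auto simp: Mon_def)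

lemma independent_span_disjoint:
  assumes "falg.independent B" "A \<subseteq> B" "C \<subseteq> B" "A \<inter> C = {}"
  shows "falg.span A \<inter> falg.span C = {0}"
proof -
  have "x = 0" if "x \<in> falg.span A" "x \<in> falg.span C" for x
  proof -
    have indA: "falg.independent A" using assms by (meson falg.independent_mono)
    have "falg.representation B x = falg.representation A x"
      "falg.representation B x = falg.representation C x"
      using assms that by (auto intro: falg.representation_extend)
    then have "falg.representation A x b = 0" for b
      using falg.representation_ne_zero[of A x b] falg.representation_ne_zero[of C x b] assms(4) by fastforce
    then show "x = 0"
      using falg.sum_nonzero_representation_eq[OF indA that(1)] by simp
  qed
  then show ?thesis by (auto simp: falg.span_zero)
qed

lemma Mon_times:
  assumes "W \<subseteq> Mon m" "W' \<subseteq> Mon n"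
  shows "W * W' \<subseteq> Mon (m + n)"
proof
  fix x assume "x \<in> W * W'"
  then obtain a b where "x = a * b" "a \<in> W" "b \<in> W'" by (rule set_times_elim)
  moreover from this obtain u v where "a = wd u" "mon_length u = m" "b = wd v" "mon_length v = n"
    using assms unfolding Mon_def by blast
  ultimately show "x \<in> Mon (m + n)" by (auto simp: Mon_def wd_mult)
qed

text \<open>Words of equal length factor uniquely, so the dimension really squares.\<close>

lemma card_Mon_times:
  fixes W :: "'k::field falg set"
  assumes "W \<subseteq> Mon n"
  shows "card (W * W) = card W * card W"
proof -
  have eq: "W * W = (\<lambda>(x, y). x * y) ` (W \<times> W)" by (auto simp: set_times_def)
  have "inj_on (\<lambda>(x, y). x * y) (W \<times> W)"
  proof (rule inj_onI, clarify)
    fix a b c d assume *: "a \<in> W" "b \<in> W" "c \<in> W" "d \<in> W" "a * b = c * d"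
    obtain u where u: "a = wd u" "mon_length u = n" using *(1) assms by (auto simp: Mon_def)
    obtain v where v: "b = wd v" using *(2) assms by (auto simp: Mon_def)
    obtain u' where u': "c = wd u'" "mon_length u' = n" using *(3) assms by (auto simp: Mon_def)
    obtain v' where v': "d = wd v'" using *(4) assms by (auto simp: Mon_def)
    have "u + v = u' + v'" using *(5) by (simp add: u v u' v' wd_mult)
    then show "a = c \<and> b = d" using word_add_cancel[of u v u' v'] u v u' v' by simp
  qed
  then show ?thesis unfolding eq by (simp add: card_image card_cartesian_product)
qed

text \<open>The words in \<open>W * W\<close> are independent modulo \<open>H U + U H\<close>, so at least
  \<open>card W * card W - dim F\<close> of them stay independent when \<open>F\<close> is factored out as well.\<close>

lemma splitting_step:
  fixes W U F :: "'k::field falg set"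
  assumes W: "W \<subseteq> Mon n" and U: "falg.subspace U" "U \<subseteq> Hom n"
    and WU: "falg.span W + U = Hom n" "falg.span W \<inter> U = {0}"
    and F: "falg.subspace F" "F \<subseteq> Hom (n + n)"
    and c: "c + falg.dim F \<le> card W * card W"
  obtains W' U' where "W' \<subseteq> W * W" "card W' = c" "falg.subspace U'" "U' \<subseteq> Hom (n + n)"
    "falg.span W' + U' = Hom (n + n)" "falg.span W' \<inter> U' = {0}"
    "Hom n \<cdot> U + U \<cdot> Hom n \<subseteq> U'" "F \<subseteq> U'"
proof -
  define Q0 where "Q0 = U \<cdot> Hom n + Hom n \<cdot> U"
  define Q where "Q = Q0 + F"
  have Q0: "falg.subspace Q0" unfolding Q0_def by (simp add: subspace_plus)
  have Q: "falg.subspace Q" unfolding Q_def by (simp add: subspace_plus Q0 F)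
  have Q0h: "Q0 \<subseteq> Hom (n + n)"
    unfolding Q0_def using U(2)
    by (simp add: plus_subset_iff[OF _ _ subspace_Hom] sprod_subset_iff[OF subspace_Hom]) (blast intro: Hom_mult)
  have Q0Q: "Q0 \<subseteq> Q" "F \<subseteq> Q"
    using plus_subset_iff[OF Q0 F(1) Q] unfolding Q_def by auto
  have Qh: "Q \<subseteq> Hom (n + n)"
    unfolding Q_def using Q0h F(2) by (simp add: plus_subset_iff[OF Q0 F(1) subspace_Hom])
  have Wh: "falg.span W \<subseteq> Hom n" unfolding Hom_def using W by (rule falg.span_mono)
  have WWh: "W * W \<subseteq> Hom (n + n)"
    using Wh falg.span_superset[of W] by (auto elim!: set_times_elim intro!: Hom_mult)
  have finW: "finite W" using W finite_subset by fastforce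
  have finWW: "finite (W * W)" using finW by (simp add: finite_set_times)
  obtain QB where QB: "QB \<subseteq> Q" "falg.independent QB" "Q = falg.span QB" "finite QB"
    by (rule subspace_Hom_basis[OF Q Qh])
  \<comment> \<open>Extending a basis of \<open>Q\<close> by elements of \<open>W * W\<close> alone
    keeps the future \<open>V\<close> spanned by words.\<close>
  obtain B' where B': "QB \<subseteq> B'" "B' \<subseteq> QB \<union> W * W" "falg.independent B'" "QB \<union> W * W \<subseteq> falg.span B'"
    using falg.maximal_independent_subset_extend[of QB "QB \<union> W * W"] QB(2) by auto
  have spanB': "falg.span B' = Hom (n + n)"
  proof
    have "B' \<subseteq> Hom (n + n)" using B'(2) QB(1) Qh WWh by blast
    then show "falg.span B' \<subseteq> Hom (n + n)" by (rule falg.span_minimal) simp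
    have QB': "Q \<subseteq> falg.span B'" unfolding QB(3) using B'(1) by (rule falg.span_mono)
    show "Hom (n + n) \<subseteq> falg.span B'"
    proof (rule Hom_split_subset[OF falg.subspace_span])
      fix p q :: "'k falg" assume p: "p \<in> Hom n" and q: "q \<in> Hom n"
      obtain x t where x: "p = x + t" "x \<in> falg.span W" "t \<in> U"
        using p WU(1) by (metis set_plus_elim)
      obtain y s where y: "q = y + s" "y \<in> falg.span W" "s \<in> U"
        using q WU(1) by (metis set_plus_elim)
      have "x * y \<in> falg.span B'"
        by (rule mult_span[OF falg.subspace_span _ x(2) y(2)]) (use B'(4) set_times_intro in blast)
      moreover have "t * q \<in> U \<cdot> Hom n" "x * s \<in> Hom n \<cdot> U"
        using x y q Wh by (auto intro: sprodI)
      then have "t * q + x * s \<in> falg.span B'"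
        using QB' Q0Q(1) unfolding Q0_def by (meson set_plus_intro subsetD)
      ultimately have "x * y + (t * q + x * s) \<in> falg.span B'" by (rule falg.span_add)
      moreover have "x * y + (t * q + x * s) = p * q" by (simp add: x(1) y(1) algebra_simps)
      ultimately show "p * q \<in> falg.span B'" by simp
    qed
  qed
  define B where "B = B' - QB"
  have BWW: "B \<subseteq> W * W" using B'(2) by (auto simp: B_def)
  then have finB: "finite B" using finWW by (rule finite_subset)
  obtain \<rho> where \<rho>: "lin \<rho>" "\<And>v w. v \<in> falg.span W \<Longrightarrow> w \<in> falg.span W \<Longrightarrow> \<rho> (v * w) = v * w"
    "\<And>x. x \<in> Q0 \<Longrightarrow> \<rho> x = 0"
    unfolding Q0_def by (rule square_projection_exists[OF falg.subspace_span U(1) WU]) blast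
  obtain FB where FB: "F = falg.span FB" "finite FB" "card FB = falg.dim F"
    by (rule subspace_Hom_basis[OF F])
  \<comment> \<open>The map \<open>\<rho>\<close> fixes words of \<open>W * W\<close> and kills
    \<open>Q0\<close>, so these independent words lie in the span of the images of \<open>B\<close>
    and of a basis of \<open>F\<close>.\<close>
  have card_WW: "card (W * W) \<le> card B + falg.dim F"
  proof -
    let ?S = "falg.span (\<rho> ` B \<union> \<rho> ` FB)"
    have "w \<in> ?S" if w: "w \<in> W * W" for w
    proof -
      have "w \<in> falg.span B'" using B'(4) w by blast
      also have "B' = B \<union> QB" using B'(1) by (auto simp: B_def)
      finally obtain b q where bq: "w = b + q" "b \<in> falg.span B" "q \<in> Q"
        unfolding falg.span_Un QB(3) by blast
      then obtain q0 f where q: "q = q0 + f" "q0 \<in> Q0" "f \<in> F"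
        unfolding Q_def by (elim set_plus_elim) blast
      have "\<rho> b \<in> ?S" by (rule lin_span[OF \<rho>(1) falg.subspace_span _ bq(2)]) (auto intro: falg.span_base)
      moreover have "\<rho> f \<in> ?S"
        using q(3) unfolding FB(1)
        by (rule lin_span[OF \<rho>(1) falg.subspace_span, rotated]) (auto intro: falg.span_base)
      ultimately have "\<rho> b + \<rho> f \<in> ?S" by (rule falg.span_add)
      moreover have "\<rho> w = w"
        using w \<rho>(2) falg.span_superset[of W] by (auto elim!: set_times_elim)
      then have "w = \<rho> b + \<rho> f"
        using \<rho>(3)[OF q(2)] by (simp add: bq(1) q(1) falg_pair.linear_add[OF \<rho>(1)])
      ultimately show ?thesis by simp
    qed
    moreover have "falg.independent (W * W)"
    proof (rule independent_Mon[of _ "n + n"])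
      show "W * W \<subseteq> Mon (n + n)" by (rule Mon_times[OF W W])
    qed
    ultimately have "card (W * W) \<le> card (\<rho> ` B \<union> \<rho> ` FB)"
      using falg.independent_span_bound[of "\<rho> ` B \<union> \<rho> ` FB" "W * W"] finB FB(2) by blast
    also have "\<dots> \<le> card (\<rho> ` B) + card (\<rho> ` FB)" by (rule card_Un_le)
    also have "\<dots> \<le> card B + card FB" using finB FB(2) by (intro add_mono card_image_le)
    finally show ?thesis by (simp add: FB(3))
  qed
  then have "c \<le> card B" using c card_Mon_times[OF W] by simp
  then obtain W' where W': "W' \<subseteq> B" "card W' = c" by (metis obtain_subset_with_card_n)
  \<comment> \<open>The words of \<open>B\<close> that are not selected go into \<open>U'\<close>,
    which makes it a complement of the span of \<open>W'\<close> that still contains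
    \<open>Q\<close>.\<close>
  define U' where "U' = falg.span (B' - W')"
  have "QB \<subseteq> B' - W'" using B'(1) W'(1) by (auto simp: B_def)
  then have QU': "Q \<subseteq> U'" unfolding QB(3) U'_def by (rule falg.span_mono)
  have W'B': "W' \<subseteq> B'" using W'(1) by (auto simp: B_def)
  show thesis
  proof
    show "W' \<subseteq> W * W" "card W' = c" using W' BWW by auto
    show "falg.subspace U'" by (simp add: U'_def)
    show "U' \<subseteq> Hom (n + n)" unfolding U'_def spanB'[symmetric] by (rule falg.span_mono) auto
    have "B' = W' \<union> (B' - W')" using W'B' by auto
    then have "Hom (n + n) = falg.span (W' \<union> (B' - W'))" using spanB' by simp
    then show "falg.span W' + U' = Hom (n + n)"
      unfolding U'_def falg.span_Un by (auto simp: set_plus_def)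
    show "falg.span W' \<inter> U' = {0}"
      unfolding U'_def using W'B' by (intro independent_span_disjoint[OF B'(3)]) auto
    show "Hom n \<cdot> U + U \<cdot> Hom n \<subseteq> U'"
      using QU' Q0Q(1) by (simp add: Q0_def add.commute)
    show "F \<subseteq> U'" using QU' Q0Q(2) by blast
  qed
qed

section \<open>Countability and the enumeration of the augmentation ideal\<close>

lemma countable_falg:
  assumes "countable (UNIV :: 'k::field set)"
  shows "countable (UNIV :: 'k falg set)"
proof -
  have mon: "countable (UNIV :: monomial set)"
  proof (rule countable_subset)
    show "countable (Monomial ` lists {LX, LY, LZ})"
      by (intro countable_image countable_lists countable_finite) simp
    have "set xs \<subseteq> {LX, LY, LZ}" for xs
      using letter.exhaust by auto
    then show "UNIV \<subseteq> Monomial ` lists {LX, LY, LZ}"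
      by (metis image_eqI in_listsI monomial.collapse subsetD subsetI)
  qed
  let ?g = "\<lambda>xs. \<Sum>(u, a)\<leftarrow>xs. (Poly_Mapping.single u a :: 'k falg)"
  show ?thesis
  proof (rule countable_subset)
    show "countable (?g ` lists (UNIV \<times> UNIV))"
      by (intro countable_image countable_lists countable_SIGMA mon assms)
    show "UNIV \<subseteq> ?g ` lists (UNIV \<times> UNIV)"
    proof
      fix p :: "'k falg"
      obtain us where us: "set us = Poly_Mapping.keys p" "distinct us"
        using finite_distinct_list[of "Poly_Mapping.keys p"] by auto
      have "?g (map (\<lambda>u. (u, Poly_Mapping.lookup p u)) us) =
          (\<Sum>u\<leftarrow>us. Poly_Mapping.single u (Poly_Mapping.lookup p u))"
        by (simp add: comp_def)
      also have "\<dots> = (\<Sum>u\<in>Poly_Mapping.keys p. Poly_Mapping.single u (Poly_Mapping.lookup p u))"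
        by (simp add: sum_list_distinct_conv_sum_set us)
      also have "\<dots> = p" by (subst (3) falg_expand) (simp add: scl_single)
      finally show "p \<in> ?g ` lists (UNIV \<times> UNIV)"
        by (metis UNIV_Times_UNIV lists_UNIV rangeI)
    qed
  qed
qed

text \<open>As \<open>3 ^ (6 * t) \<le> 4 ^ (6 * t) = 2 ^ (12 * t)\<close>, it suffices that
  \<open>12 * t < 2 ^ i\<close>, hence the summands \<open>12 * deg (f0 k)\<close> in
  \<open>g\<close>. Partial sums together with \<open>n\<close> make \<open>g\<close> strictly
  increasing, so indices stay distinct even if \<open>f0\<close> repeats values.\<close>

lemma enumeration_exists:
  assumes "countable (UNIV :: 'k::field set)"
  obtains Z and f :: "nat \<Rightarrow> 'k::field falg" where "\<And>i. i \<in> Z \<Longrightarrow> 5 \<le> i" "f ` Z = Abar"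
    "\<And>i. i \<in> Z \<Longrightarrow> 3 ^ (6 * deg (f i)) < (2::nat) ^ 2 ^ i"
proof -
  define f0 where "f0 = from_nat_into (Abar :: 'k falg set)"
  have "countable (Abar :: 'k falg set)"
    using countable_falg[OF assms] by (rule countable_subset[rotated]) simp
  moreover have "Abar \<noteq> ({} :: 'k falg set)" using falg.subspace_0[OF subspace_Abar] by blast
  ultimately have f0: "range f0 = Abar" unfolding f0_def by (simp add: range_from_nat_into)
  define g where "g n = 5 + n + (\<Sum>k\<le>n. 12 * deg (f0 k))" for n
  have "strict_mono g" unfolding strict_mono_Suc_iff by (simp add: g_def)
  then have inj: "inj g" by (rule strict_mono_imp_inj_on)
  define f where "f i = f0 (inv_into UNIV g i)" for i
  have fg: "f (g n) = f0 n" for n by (simp add: f_def inv_into_f_f[OF inj])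
  have "3 ^ (6 * deg (f (g n))) < (2::nat) ^ 2 ^ g n" for n
  proof -
    have "12 * deg (f0 n) \<le> (\<Sum>k\<le>n. 12 * deg (f0 k))" by (rule member_le_sum) auto
    then have "12 * deg (f0 n) \<le> g n" unfolding g_def by simp
    also have "g n < 2 ^ g n" by (rule less_exp)
    finally have "12 * deg (f0 n) < 2 ^ g n" .
    then have "(2::nat) ^ (12 * deg (f0 n)) < 2 ^ 2 ^ g n" by (rule power_strict_increasing) simp
    moreover have "(3::nat) ^ (6 * deg (f0 n)) \<le> 4 ^ (6 * deg (f0 n))" by (intro power_mono) auto
    moreover have "(4::nat) ^ (6 * deg (f0 n)) = 2 ^ (12 * deg (f0 n))"
      using power_mult[of "2::nat" 2 "6 * deg (f0 n)"] by (simp add: mult.assoc[symmetric])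
    ultimately show ?thesis unfolding fg by linarith
  qed
  moreover have "5 \<le> g n" for n by (simp add: g_def)
  moreover have "f ` range g = Abar" using f0 by (auto simp: fg image_image)
  ultimately show thesis by (intro that[of "range g" f]) auto
qed

lemma Mon_1: "(Mon 1 :: 'k::field falg set) = {var LX, var LY, var LZ}"
proof -
  have "mon_length u = 1 \<longleftrightarrow> u \<in> {Monomial [LX], Monomial [LY], Monomial [LZ]}" for u
  proof
    assume "mon_length u = 1"
    then obtain l where "u = Monomial [l]"
      by (cases u) (auto simp: mon_length_def length_Suc_conv)
    then show "u \<in> {Monomial [LX], Monomial [LY], Monomial [LZ]}" by (cases l) auto
  qed (auto simp: mon_length_def)
  then show ?thesis unfolding Mon_def var_def by auto
qed

text \<open>Dependent choice iterates \<open>splitting_step\<close>. The space \<open>G n\<close> is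
  what \<open>U\<close> must absorb at level \<open>n\<close>, and \<open>dims\<close> says that the
  square of the previous dimension leaves enough words after that loss.\<close>

lemma splitting_sequence_exists:
  fixes G :: "nat \<Rightarrow> 'k::field falg set"
  assumes G: "\<And>n. falg.subspace (G n)" "\<And>n. G n \<subseteq> Hom (2 ^ n)"
    and dims: "\<And>n. dim_seq (Suc n) + falg.dim (G (Suc n)) \<le> dim_seq n * dim_seq n"
  obtains W U :: "nat \<Rightarrow> 'k::field falg set" where
    "W 0 = {var LX, var LY}" "U 0 = falg.span {var LZ}"
    "\<And>n. W n \<subseteq> Mon (2 ^ n)" "\<And>n. card (W n) = dim_seq n"
    "\<And>n. falg.subspace (U n)" "\<And>n. U n \<subseteq> Hom (2 ^ n)"
    "\<And>n. falg.span (W n) + U n = Hom (2 ^ n)" "\<And>n. falg.span (W n) \<inter> U n = {0}"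
    "\<And>n. W (Suc n) \<subseteq> W n * W n"
    "\<And>n. Hom (2 ^ n) \<cdot> U n + U n \<cdot> Hom (2 ^ n) \<subseteq> U (Suc n)" "\<And>n. G (Suc n) \<subseteq> U (Suc n)"
proof -
  define P where "P n x \<longleftrightarrow> (n = 0 \<longrightarrow> x = ({var LX, var LY}, falg.span {var LZ})) \<and>
    fst x \<subseteq> Mon (2 ^ n) \<and> card (fst x) = dim_seq n \<and> falg.subspace (snd x) \<and> snd x \<subseteq> Hom (2 ^ n) \<and>
    falg.span (fst x) + snd x = Hom (2 ^ n) \<and> falg.span (fst x) \<inter> snd x = {0}"
    for n and x :: "'k falg set \<times> 'k falg set"
  define Q where "Q n x y \<longleftrightarrow> fst y \<subseteq> fst x * fst x \<and>
    Hom (2 ^ n) \<cdot> snd x + snd x \<cdot> Hom (2 ^ n) \<subseteq> snd y \<and> G (Suc n) \<subseteq> snd y"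
    for n and x y :: "'k falg set \<times> 'k falg set"
  have "\<exists>s. \<forall>n. P n (s n) \<and> Q n (s n) (s (Suc n))"
  proof (rule dependent_nat_choice)
    have distinct: "var LX \<noteq> (var LY :: 'k falg)" "var LX \<noteq> (var LZ :: 'k falg)" "var LY \<noteq> (var LZ :: 'k falg)"
      by (simp_all add: var_def)
    have M: "Mon (2 ^ 0) = ({var LX, var LY} \<union> {var LZ} :: 'k falg set)" using Mon_1 by auto
    have "falg.span {var LX, var LY} \<inter> falg.span {var LZ :: 'k falg} = {0}"
      using distinct M by (intro independent_span_disjoint[OF independent_Mon[OF order_refl, of "2 ^ 0"]]) auto
    moreover have "falg.span {var LX, var LY} + falg.span {var LZ :: 'k falg} = Hom (2 ^ 0)"
      unfolding Hom_def M falg.span_Un by (auto simp: set_plus_def)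
    moreover have "falg.span {var LZ :: 'k falg} \<subseteq> Hom (2 ^ 0)"
      unfolding Hom_def M by (rule falg.span_mono) auto
    moreover have "0 \<notin> S_exc"
      unfolding S_exc_iff using Suc_less_two_power by fastforce
    ultimately have "P 0 ({var LX, var LY}, falg.span {var LZ})"
      using distinct M by (simp add: P_def dim_seq_non_exc)
    then show "\<exists>x. P 0 x" by blast
  next
    fix x n assume x: "P n x"
    then have x': "fst x \<subseteq> Mon (2 ^ n)" "card (fst x) = dim_seq n" "falg.subspace (snd x)" "snd x \<subseteq> Hom (2 ^ n)"
      "falg.span (fst x) + snd x = Hom (2 ^ n)" "falg.span (fst x) \<inter> snd x = {0}"
      by (simp_all add: P_def)
    have G': "G (Suc n) \<subseteq> Hom (2 ^ n + 2 ^ n)" using G(2)[of "Suc n"] by (simp add: mult_2)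
    have d: "dim_seq (Suc n) + falg.dim (G (Suc n)) \<le> card (fst x) * card (fst x)"
      using dims[of n] x'(2) by simp
    obtain W' U' where y: "W' \<subseteq> fst x * fst x" "card W' = dim_seq (Suc n)" "falg.subspace U'"
      "U' \<subseteq> Hom (2 ^ n + 2 ^ n)" "falg.span W' + U' = Hom (2 ^ n + 2 ^ n)" "falg.span W' \<inter> U' = {0}"
      "Hom (2 ^ n) \<cdot> snd x + snd x \<cdot> Hom (2 ^ n) \<subseteq> U'" "G (Suc n) \<subseteq> U'"
      by (rule splitting_step[OF x'(1,3,4,5,6) G(1) G' d])
    have two: "(2::nat) ^ Suc n = 2 ^ n + 2 ^ n" by simp
    have "W' \<subseteq> Mon (2 ^ n + 2 ^ n)" using y(1) Mon_times[OF x'(1) x'(1)] by (rule order_trans)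
    then have "P (Suc n) (W', U') \<and> Q n x (W', U')"
      using y unfolding P_def Q_def two by simp
    then show "\<exists>y. P (Suc n) y \<and> Q n x y" by blast
  qed
  then obtain s where s: "\<And>n. P n (s n)" "\<And>n. Q n (s n) (s (Suc n))" by blast
  have "s 0 = ({var LX, var LY}, falg.span {var LZ})" using s(1)[of 0] by (simp add: P_def)
  then show thesis
    using s unfolding P_def Q_def by (intro that[of "\<lambda>n. fst (s n)" "\<lambda>n. snd (s n)"]) auto
qed

lemma the_exponent: "(THE k. (2::nat) ^ k = 2 ^ n) = n"
  by simp

theorem construction_datum_exists:
  assumes "countable (UNIV :: 'k::field set)"
  shows "\<exists>Z (f :: nat \<Rightarrow> 'k falg) F U V. construction_datum Z f F U V"
proof -
  obtain Z and f :: "nat \<Rightarrow> 'k falg" where Z: "\<And>i. i \<in> Z \<Longrightarrow> 5 \<le> i" and fZ: "f ` Z = Abar"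
    and degf: "\<And>i. i \<in> Z \<Longrightarrow> 3 ^ (6 * deg (f i)) < (2::nat) ^ 2 ^ i"
    using enumeration_exists[OF assms] by blast
  have "\<forall>i\<in>Z. \<exists>F. falg.subspace F \<and> F \<subseteq> Hom (2 ^ 2 ^ i) \<and> falg.dim F < 2 ^ 2 ^ (i + 1) - 2 \<and>
      generated_ideal (f i ^ (10 * w_exp i)) \<subseteq> B_ideal (w_exp i) F"
    using fZ degf by (blast intro: power_piece_space_exists)
  then obtain F where F: "\<And>i. i \<in> Z \<Longrightarrow> falg.subspace (F i) \<and> F i \<subseteq> Hom (2 ^ 2 ^ i) \<and>
      falg.dim (F i) < 2 ^ 2 ^ (i + 1) - 2 \<and> generated_ideal (f i ^ (10 * w_exp i)) \<subseteq> B_ideal (w_exp i) (F i)"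
    by metis
  \<comment> \<open>\<open>F i\<close> lives in degree \<open>2 ^ 2 ^ i\<close>, that is, at level
    \<open>2 ^ i\<close>; at all other levels nothing extra is absorbed.\<close>
  define G where "G n = (if n \<in> (^) 2 ` Z then F (THE i. 2 ^ i = n) else {0})" for n :: nat
  have GF: "G (2 ^ i) = F i" if "i \<in> Z" for i
    using that by (simp add: G_def the_exponent)
  have Gcases: "(\<exists>i\<in>Z. n = 2 ^ i) \<or> G n = {0}" for n by (auto simp: G_def)
  have G1: "falg.subspace (G n)" for n using Gcases[of n] GF F by auto
  have G2: "G n \<subseteq> Hom (2 ^ n)" for n
  proof (cases "\<exists>i\<in>Z. n = 2 ^ i")
    case True
    then obtain i where i: "i \<in> Z" "n = 2 ^ i" by blast
    show ?thesis unfolding i(2) GF[OF i(1)] using F[OF i(1)] by blast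
  next
    case False
    then show ?thesis using Gcases[of n] falg.subspace_0[OF subspace_Hom] by auto
  qed
  have dims: "dim_seq (Suc n) + falg.dim (G (Suc n)) \<le> dim_seq n * dim_seq n" for n
  proof (cases "\<exists>i\<in>Z. Suc n = 2 ^ i")
    case True
    then obtain i where i: "i \<in> Z" "Suc n = 2 ^ i" by blast
    have "dim_seq (Suc n) = 2" "dim_seq n * dim_seq n = 2 ^ 2 ^ (i + 1)"
      using dim_seq_before_two_power[OF Z[OF i(1)] i(2)] by auto
    moreover have "falg.dim (G (Suc n)) < 2 ^ 2 ^ (i + 1) - 2"
      using F[OF i(1)] GF[OF i(1)] i(2) by simp
    ultimately show ?thesis by linarith
  next
    case False
    then have "G (Suc n) = falg.span {}" using Gcases[of "Suc n"] by auto
    then have "falg.dim (G (Suc n)) = 0"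
      using falg.dim_span_eq_card_independent[OF falg.independent_empty] by (metis card.empty)
    then show ?thesis using dim_seq_Suc by simp
  qed
  obtain W U :: "nat \<Rightarrow> 'k falg set" where
    W0: "W 0 = {var LX, var LY}" and U0: "U 0 = falg.span {var LZ}"
    and W: "\<And>n. W n \<subseteq> Mon (2 ^ n)" "\<And>n. card (W n) = dim_seq n"
    and U: "\<And>n. falg.subspace (U n)" "\<And>n. U n \<subseteq> Hom (2 ^ n)"
    and WU: "\<And>n. falg.span (W n) + U n = Hom (2 ^ n)" "\<And>n. falg.span (W n) \<inter> U n = {0}"
    and W_Suc: "\<And>n. W (Suc n) \<subseteq> W n * W n"
    and U_Suc: "\<And>n. Hom (2 ^ n) \<cdot> U n + U n \<cdot> Hom (2 ^ n) \<subseteq> U (Suc n)"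
    and GU: "\<And>n. G (Suc n) \<subseteq> U (Suc n)"
    using splitting_sequence_exists[of G, OF G1 G2 dims] by metis
  define U' where "U' d = U (THE k. 2 ^ k = d)" for d :: nat
  define V' where "V' d = falg.span (W (THE k. 2 ^ k = d))" for d :: nat
  have U': "U' (2 ^ n) = U n" and V': "V' (2 ^ n) = falg.span (W n)" for n
    by (simp_all add: U'_def V'_def the_exponent)
  have dimV: "falg.dim (V' (2 ^ n)) = dim_seq n" for n
    unfolding V' using falg.dim_span_eq_card_independent[OF independent_Mon[OF W(1)]] W(2) by simp
  have "construction_datum Z f F U' V'"
    unfolding construction_datum_def
  proof (intro conjI)
    show "\<forall>i\<in>Z. F i \<subseteq> U' (2 ^ 2 ^ i)"
    proof
      fix i assume i: "i \<in> Z"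
      have "F i \<subseteq> U (2 ^ i)"
        using GU[of "2 ^ i - 1"] GF[OF i] by simp
      then show "F i \<subseteq> U' (2 ^ 2 ^ i)" by (simp add: U')
    qed
    show "V' 1 = falg.span {var LX, var LY}" "U' 1 = falg.span {var LZ}"
      using V'[of 0] U'[of 0] W0 U0 by simp_all
    show "\<forall>n. \<exists>W\<subseteq>\<Union>d. Mon d. V' (2 ^ n) = falg.span W" using V' W(1) by blast
    show "\<forall>n. falg.subspace (V' (2 ^ n)) \<and> V' (2 ^ n) \<subseteq> Hom (2 ^ n)"
      using V' falg.span_mono[OF W(1)] unfolding Hom_def by simp
    show "\<forall>n. n \<notin> S_exc \<longrightarrow> falg.dim (V' (2 ^ n)) = 2" by (simp add: dimV dim_seq_non_exc)
    show "\<forall>i\<ge>5. \<forall>j\<le>i. falg.dim (V' (2 ^ (2 ^ i - i - 1 + j))) = 2 ^ 2 ^ j"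
      using dimV dim_seq_exc by metis
    show "\<forall>n. V' (2 ^ (n + 1)) \<subseteq> V' (2 ^ n) \<cdot> V' (2 ^ n)"
    proof
      fix n
      have "falg.span (W (Suc n)) \<subseteq> falg.span (W n * W n)" using W_Suc by (rule falg.span_mono)
      also have "\<dots> \<subseteq> falg.span (W n) \<cdot> falg.span (W n)"
        unfolding sprod_def by (intro falg.span_mono set_times_mono2 falg.span_superset)
      finally show "V' (2 ^ (n + 1)) \<subseteq> V' (2 ^ n) \<cdot> V' (2 ^ n)"
        using V'[of "Suc n"] V'[of n] by simp
    qed
    show "\<forall>n. Hom (2 ^ n) \<cdot> U' (2 ^ n) + U' (2 ^ n) \<cdot> Hom (2 ^ n) \<subseteq> U' (2 ^ (n + 1))"
      using U_Suc U' by (metis Suc_eq_plus1)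
  qed (use Z fZ degf F U WU in \<open>simp_all add: U' V'\<close>)
  then show ?thesis by blast
qed

section \<open>The algebra of a construction datum\<close>

context degree_splitting
begin

text \<open>For \<open>2 ^ m \<le> n < 2 ^ Suc m\<close> the level is \<open>Suc m\<close>, so
  \<open>(Q (Suc m))\<^sup>2 \<le> 2 ^ (18 * m + 20)\<close>, which is the origin of
  \<open>2 ^ 20\<close>. The factor \<open>5\<close> comes from
  \<open>2 ^ (m + 2) + 1 \<le> 5 * 2 ^ m\<close> for the number of positions.\<close>

lemma Abar_upto_spanning:
  assumes Q: "\<And>k. Q k \<le> 2 ^ (9 * k + 1)"
  shows "\<exists>Y. finite Y \<and> card Y \<le> (5 * 2 ^ 20) * D ^ 20 \<and> Abar_upto D \<subseteq> falg.span Y + E_space U"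
proof -
  let ?c = "5 * 2 ^ 20 * D ^ 19"
  have "\<exists>X. finite X \<and> card X \<le> ?c \<and> Hom n \<subseteq> falg.span X + E_deg U n" if n: "n \<in> {1..D}" for n
  proof -
    have "1 \<le> n" using n by simp
    then obtain m where m: "2 ^ m \<le> n" "n < 2 ^ Suc m" by (rule dyadic_exists)
    have "(Q (Suc m))\<^sup>2 \<le> (2 ^ (9 * Suc m + 1))\<^sup>2" using Q by (rule power_mono) simp
    moreover have "(2::nat) ^ Suc (Suc m) + 1 \<le> 5 * 2 ^ m" by simp
    ultimately have "(2 ^ Suc (Suc m) + 1) * (Q (Suc m))\<^sup>2 \<le> 5 * 2 ^ m * (2 ^ (9 * Suc m + 1))\<^sup>2"
      by (intro mult_mono) auto
    also have "\<dots> = 5 * 2 ^ 20 * (2 ^ m) ^ 19"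
      by (simp add: power_add power_mult[symmetric] power2_eq_square power_add[symmetric] algebra_simps)
    also have "\<dots> \<le> ?c" using m(1) n by (intro mult_left_mono power_mono) auto
    finally show ?thesis
      using cod_mono[OF cod_E_deg[OF m] order_refl] unfolding cod_def by blast
  qed
  then obtain X where X: "\<And>n. n \<in> {1..D} \<Longrightarrow>
      finite (X n) \<and> card (X n) \<le> ?c \<and> Hom n \<subseteq> falg.span (X n) + E_deg U n" by metis
  let ?Y = "\<Union>n\<in>{1..D}. X n"
  have "card ?Y \<le> (\<Sum>n\<in>{1..D}. card (X n))" by (rule card_UN_le) simp
  also have "\<dots> \<le> (\<Sum>n\<in>{1..D}. ?c)" using X by (intro sum_mono) blast
  also have "\<dots> = (5 * 2 ^ 20) * D ^ 20" by (simp add: power_Suc[symmetric] del: power_Suc)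
  finally have card: "card ?Y \<le> (5 * 2 ^ 20) * D ^ 20" .
  have S: "falg.subspace (falg.span ?Y + E_space U)" by (simp add: subspace_plus subspace_E)
  have "Abar_upto D \<subseteq> falg.span ?Y + E_space U"
  proof
    fix p :: "'k falg" assume p: "p \<in> Abar_upto D"
    have "mon_length ` Poly_Mapping.keys p \<subseteq> {1..D}"
      using p Abar_keys(1) by (fastforce simp: Abar_upto_def)
    then have "p = (\<Sum>n\<in>{1..D}. hcomp n p)" by (intro hcomp_sum_eq) auto
    also have "\<dots> \<in> falg.span ?Y + E_space U"
    proof (rule falg.subspace_sum[OF S])
      fix n assume n: "n \<in> {1..D}"
      have "hcomp n p \<in> falg.span (X n) + E_deg U n" using X[OF n] hcomp_in_Hom by blast
      moreover have "falg.span (X n) \<subseteq> falg.span ?Y" using n by (intro falg.span_mono) blast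
      moreover have "E_deg U n \<subseteq> E_space U" using n by (intro E_deg_E_space) simp
      ultimately show "hcomp n p \<in> falg.span ?Y + E_space U"
        using set_plus_mono2 by blast
    qed
    finally show "p \<in> falg.span ?Y + E_space U" .
  qed
  then show ?thesis using card X by (intro exI[of _ ?Y]) auto
qed

end

section \<open>Consequences of an arbitrary construction datum\<close>

lemma construction_datumD:
  assumes "construction_datum Z f F U V"
  shows "f ` Z = Abar"
    and "\<forall>i\<in>Z. falg.subspace (F i) \<and> F i \<subseteq> Hom (2 ^ 2 ^ i) \<and>
      falg.dim (F i) < 2 ^ 2 ^ (i + 1) - 2 \<and>
      generated_ideal (f i ^ (10 * w_exp i)) \<subseteq> B_ideal (w_exp i) (F i)"
    and "\<forall>n. n \<notin> S_exc \<longrightarrow> falg.dim (V (2 ^ n)) = 2"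
    and "\<forall>i\<ge>5. \<forall>j\<le>i. falg.dim (V (2 ^ (2 ^ i - i - 1 + j))) = 2 ^ 2 ^ j"
    and "\<forall>n. \<exists>W \<subseteq> (\<Union>d. Mon d). V (2 ^ n) = falg.span W"
    and "\<forall>i\<in>Z. F i \<subseteq> U (2 ^ 2 ^ i)"
  using assms unfolding construction_datum_def by - ((elim conjE, assumption)+)

lemma construction_datum_dim:
  assumes "construction_datum Z f F U V"
  shows "n \<notin> S_exc \<Longrightarrow> falg.dim (V (2 ^ n)) = 2"
    and "5 \<le> i \<Longrightarrow> j \<le> i \<Longrightarrow> falg.dim (V (2 ^ (2 ^ i - i - 1 + j))) = 2 ^ 2 ^ j"
  using construction_datumD(3,4)[OF assms] by simp_all

lemma construction_datum_nonzero:
  assumes "construction_datum Z f F U V"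
  shows "V (2 ^ k) \<noteq> {0}"
proof
  assume "V (2 ^ k) = {0}"
  then have "V (2 ^ k) = falg.span {}" by simp
  then have "falg.dim (V (2 ^ k)) = 0"
    using falg.dim_span_eq_card_independent[OF falg.independent_empty] by (metis card.empty)
  moreover have "falg.dim (V (2 ^ k)) \<noteq> 0"
  proof (cases "k \<in> S_exc")
    case True
    then show ?thesis using construction_datum_dim(2)[OF assms] unfolding S_exc_iff by auto
  next
    case False
    then show ?thesis using construction_datum_dim(1)[OF assms] by simp
  qed
  ultimately show False by simp
qed

lemma construction_datum_splitting:
  assumes "construction_datum Z f F U V"
  shows "degree_splitting U V"
proof
  fix k
  show "V (2 ^ k) \<noteq> {0}" by (rule construction_datum_nonzero[OF assms])
qed (use assms in \<open>simp_all add: construction_datum_def\<close>)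

text \<open>Spanning by monomials enters here: a nonzero space spanned by words contains a word, and
  squares of words witness non-nilpotency.\<close>

lemma construction_datum_word:
  assumes "construction_datum Z f F U V"
  shows "\<exists>w. wd w \<in> V (2 ^ k)"
proof -
  obtain W where W: "W \<subseteq> (\<Union>d. Mon d)" "V (2 ^ k) = falg.span W"
    using spec[OF construction_datumD(5)[OF assms], of k] by (elim exE conjE)
  have "W \<noteq> {}"
  proof
    assume "W = {}"
    then have "V (2 ^ k) = {0}" using W(2) by (simp only: falg.span_empty)
    then show False using construction_datum_nonzero[OF assms] by (rule notE[rotated])
  qed
  then obtain x where x: "x \<in> W" by blast
  then obtain d where "x \<in> Mon d" using W(1) by blast
  then obtain w where w: "x = wd w" unfolding Mon_def by blast
  have "x \<in> V (2 ^ k)" unfolding W(2) using x by (rule falg.span_base)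
  then show ?thesis unfolding w by (rule exI)
qed

text \<open>The positions in \<open>B_ideal\<close> are multiples of \<open>4 * 2 ^ 2 ^ i\<close>,
  hence aligned with the blocks of level \<open>2 ^ i\<close>. The exponent exceeds
  \<open>2 ^ 2 ^ i\<close>, so the power has no components of smaller degree.\<close>

lemma construction_datum_power_in_E:
  assumes D: "construction_datum Z f F U V" and p: "p \<in> Abar"
  shows "\<exists>n\<ge>1. p ^ n \<in> E_space U"
proof -
  interpret degree_splitting U V by (rule construction_datum_splitting[OF D])
  obtain i where i: "i \<in> Z" "p = f i"
    using p construction_datumD(1)[OF D] by blast
  let ?n = "10 * w_exp i"
  have "F i \<subseteq> U (2 ^ 2 ^ i)" "generated_ideal (p ^ ?n) \<subseteq> B_ideal (4 * 2 ^ 2 ^ i) (F i)"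
    using construction_datumD(2,6)[OF D] i unfolding w_exp_def by blast+
  moreover have "hcomp n (p ^ ?n) = 0" if "n < 2 ^ 2 ^ i" for n
    using that by (intro hcomp_power_eq_0[OF p]) (simp add: w_exp_def)
  ultimately have "p ^ ?n \<in> E_space U" by (rule E_spaceI_B_ideal)
  moreover have "1 \<le> ?n" by (simp add: w_exp_def)
  ultimately show ?thesis by blast
qed

theorem theorem17:
  assumes "countable (UNIV :: 'k::field set)"
  shows "(\<exists>Z (f :: nat \<Rightarrow> 'k falg) F U V. construction_datum Z f F U V) \<and>
    (\<forall>Z (f :: nat \<Rightarrow> 'k falg) F U V. construction_datum Z f F U V \<longrightarrow>
      E_space U \<subseteq> Abar \<and>
      assoc_algebra.two_sided_ideal class_ring Abar_algebra (E_space U) \<and>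
      (let R = quot_algebra Abar_algebra (E_space U) in
        assoc_algebra class_ring R \<and>
        assoc_algebra.finitely_generated class_ring R \<and>
        assoc_algebra.nil R \<and>
        \<not> assoc_algebra.nilpotent class_ring R \<and>
        assoc_algebra.GKdim class_ring R \<le> 20))"
proof (intro conjI allI impI construction_datum_exists[OF assms])
  fix Z and f :: "nat \<Rightarrow> 'k falg" and F U V
  assume D: "construction_datum Z f F U V"
  interpret degree_splitting U V by (rule construction_datum_splitting[OF D])
  let ?E = "E_space U"
  show "?E \<subseteq> Abar" by (rule E_space_Abar)
  \<comment> \<open>The identity map presents the augmentation ideal itself, so the ideal property
    of \<open>E\<close> is proved within the same framework as the claims on the quotient.\<close>
  interpret A: falg_image "\<lambda>p. p" Abar_algebra "{0} :: 'k falg set" by (rule falg_image_id)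
  show "A.two_sided_ideal ?E"
    using A.two_sided_idealI[OF subspace_E E_space_Abar] E_space_mult by simp
  interpret R: falg_image "\<lambda>p. (\<lambda>e. e + p) ` ?E" "quot_algebra Abar_algebra ?E" ?E
    using E_space_mult by (intro falg_image_quot subspace_E E_space_Abar) blast
  have "R.nil" by (rule R.nilI[OF construction_datum_power_in_E[OF D]])
  moreover have "\<not> R.nilpotent"
  proof (rule R.not_nilpotentI)
    fix n
    obtain u where "mon_length u = 2 ^ n" "wd u \<notin> ?E"
      by (rule word_not_in_E[OF construction_datum_word[OF D]])
    then show "\<exists>u. n \<le> mon_length u \<and> wd u \<notin> ?E" using less_exp[of n] by (metis less_imp_le)
  qed
  moreover have "R.GKdim \<le> 20"
  proof -
    have "Q k \<le> 2 ^ (9 * k + 1)" for k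
      unfolding Q_def dV_def by (rule prod_dims_le) (rule construction_datum_dim[OF D]; assumption)+
    from R.GKdim_le[OF subspace_E _ Abar_upto_spanning[OF this]]
    have "R.GKdim \<le> ereal (real 20)" by simp
    then show ?thesis by simp
  qed
  ultimately show "let R = quot_algebra Abar_algebra ?E in
        assoc_algebra class_ring R \<and> assoc_algebra.finitely_generated class_ring R \<and>
        assoc_algebra.nil R \<and> \<not> assoc_algebra.nilpotent class_ring R \<and>
        assoc_algebra.GKdim class_ring R \<le> 20"
    using R.is_assoc_algebra R.finitely_generated by (simp add: Let_def)
qed

end
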